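(* Let $M$ be a countable transitive model of $\mathsf{ZFC}$ and let $\mathbb{C}$ be Cohen forcing in its idealized presentation. Then the equivalence relation $\equiv^\mathbb{C}_M$ on $\mathcal{C}$ is an increasing union of countably many hyperfinite Borel equivalence relations. In particular, $\equiv^\mathbb{C}_M$ is (Fréchet) amenable.
   Context: $\mathbb{C}$ is the partial order, computed in $M$, of all non-meager Borel subsets of $2^\omega$ ordered by inclusion. For a Borel set $B$ coded in $M$, $B^M$ denotes its interpretation in $M$ and $B$ its interpretation in $\mathbf{V}$. A real $x\in 2^\omega$ is an $M$-generic Cohen real if $\{B^M\in\mathbb{C}: x\in B\}$ is an $M$-generic filter for $\mathbb{C}$ (equivalently, $x$ lies in every comeager Borel set coded in $M$); $\mathcal{C}$ denotes the set of such reals, and for $x,y\in\mathcal{C}$, $x\equiv^\mathbb{C}_M y$ iff $M[x]=M[y]$. A countable Borel equivalence relation is hyperfinite if it is an increasing union of countably many Borel equivalence relations with finite classes. *)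

theory Defs
  imports "HOL-Analysis.Analysis" "HOL-Library.Countable_Set_Type"
begin

section \<open>Hereditarily countable sets\<close>

text \<open>
  The elements of this datatype are the hereditarily countable sets: the constructor is
  injective (extensionality) and every element is well-founded. Every countable transitive
  set consists of hereditarily countable sets, so a countable transitive model of ZFC is a
  countable transitive subset of this type.
\<close>

datatype hc = HC (the_cset: "hc cset")

definition elts :: "hc \<Rightarrow> hc set" where
  "elts a = rcset (the_cset a)"

text \<open>Only meaningful for countable arguments.\<close>

definition hset :: "hc set \<Rightarrow> hc" where
  "hset A = HC (acset A)"

lemma elts_hset [simp]: "countable A \<Longrightarrow> elts (hset A) = A"
  by (simp add: elts_def hset_def)

lemma hset_elts [simp]: "hset (elts a) = a"
  by (simp add: elts_def hset_def rcset_inverse)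

lemma countable_elts [simp]: "countable (elts a)"
  using rcset[of "the_cset a"] by (simp add: elts_def)

lemma hc_ext: "elts a = elts b \<Longrightarrow> a = b"
  by (metis hset_elts)

lemma wf_elts: "wf {(a, b). a \<in> elts b}"
proof (rule wfUNIVI)
  fix P :: "hc \<Rightarrow> bool" and x
  assume step: "\<forall>x. (\<forall>y. (y, x) \<in> {(a, b). a \<in> elts b} \<longrightarrow> P y) \<longrightarrow> P x"
  show "P x"
  proof (induction x)
    case (HC A)
    then show ?case using step by (auto simp: elts_def)
  qed
qed

definition hpair :: "hc \<Rightarrow> hc \<Rightarrow> hc" where
  "hpair a b = hset {hset {a}, hset {a, b}}"

lemma hset_doubleton_eq: "hset {a, b} = hset {c, d} \<longleftrightarrow> {a, b} = {c, d}"
proof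
  assume "hset {a, b} = hset {c, d}"
  then have "elts (hset {a, b}) = elts (hset {c, d})" by (rule arg_cong)
  then show "{a, b} = {c, d}" by simp
qed simp

lemma hpair_inject [simp]: "hpair a b = hpair c d \<longleftrightarrow> a = c \<and> b = d"
  using hset_doubleton_eq[of a a c c] hset_doubleton_eq[of a a c d]
    hset_doubleton_eq[of a b c c] hset_doubleton_eq[of a b c d]
  by (auto simp: hpair_def hset_doubleton_eq doubleton_eq_iff)

definition hsucc :: "hc \<Rightarrow> hc" where
  "hsucc a = hset (insert a (elts a))"

text \<open>The von Neumann numeral of a natural number.\<close>

primrec hnat :: "nat \<Rightarrow> hc" where
  "hnat 0 = hset {}"
| "hnat (Suc n) = hsucc (hnat n)"

text \<open>Graphs of functions on \<open>\<omega>\<close> and on a natural number.\<close>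

definition hseq :: "(nat \<Rightarrow> hc) \<Rightarrow> hc" where
  "hseq f = hset (range (\<lambda>n. hpair (hnat n) (f n)))"

definition hlist :: "hc list \<Rightarrow> hc" where
  "hlist xs = hset ((\<lambda>n. hpair (hnat n) (xs ! n)) ` {..<length xs})"


section \<open>Countable transitive models of ZFC\<close>

datatype fm = Mem nat nat | Eq nat nat | Neg fm | Conj fm fm | All nat fm

text \<open>Satisfaction of a formula of the language of set theory in \<open>(M, \<in>)\<close>.\<close>

primrec sat :: "hc set \<Rightarrow> (nat \<Rightarrow> hc) \<Rightarrow> fm \<Rightarrow> bool" where
  "sat M v (Mem i j) \<longleftrightarrow> v i \<in> elts (v j)"
| "sat M v (Eq i j) \<longleftrightarrow> v i = v j"
| "sat M v (Neg p) \<longleftrightarrow> \<not> sat M v p"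
| "sat M v (Conj p q) \<longleftrightarrow> sat M v p \<and> sat M v q"
| "sat M v (All i p) \<longleftrightarrow> (\<forall>a\<in>M. sat M (v(i := a)) p)"

text \<open>
  Below, each single axiom is written as its relativisation to \<open>M\<close>; the two schemas range
  over all formulas, with the remaining values of \<open>v\<close> as parameters.
\<close>

definition ax_extensionality :: "hc set \<Rightarrow> bool" where
  "ax_extensionality M \<longleftrightarrow>
     (\<forall>x\<in>M. \<forall>y\<in>M. (\<forall>z\<in>M. z \<in> elts x \<longleftrightarrow> z \<in> elts y) \<longrightarrow> x = y)"

definition ax_foundation :: "hc set \<Rightarrow> bool" where
  "ax_foundation M \<longleftrightarrow>
     (\<forall>x\<in>M. (\<exists>y\<in>M. y \<in> elts x) \<longrightarrow>
        (\<exists>y\<in>M. y \<in> elts x \<and> \<not> (\<exists>z\<in>M. z \<in> elts x \<and> z \<in> elts y)))"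

definition ax_pairing :: "hc set \<Rightarrow> bool" where
  "ax_pairing M \<longleftrightarrow>
     (\<forall>x\<in>M. \<forall>y\<in>M. \<exists>z\<in>M. \<forall>w\<in>M. w \<in> elts z \<longleftrightarrow> w = x \<or> w = y)"

definition ax_union :: "hc set \<Rightarrow> bool" where
  "ax_union M \<longleftrightarrow>
     (\<forall>x\<in>M. \<exists>u\<in>M. \<forall>w\<in>M. w \<in> elts u \<longleftrightarrow> (\<exists>y\<in>M. y \<in> elts x \<and> w \<in> elts y))"

definition ax_power_set :: "hc set \<Rightarrow> bool" where
  "ax_power_set M \<longleftrightarrow>
     (\<forall>x\<in>M. \<exists>p\<in>M. \<forall>w\<in>M. w \<in> elts p \<longleftrightarrow> (\<forall>z\<in>M. z \<in> elts w \<longrightarrow> z \<in> elts x))"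

definition ax_infinity :: "hc set \<Rightarrow> bool" where
  "ax_infinity M \<longleftrightarrow>
     (\<exists>x\<in>M. (\<exists>e\<in>M. e \<in> elts x \<and> (\<forall>z\<in>M. z \<notin> elts e)) \<and>
        (\<forall>y\<in>M. y \<in> elts x \<longrightarrow>
           (\<exists>s\<in>M. s \<in> elts x \<and> (\<forall>z\<in>M. z \<in> elts s \<longleftrightarrow> z \<in> elts y \<or> z = y))))"

definition ax_separation :: "hc set \<Rightarrow> bool" where
  "ax_separation M \<longleftrightarrow>
     (\<forall>p v. range v \<subseteq> M \<longrightarrow>
        (\<forall>a\<in>M. \<exists>b\<in>M. \<forall>x\<in>M. x \<in> elts b \<longleftrightarrow> x \<in> elts a \<and> sat M (v(0 := x)) p))"

definition ax_replacement :: "hc set \<Rightarrow> bool" where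
  "ax_replacement M \<longleftrightarrow>
     (\<forall>p v. range v \<subseteq> M \<longrightarrow>
        (\<forall>a\<in>M. (\<forall>x\<in>M. x \<in> elts a \<longrightarrow> (\<exists>!y. y \<in> M \<and> sat M (v(0 := x, 1 := y)) p)) \<longrightarrow>
           (\<exists>b\<in>M. \<forall>x\<in>M. x \<in> elts a \<longrightarrow>
              (\<exists>y\<in>M. y \<in> elts b \<and> sat M (v(0 := x, 1 := y)) p))))"

definition ax_choice :: "hc set \<Rightarrow> bool" where
  "ax_choice M \<longleftrightarrow>
     (\<forall>x\<in>M. (\<forall>y\<in>M. y \<in> elts x \<longrightarrow> (\<exists>z\<in>M. z \<in> elts y)) \<and>
        (\<forall>y\<in>M. \<forall>y'\<in>M. y \<in> elts x \<and> y' \<in> elts x \<and> (\<exists>z\<in>M. z \<in> elts y \<and> z \<in> elts y') \<longrightarrow> y = y')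
        \<longrightarrow> (\<exists>c\<in>M. \<forall>y\<in>M. y \<in> elts x \<longrightarrow> (\<exists>!z. z \<in> M \<and> z \<in> elts y \<and> z \<in> elts c)))"

definition models_ZFC :: "hc set \<Rightarrow> bool" where
  "models_ZFC M \<longleftrightarrow>
     ax_extensionality M \<and> ax_foundation M \<and> ax_pairing M \<and> ax_union M \<and> ax_power_set M \<and>
     ax_infinity M \<and> ax_separation M \<and> ax_replacement M \<and> ax_choice M"

definition ctm_ZFC :: "hc set \<Rightarrow> bool" where
  "ctm_ZFC M \<longleftrightarrow> countable M \<and> (\<forall>a\<in>M. elts a \<subseteq> M) \<and> models_ZFC M"


section \<open>Borel sets, category and Cohen forcing computed in the model\<close>

type_synonym real2 = "nat \<Rightarrow> bool"  \<comment> \<open>\<open>2\<^sup>\<omega>\<close>, with the product topology\<close>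

definition hreal :: "real2 \<Rightarrow> hc" where
  "hreal x = hseq (\<lambda>n. hnat (of_bool (x n)))"

definition hreals :: "real2 set \<Rightarrow> hc" where
  "hreals A = hset (hreal ` A)"

definition hfamily :: "real2 set set \<Rightarrow> hc" where
  "hfamily S = hset (hreals ` S)"

text \<open>The space \<open>2\<^sup>\<omega>\<close> of \<open>M\<close>, its power set in \<open>M\<close>, and the sequences of such subsets in \<open>M\<close>.\<close>

definition cantor_in :: "hc set \<Rightarrow> real2 set" where
  "cantor_in M = {x. hreal x \<in> M}"

definition subsets_in :: "hc set \<Rightarrow> real2 set set" where
  "subsets_in M = {A. A \<subseteq> cantor_in M \<and> hreals A \<in> M}"

definition seqs_in :: "hc set \<Rightarrow> (nat \<Rightarrow> real2 set) set" where
  "seqs_in M = {s. range s \<subseteq> subsets_in M \<and> hseq (\<lambda>n. hreals (s n)) \<in> M}"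

text \<open>
  The basic clopen sets are indexed by finite binary strings, all of which lie in \<open>M\<close>, so the
  topology of \<open>2\<^sup>\<omega>\<close> as computed in \<open>M\<close> is that of the subspace \<open>cantor_in M\<close>, restricted to
  the sets in \<open>subsets_in M\<close>.
\<close>

abbreviation cantor_top :: "hc set \<Rightarrow> real2 topology" where
  "cantor_top M \<equiv> top_of_set (cantor_in M)"

definition sigma_algebra_in :: "hc set \<Rightarrow> real2 set set \<Rightarrow> bool" where
  "sigma_algebra_in M S \<longleftrightarrow>
     S \<subseteq> subsets_in M \<and> hfamily S \<in> M \<and> {} \<in> S \<and> (\<forall>A\<in>S. cantor_in M - A \<in> S) \<and>
     (\<forall>s\<in>seqs_in M. range s \<subseteq> S \<longrightarrow> (\<Union>n. s n) \<in> S)"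

definition borel_in :: "hc set \<Rightarrow> real2 set set" where
  "borel_in M =
     {A \<in> subsets_in M. \<forall>S. sigma_algebra_in M S \<and>
        (\<forall>U\<in>subsets_in M. openin (cantor_top M) U \<longrightarrow> U \<in> S) \<longrightarrow> A \<in> S}"

definition nowhere_dense_in :: "hc set \<Rightarrow> real2 set \<Rightarrow> bool" where
  "nowhere_dense_in M A \<longleftrightarrow> cantor_top M interior_of (cantor_top M closure_of A) = {}"

definition meager_in :: "hc set \<Rightarrow> real2 set \<Rightarrow> bool" where
  "meager_in M A \<longleftrightarrow> (\<exists>s\<in>seqs_in M. (\<forall>n. nowhere_dense_in M (s n)) \<and> A \<subseteq> (\<Union>n. s n))"

text \<open>
  The underlying set of \<open>\<complex>\<close>; the order is inclusion. As an element of \<open>M\<close>, the condition \<open>A\<close>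
  is \<open>hreals A\<close>.
\<close>

definition cohen_poset :: "hc set \<Rightarrow> real2 set set" where
  "cohen_poset M = {A \<in> borel_in M. \<not> meager_in M A}"

text \<open>
  Borel codes are well-founded countably branching trees. Being such a tree is absolute for
  transitive models, so the codes in \<open>M\<close> are those \<open>c\<close> with \<open>hcode c \<in> M\<close>.
\<close>

datatype bcode = Basic "bool list" | Complement bcode | CUnion "nat \<Rightarrow> bcode"

primrec hcode :: "bcode \<Rightarrow> hc" where
  "hcode (Basic s) = hpair (hnat 0) (hlist (map (\<lambda>b. hnat (of_bool b)) s))"
| "hcode (Complement c) = hpair (hnat 1) (hcode c)"
| "hcode (CUnion f) = hpair (hnat 2) (hseq (\<lambda>n. hcode (f n)))"

text \<open>
  The Borel set with a given code, computed in the space \<open>X\<close>: with \<open>X = UNIV\<close> this is its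
  interpretation in the universe, with \<open>X = cantor_in M\<close> its interpretation in \<open>M\<close>.
\<close>

primrec interp :: "real2 set \<Rightarrow> bcode \<Rightarrow> real2 set" where
  "interp X (Basic s) = {x \<in> X. \<forall>i<length s. x i = s ! i}"
| "interp X (Complement c) = X - interp X c"
| "interp X (CUnion f) = (\<Union>n. interp X (f n))"

definition cohen_filter :: "hc set \<Rightarrow> real2 \<Rightarrow> real2 set set" where
  "cohen_filter M x =
     {interp (cantor_in M) c | c.
        hcode c \<in> M \<and> interp (cantor_in M) c \<in> cohen_poset M \<and> x \<in> interp UNIV c}"

definition dense_subset :: "real2 set set \<Rightarrow> real2 set set \<Rightarrow> bool" where
  "dense_subset P D \<longleftrightarrow> D \<subseteq> P \<and> (\<forall>p\<in>P. \<exists>d\<in>D. d \<subseteq> p)"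

definition is_filter_on :: "real2 set set \<Rightarrow> real2 set set \<Rightarrow> bool" where
  "is_filter_on P G \<longleftrightarrow>
     G \<subseteq> P \<and> G \<noteq> {} \<and> (\<forall>p\<in>G. \<forall>q\<in>P. p \<subseteq> q \<longrightarrow> q \<in> G) \<and>
     (\<forall>p\<in>G. \<forall>q\<in>G. \<exists>r\<in>G. r \<subseteq> p \<and> r \<subseteq> q)"

definition generic_filter :: "hc set \<Rightarrow> real2 set set \<Rightarrow> real2 set set \<Rightarrow> bool" where
  "generic_filter M P G \<longleftrightarrow>
     is_filter_on P G \<and> (\<forall>D. dense_subset P D \<and> hfamily D \<in> M \<longrightarrow> G \<inter> D \<noteq> {})"

definition cohen_reals :: "hc set \<Rightarrow> real2 set" where
  "cohen_reals M = {x. generic_filter M (cohen_poset M) (cohen_filter M x)}"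


section \<open>Generic extensions\<close>

text \<open>The value of the name \<open>t\<close> under the filter \<open>G\<close>: the set of values of \<open>s\<close> with \<open>(s, p) \<in> t\<close> for some \<open>p \<in> G\<close>.\<close>

function val :: "hc set \<Rightarrow> hc \<Rightarrow> hc" where
  "val G t = hset (val G ` {s. \<exists>p\<in>G. hpair s p \<in> elts t})"
  by auto
termination
proof (relation "inv_image ({(a, b). a \<in> elts b}\<^sup>+) snd")
  show "wf (inv_image ({(a, b). a \<in> elts b}\<^sup>+) (snd :: hc set \<times> hc \<Rightarrow> hc))"
    by (intro wf_inv_image wf_trancl wf_elts)
next
  fix G t s
  let ?R = "{(a, b). a \<in> elts b}"
  assume "s \<in> {s. \<exists>p\<in>G. hpair s p \<in> elts t}"
  then obtain p where "hpair s p \<in> elts t" by auto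
  moreover have "hset {s} \<in> elts (hpair s p)" "s \<in> elts (hset {s})"
    by (simp_all add: hpair_def)
  ultimately have "(s, hset {s}) \<in> ?R" "(hset {s}, hpair s p) \<in> ?R" "(hpair s p, t) \<in> ?R"
    by simp_all
  then have "(s, t) \<in> ?R\<^sup>+"
    by (blast intro: r_into_trancl trancl_into_trancl)
  then show "((G, s), (G, t)) \<in> inv_image ({(a, b). a \<in> elts b}\<^sup>+) snd" by simp
qed

declare val.simps [simp del]

definition generic_ext :: "hc set \<Rightarrow> real2 \<Rightarrow> hc set" where
  "generic_ext M x = val (hreals ` cohen_filter M x) ` M"

definition cohen_equiv :: "hc set \<Rightarrow> real2 rel" where
  "cohen_equiv M =
     {(x, y). x \<in> cohen_reals M \<and> y \<in> cohen_reals M \<and> generic_ext M x = generic_ext M y}"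


section \<open>Borel equivalence relations\<close>

definition borel_equiv :: "'a::topological_space set \<Rightarrow> 'a rel \<Rightarrow> bool" where
  "borel_equiv X E \<longleftrightarrow> X \<in> sets borel \<and> equiv X E \<and> E \<in> sets borel"

definition countable_borel_equiv :: "'a::topological_space set \<Rightarrow> 'a rel \<Rightarrow> bool" where
  "countable_borel_equiv X E \<longleftrightarrow> borel_equiv X E \<and> (\<forall>x\<in>X. countable (E `` {x}))"

definition finite_borel_equiv :: "'a::topological_space set \<Rightarrow> 'a rel \<Rightarrow> bool" where
  "finite_borel_equiv X E \<longleftrightarrow> borel_equiv X E \<and> (\<forall>x\<in>X. finite (E `` {x}))"

definition hyperfinite :: "'a::topological_space set \<Rightarrow> 'a rel \<Rightarrow> bool" where
  "hyperfinite X E \<longleftrightarrow> countable_borel_equiv X E \<and>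
     (\<exists>F :: nat \<Rightarrow> 'a rel. (\<forall>n. finite_borel_equiv X (F n)) \<and> incseq F \<and> E = (\<Union>n. F n))"


section \<open>Frechet amenability\<close>

text \<open>
  The iterated Frechet filters of Jackson, Kechris and Louveau, carried over to the index set
  \<open>nat\<close> by a pairing function. \<open>A\<close> belongs to \<open>filter_sum F\<close> iff, for all but finitely many
  \<open>n\<close>, the \<open>n\<close>-th section of \<open>A\<close> belongs to \<open>F n\<close>.
\<close>

definition filter_sum :: "(nat \<Rightarrow> nat filter) \<Rightarrow> nat filter" where
  "filter_sum F =
     Abs_filter (\<lambda>P. \<forall>\<^sub>F n in cofinite. \<forall>\<^sub>F j in F n. P (prod_encode (n, j)))"

lemma eventually_filter_sum:
  "eventually P (filter_sum F) \<longleftrightarrow>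
     (\<forall>\<^sub>F n in cofinite. \<forall>\<^sub>F j in F n. P (prod_encode (n, j)))"
  unfolding filter_sum_def
proof (rule eventually_Abs_filter, standard)
  fix P Q :: "nat \<Rightarrow> bool"
  assume "\<forall>\<^sub>F n in cofinite. \<forall>\<^sub>F j in F n. P (prod_encode (n, j))"
    and "\<forall>\<^sub>F n in cofinite. \<forall>\<^sub>F j in F n. Q (prod_encode (n, j))"
  then show "\<forall>\<^sub>F n in cofinite. \<forall>\<^sub>F j in F n. P (prod_encode (n, j)) \<and> Q (prod_encode (n, j))"
    by eventually_elim (rule eventually_conj)
next
  fix P Q :: "nat \<Rightarrow> bool"
  assume PQ: "\<forall>x. P x \<longrightarrow> Q x"
    and "\<forall>\<^sub>F n in cofinite. \<forall>\<^sub>F j in F n. P (prod_encode (n, j))"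
  from this(2) show "\<forall>\<^sub>F n in cofinite. \<forall>\<^sub>F j in F n. Q (prod_encode (n, j))"
    by eventually_elim (use PQ in \<open>auto elim: eventually_mono\<close>)
qed simp

text \<open>
  The index is a countable ordinal \<open>\<alpha> \<ge> 1\<close>, represented as a von Neumann ordinal. At a limit,
  the filter depends on a choice of an increasing sequence of ordinals converging to it.
\<close>

inductive iterated_frechet :: "hc \<Rightarrow> nat filter \<Rightarrow> bool" where
  one: "iterated_frechet (hnat 1) cofinite"
| succ: "iterated_frechet \<alpha> F \<Longrightarrow> iterated_frechet (hsucc \<alpha>) (filter_sum (\<lambda>_. F))"
| limit: "(\<And>n. iterated_frechet (\<beta> n) (F n)) \<Longrightarrow> (\<And>n. \<beta> n \<in> elts (\<beta> (Suc n))) \<Longrightarrow>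
     iterated_frechet (hset (\<Union>n. elts (\<beta> n))) (filter_sum F)"

text \<open>The functions \<open>f n\<close> are Borel functions on \<open>E\<close>; \<open>f n (x, \<cdot>)\<close> is a unit vector of \<open>\<ell>\<^sup>1\<close> of the class of \<open>x\<close>.\<close>

definition filter_amenable ::
    "nat filter \<Rightarrow> 'a::topological_space set \<Rightarrow> 'a rel \<Rightarrow> bool" where
  "filter_amenable \<F> X E \<longleftrightarrow> countable_borel_equiv X E \<and>
     (\<exists>f :: nat \<Rightarrow> 'a \<times> 'a \<Rightarrow> real.
        (\<forall>n. f n \<in> borel_measurable (restrict_space borel E)) \<and>
        (\<forall>n. \<forall>p\<in>E. 0 \<le> f n p) \<and>
        (\<forall>n. \<forall>x\<in>X. ((\<lambda>y. f n (x, y)) has_sum 1) (E `` {x})) \<and>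
        (\<forall>(x, y)\<in>E.
           ((\<lambda>n. \<Sum>\<^sub>\<infinity>z\<in>E `` {x}. \<bar>f n (x, z) - f n (y, z)\<bar>) \<longlongrightarrow> 0) \<F>))"

definition frechet_amenable :: "'a::topological_space set \<Rightarrow> 'a rel \<Rightarrow> bool" where
  "frechet_amenable X E \<longleftrightarrow> (\<exists>\<alpha> \<F>. iterated_frechet \<alpha> \<F> \<and> filter_amenable \<F> X E)"

end

theory Submission
  imports Defs
begin

text \<open>
  If \<open>M[x] = M[y]\<close>, then \<open>y = f x\<close> and \<open>x = g y\<close> for two of the countably many functions coded in
  \<open>M\<close>: \<open>f\<close> evaluates at \<open>x\<close> a name in \<open>M\<close> for a subset of \<open>\<omega>\<close>, and on Cohen reals it is decided by
  finite strings. Enumerate these functions, let \<open>S n\<close> be the graph relating \<open>x\<close> and \<open>y\<close> with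
  \<open>M[x] = M[y]\<close> that are mapped to each other by some of the first \<open>n\<close> of them, and let \<open>E n\<close> be its
  connectedness relation.

  \<open>E n\<close> is hyperfinite by a variant of generic hyperfiniteness carried out in \<open>M\<close>. Below every
  string there is a string \<open>s\<close> such that each of the finitely many compositions of boundedly many of
  the first \<open>n\<close> functions either fixes all Cohen reals in the cylinder of \<open>s\<close> or moves all of them
  out of it. Choosing such strings in \<open>M\<close> gives cylinders covering all Cohen reals, the \<open>k\<close>-th of
  which contains no two points at positive distance at most \<open>2 ^ (k + 1)\<close> in \<open>S n\<close>. Then the
  components of \<open>S n\<close> in the union of the first \<open>k\<close> cylinders have diameter less than \<open>2 ^ (k + 1)\<close>,
  so they are finite, and they increase to the classes of \<open>E n\<close>.

  The normalized counting measures on these finite classes witness amenability for the square of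
  the Frechet filter.
\<close>

section \<open>Definability over a transitive model\<close>

text \<open>The enumeration of all codes lies outside \<open>M\<close>, since the codes do not form
  a countable set in \<open>M\<close>, whereas each finite set of codes is in \<open>M\<close>. Only
  for a finite set can the strings be chosen inside \<open>M\<close>, and only then does genericity
  put every Cohen real into a chosen cylinder. Hence the argument yields hyperfiniteness of each
  \<open>E n\<close>, not of the whole relation.

  The bound \<open>2 ^ (k + 1)\<close> comes from a recursion for diameters: adding a set without
  two points at positive distance at most \<open>d + 2\<close> to a set whose components have
  diameter at most \<open>d\<close> gives components of diameter at most \<open>2 * d + 2\<close>.
  Starting with \<open>d = 0\<close>, this produces \<open>2 ^ (k + 1) - 2\<close>.

  Whatever has to happen in \<open>M\<close> is expressed by predicates definable over
  \<open>M\<close>, to which Separation and genericity apply. Every Borel set of \<open>M\<close>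
  has the Baire property there, so a condition belongs to the generic filter iff it is comeager in a
  cylinder around the real. This reduces forcing to finite strings.\<close>

abbreviation tl_env :: "(nat \<Rightarrow> hc) \<Rightarrow> nat \<Rightarrow> hc" where
  "tl_env c \<equiv> (\<lambda>n. c (Suc n))"

definition cons_env :: "hc \<Rightarrow> (nat \<Rightarrow> hc) \<Rightarrow> nat \<Rightarrow> hc" where
  "cons_env x c n = (case n of 0 \<Rightarrow> x | Suc m \<Rightarrow> c m)"

lemma cons_env_simps [simp]: "cons_env x c 0 = x" "cons_env x c (Suc n) = c n"
  "(\<lambda>n. cons_env x c (Suc n)) = c"
  by (simp_all add: cons_env_def)

primrec rename_fm :: "(nat \<Rightarrow> nat) \<Rightarrow> fm \<Rightarrow> fm" where
  "rename_fm f (Mem i j) = Mem (f i) (f j)"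
| "rename_fm f (Eq i j) = Eq (f i) (f j)"
| "rename_fm f (Neg p) = Neg (rename_fm f p)"
| "rename_fm f (Conj p q) = Conj (rename_fm f p) (rename_fm f q)"
| "rename_fm f (All i p) = All (f i) (rename_fm f p)"

text \<open>Bound variables are renamed along with the free ones, so injectivity of \<open>f\<close>
  is what excludes capture.\<close>

lemma sat_rename_fm:
  assumes "inj f"
  shows "sat M v (rename_fm f p) \<longleftrightarrow> sat M (\<lambda>i. v (f i)) p"
proof (induction p arbitrary: v)
  case (All i p)
  have "(\<lambda>j. (v(f i := a)) (f j)) = (\<lambda>j. v (f j))(i := a)" for a
    using assms by (auto simp: fun_eq_iff inj_eq)
  then show ?case by (simp add: All)
qed simp_all

text \<open>Even variables carry the environment, odd ones the parameters.\<close>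

definition merge_env :: "(nat \<Rightarrow> hc) \<Rightarrow> (nat \<Rightarrow> hc) \<Rightarrow> nat \<Rightarrow> hc" where
  "merge_env w c i = (if even i then c (i div 2) else w (i div 2))"

lemma merge_env_simps [simp]: "merge_env w c (2 * n) = c n" "merge_env w c (Suc (2 * n)) = w n"
  by (simp_all add: merge_env_def)

lemma range_merge_env: "range w \<subseteq> M \<Longrightarrow> range c \<subseteq> M \<Longrightarrow> range (merge_env w c) \<subseteq> M"
  unfolding merge_env_def by (auto simp: image_subset_iff)

lemma range_cons_env: "x \<in> M \<Longrightarrow> range c \<subseteq> M \<Longrightarrow> range (cons_env x c) \<subseteq> M"
  by (auto simp: cons_env_def image_subset_iff split: nat.split)

text \<open>
  The argument of a definable predicate is an environment \<open>c\<close> in the style of de Bruijn: \<open>c 0\<close> is the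
  variable bound last and \<open>tl_env c\<close> the outer environment. The rules below then apply, by
  \<open>intro\<close>, to predicates written in ordinary HOL syntax.
\<close>

definition definable :: "hc set \<Rightarrow> ((nat \<Rightarrow> hc) \<Rightarrow> bool) \<Rightarrow> bool" where
  "definable M P \<longleftrightarrow>
     (\<exists>p w. range w \<subseteq> M \<and> (\<forall>c. range c \<subseteq> M \<longrightarrow> (P c \<longleftrightarrow> sat M (merge_env w c) p)))"

text \<open>Totality on \<open>M\<close> is part of the notion: it lets
  \<open>definable_subst\<close> express a substitution by the clause \<open>x = t c\<close> under a
  quantifier over \<open>M\<close>.\<close>

definition definable_term :: "hc set \<Rightarrow> ((nat \<Rightarrow> hc) \<Rightarrow> hc) \<Rightarrow> bool" where
  "definable_term M t \<longleftrightarrow> (\<forall>c. range c \<subseteq> M \<longrightarrow> t c \<in> M) \<and> definable M (\<lambda>c. c 0 = t (tl_env c))"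

lemma definableI:
  assumes "range w \<subseteq> M" "\<And>c. range c \<subseteq> M \<Longrightarrow> P c \<longleftrightarrow> sat M (merge_env w c) p"
  shows "definable M P"
  using assms unfolding definable_def by blast

lemma definable_cong:
  assumes "\<And>c. range c \<subseteq> M \<Longrightarrow> P c = Q c" "definable M Q"
  shows "definable M P"
  using assms unfolding definable_def by (metis (no_types, lifting))

lemma definable_not:
  assumes "definable M P" shows "definable M (\<lambda>c. \<not> P c)"
proof -
  obtain p w where "range w \<subseteq> M" "\<And>c. range c \<subseteq> M \<Longrightarrow> P c \<longleftrightarrow> sat M (merge_env w c) p"
    using assms unfolding definable_def by blast
  then show ?thesis by (intro definableI[of w _ _ "Neg p"]) auto
qed

lemma definable_conj:
  assumes "definable M P" "definable M Q" shows "definable M (\<lambda>c. P c \<and> Q c)"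
proof -
  obtain p w where p: "range w \<subseteq> M" "\<And>c. range c \<subseteq> M \<Longrightarrow> P c \<longleftrightarrow> sat M (merge_env w c) p"
    using assms(1) unfolding definable_def by blast
  obtain q u where q: "range u \<subseteq> M" "\<And>c. range c \<subseteq> M \<Longrightarrow> Q c \<longleftrightarrow> sat M (merge_env u c) q"
    using assms(2) unfolding definable_def by blast
  \<comment> \<open>The two parameter sequences are interleaved: \<open>f\<close> sends parameter
    slot \<open>k\<close> to slot \<open>2 * k\<close>, \<open>g\<close> sends it to slot
    \<open>2 * k + 1\<close>, and both fix the environment variables.\<close>
  define f where "f i = (if even i then i else 2 * i - 1)" for i :: nat
  define g where "g i = (if even i then i else 2 * i + 1)" for i :: nat
  have inj: "inj f" "inj g"
    by (rule injI, simp add: f_def g_def split: if_splits; presburger)+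
  have f: "merge_env (merge_env u w) c (f i) = merge_env w c i" for c i
  proof (cases "even i")
    case False
    then obtain k where "i = Suc (2 * k)" by (metis oddE Suc_eq_plus1)
    then have "f i = Suc (2 * (2 * k))" by (simp add: f_def)
    then show ?thesis using \<open>i = Suc (2 * k)\<close> by (simp only: merge_env_simps)
  qed (simp add: f_def merge_env_def)
  have g: "merge_env (merge_env u w) c (g i) = merge_env u c i" for c i
  proof (cases "even i")
    case False
    then obtain k where "i = Suc (2 * k)" by (metis oddE Suc_eq_plus1)
    then have "g i = Suc (2 * Suc (2 * k))" by (simp add: g_def)
    then show ?thesis using \<open>i = Suc (2 * k)\<close> by (simp only: merge_env_simps)
  qed (simp add: g_def merge_env_def)
  show ?thesis
    using p q inj by (intro definableI[of "merge_env u w" _ _ "Conj (rename_fm f p) (rename_fm g q)"])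
      (simp_all add: sat_rename_fm f g range_merge_env)
qed

lemma definable_all:
  assumes "definable M (\<lambda>c. P (c 0) (tl_env c))"
  shows "definable M (\<lambda>c. \<forall>x\<in>M. P x c)"
proof -
  have "M \<noteq> {}" using assms by (auto simp: definable_def)
  then obtain d where d: "d \<in> M" by blast
  obtain p w where p: "range w \<subseteq> M"
    "\<And>c. range c \<subseteq> M \<Longrightarrow> P (c 0) (tl_env c) \<longleftrightarrow> sat M (merge_env w c) p"
    using assms unfolding definable_def by blast
  \<comment> \<open>The even variables all belong to the environment, so the bound variable moves to
    1, the first parameter slot. The dummy \<open>d\<close> in front of the parameters frees this
    slot, and the other environment variables move down by one place.\<close>
  define f where "f i = (if i = 0 then 1 else if even i then i - 2 else i + 2)" for i :: nat
  have inj: "inj f"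
    by (rule injI, simp add: f_def split: if_splits; presburger)
  have f: "(\<lambda>i. ((merge_env (cons_env d w) c)(1 := x)) (f i)) = merge_env w (cons_env x c)" for c x
  proof
    fix i
    consider "i = 0" | k where "i = 2 * Suc k" | k where "i = Suc (2 * k)"
      by (metis evenE oddE not0_implies_Suc mult_0_right Suc_eq_plus1)
    then show "((merge_env (cons_env d w) c)(1 := x)) (f i) = merge_env w (cons_env x c) i"
      by cases (auto simp: f_def merge_env_def)
  qed
  have "(\<forall>x\<in>M. P x c) \<longleftrightarrow> sat M (merge_env (cons_env d w) c) (All 1 (rename_fm f p))"
    if c: "range c \<subseteq> M" for c
  proof -
    have "P x c \<longleftrightarrow> sat M (merge_env w (cons_env x c)) p" if "x \<in> M" for x
    proof -
      show ?thesis using p(2)[OF range_cons_env[OF that c]] by simp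
    qed
    then show ?thesis by (simp add: sat_rename_fm[OF inj] f del: One_nat_def fun_upd_apply)
  qed
  moreover have "range (cons_env d w) \<subseteq> M"
    using p(1) d by (intro range_cons_env)
  ultimately show ?thesis by (rule definableI[rotated])
qed

lemma definable_rename:
  assumes "definable M P" "inj f" shows "definable M (\<lambda>c. P (\<lambda>i. c (f i)))"
proof -
  obtain p w where p: "range w \<subseteq> M" "\<And>c. range c \<subseteq> M \<Longrightarrow> P c \<longleftrightarrow> sat M (merge_env w c) p"
    using assms unfolding definable_def by blast
  define g where "g i = (if even i then 2 * f (i div 2) else i)" for i :: nat
  have inj: "inj g"
  proof (rule injI)
    fix i j assume *: "g i = g j"
    then have "even i \<longleftrightarrow> even j" by (auto simp: g_def split: if_splits)
    then have "i div 2 = j div 2"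
      using * assms(2) by (cases "even i") (auto simp: g_def inj_eq)
    with \<open>even i \<longleftrightarrow> even j\<close> show "i = j" by presburger
  qed
  have g: "merge_env w c (g i) = merge_env w (\<lambda>i. c (f i)) i" for c i
    by (cases "even i") (auto simp: g_def merge_env_def elim!: evenE oddE)
  show ?thesis
    using p by (intro definableI[of w _ _ "rename_fm g p"])
      (auto simp: sat_rename_fm[OF inj] g image_subset_iff)
qed

lemma definable_or:
  "definable M P \<Longrightarrow> definable M Q \<Longrightarrow> definable M (\<lambda>c. P c \<or> Q c)"
  using definable_not[OF definable_conj[OF definable_not definable_not]] by simp

lemma definable_imp:
  "definable M P \<Longrightarrow> definable M Q \<Longrightarrow> definable M (\<lambda>c. P c \<longrightarrow> Q c)"
  by (rule definable_cong[OF _ definable_or[OF definable_not[of M P], of Q]]) auto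

lemma definable_iff:
  "definable M P \<Longrightarrow> definable M Q \<Longrightarrow> definable M (\<lambda>c. P c \<longleftrightarrow> Q c)"
  by (rule definable_cong[OF _ definable_conj[OF definable_imp[of M P Q] definable_imp[of M Q P]]]) auto

lemma definable_ex:
  assumes "definable M (\<lambda>c. P (c 0) (tl_env c))"
  shows "definable M (\<lambda>c. \<exists>x\<in>M. P x c)"
  using definable_not[OF definable_all[OF definable_not[OF assms]]] by simp

lemma definable_subst:
  assumes "definable_term M t" "definable M (\<lambda>c. P (c 0) (tl_env c))"
  shows "definable M (\<lambda>c. P (t c) c)"
proof -
  have "definable M (\<lambda>c. \<exists>x\<in>M. x = t c \<and> P x c)"
    using assms by (intro definable_ex definable_conj) (auto simp: definable_term_def)
  then show ?thesis
    by (rule definable_cong[rotated]) (use assms(1) in \<open>auto simp: definable_term_def\<close>)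
qed

lemma definable_term_weaken:
  assumes "definable_term M t" shows "definable_term M (\<lambda>c. t (tl_env c))"
proof -
  define f where "f i = (if i = 0 then 0 else Suc i)" for i :: nat
  have "inj f" by (auto simp: f_def inj_def split: if_splits)
  from definable_rename[OF _ this] assms have "definable M (\<lambda>c. c (f 0) = t (\<lambda>i. c (f (Suc i))))"
    unfolding definable_term_def by blast
  then show ?thesis
    using assms by (auto simp: definable_term_def f_def image_subset_iff)
qed

lemma definable_eq_var: 
  assumes "M \<noteq> {}" shows "definable M (\<lambda>c. c i = c j)"
proof -
  obtain d where "d \<in> M" using \<open>M \<noteq> {}\<close> by blast
  then show ?thesis by (intro definableI[of "\<lambda>_. d" _ _ "Eq (2 * i) (2 * j)"]) auto
qed

lemma definable_mem_var: 
  assumes "M \<noteq> {}" shows "definable M (\<lambda>c. c i \<in> elts (c j))"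
proof -
  obtain d where "d \<in> M" using \<open>M \<noteq> {}\<close> by blast
  then show ?thesis by (intro definableI[of "\<lambda>_. d" _ _ "Mem (2 * i) (2 * j)"]) auto
qed

lemma definable_const: "definable M (\<lambda>c. b)" if "M \<noteq> {}"
  using definable_eq_var[OF that, of 0 0] definable_not[OF definable_eq_var[OF that, of 0 0]]
  by (cases b) auto

lemma definable_term_var: "definable_term M (\<lambda>c. c n)" if "M \<noteq> {}"
  using definable_eq_var[OF that] by (auto simp: definable_term_def)

lemma definable_term_const: "a \<in> M \<Longrightarrow> definable_term M (\<lambda>c. a)"
  unfolding definable_term_def
  by (auto intro: definableI[of "\<lambda>_. a" _ _ "Eq 0 1"] simp: merge_env_def)

lemma definable_subst2:
  assumes "definable M (\<lambda>c. P (c 0) (c 1))" "definable_term M t" "definable_term M u"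
  shows "definable M (\<lambda>c. P (t c) (u c))"
proof -
  have sw: "inj (\<lambda>i::nat. if i = 0 then 1 else if i = 1 then 0 else i)"
    by (auto simp: inj_def split: if_splits)
  have "definable M (\<lambda>c. P (c 1) (c 0))"
    using definable_rename[OF assms(1) sw] by simp
  then have "definable M (\<lambda>c. P (c 0) (u (tl_env c)))"
    by (intro definable_subst[OF definable_term_weaken[OF assms(3)], of "\<lambda>y c. P (c 0) y"]) simp
  then show ?thesis
    by (intro definable_subst[OF assms(2), of "\<lambda>x c. P x (u c)"]) 
qed

lemma definable_subst1:
  assumes "definable M (\<lambda>c. P (c 0))" "definable_term M t"
  shows "definable M (\<lambda>c. P (t c))"
  using definable_subst[OF assms(2), of "\<lambda>x c. P x"] assms(1) by simp

lemma definable_subst3: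
  assumes "definable M (\<lambda>c. P (c 0) (c 1) (c 2))"
    "definable_term M t" "definable_term M u" "definable_term M v"
  shows "definable M (\<lambda>c. P (t c) (u c) (v c))"
proof -
  define f :: "nat \<Rightarrow> nat" where "f = (\<lambda>i. if i = 2 then 0 else if i < 2 then Suc i else i)"
  have "inj f" by (auto simp: f_def inj_def split: if_splits)
  from definable_rename[OF assms(1) this] have "definable M (\<lambda>c. P (c 1) (c 2) (c 0))"
    by (simp add: f_def numeral_2_eq_2)
  then have "definable M (\<lambda>c. P (c 0) (c 1) (v (\<lambda>n. c (Suc (Suc n)))))"
    by (intro definable_subst[OF definable_term_weaken[OF definable_term_weaken[OF assms(4)]],
          of "\<lambda>y c. P (c 0) (c 1) y"]) (simp add: numeral_2_eq_2)
  moreover define g :: "nat \<Rightarrow> nat" where "g = (\<lambda>i. if i = 0 then 1 else if i = 1 then 0 else i)"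
  have "inj g" by (auto simp: g_def inj_def split: if_splits)
  ultimately have "definable M (\<lambda>c. P (c 1) (c 0) (v (\<lambda>n. c (Suc (Suc n)))))"
    using definable_rename[of M _ g] by (fastforce simp: g_def)
  then have "definable M (\<lambda>c. P (c 0) (u (tl_env c)) (v (tl_env c)))"
    by (intro definable_subst[OF definable_term_weaken[OF assms(3)], of "\<lambda>y c. P (c 0) y (v (tl_env c))"]) simp
  then show ?thesis
    by (intro definable_subst[OF assms(2), of "\<lambda>x c. P x (u c) (v c)"])
qed

lemma definable_term1:
  assumes "definable M (\<lambda>c. c 0 = f (c 1))" "\<And>x. x \<in> M \<Longrightarrow> f x \<in> M" "definable_term M t"
  shows "definable_term M (\<lambda>c. f (t c))"
  unfolding definable_term_def
proof (intro conjI allI impI)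
  show "f (t c) \<in> M" if "range c \<subseteq> M" for c
    using assms(2,3) that by (auto simp: definable_term_def)
  show "definable M (\<lambda>c. c 0 = f (t (tl_env c)))"
  proof -
    have "M \<noteq> {}" using assms(1) by (auto simp: definable_def)
    then show ?thesis
      using definable_subst2[OF assms(1) definable_term_var definable_term_weaken[OF assms(3)]] by blast
  qed
qed

lemma definable_term2:
  assumes "definable M (\<lambda>c. c 0 = f (c 1) (c 2))" "\<And>x y. x \<in> M \<Longrightarrow> y \<in> M \<Longrightarrow> f x y \<in> M"
    "definable_term M t" "definable_term M u"
  shows "definable_term M (\<lambda>c. f (t c) (u c))"
  unfolding definable_term_def
proof (intro conjI allI impI)
  show "f (t c) (u c) \<in> M" if "range c \<subseteq> M" for c
    using assms(2-4) that by (auto simp: definable_term_def)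
  show "definable M (\<lambda>c. c 0 = f (t (tl_env c)) (u (tl_env c)))"
  proof -
    have "M \<noteq> {}" using assms(1) by (auto simp: definable_def)
    then show ?thesis
      using definable_subst3[OF assms(1) definable_term_var definable_term_weaken[OF assms(3)]
          definable_term_weaken[OF assms(4)]] by blast
  qed
qed

lemma definable_term_subst:
  assumes "definable_term M (\<lambda>c. g (c 0))" "definable_term M t"
  shows "definable_term M (\<lambda>c. g (t c))"
proof (rule definable_term1[where f = g, OF _ _ assms(2)])
  show "definable M (\<lambda>c. c 0 = g (c 1))"
    using assms(1) by (simp add: definable_term_def)
  show "g x \<in> M" if "x \<in> M" for x
    using assms(1)[unfolded definable_term_def, THEN conjunct1, rule_format, of "\<lambda>_. x"] that by simp
qed

lemma definable_term_subst2:
  assumes "definable_term M (\<lambda>c. f (c 0) (c 1))" "definable_term M t" "definable_term M u"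
  shows "definable_term M (\<lambda>c. f (t c) (u c))"
proof (rule definable_term2[where f = f, OF _ _ assms(2,3)])
  show "definable M (\<lambda>c. c 0 = f (c 1) (c 2))"
    using assms(1) by (simp add: definable_term_def numeral_2_eq_2)
  show "f x y \<in> M" if "x \<in> M" "y \<in> M" for x y
    using assms(1)[unfolded definable_term_def, THEN conjunct1, rule_format, of "\<lambda>i. if i = 0 then x else y"] that
    by auto
qed

section \<open>Closure properties of countable transitive models\<close>

lemma not_mem_self: "x \<notin> elts x"
  using wf_elts by (auto dest: wf_not_refl)

lemma elts_hnat: "elts (hnat n) = hnat ` {..<n}"
  by (induction n) (auto simp: hsucc_def lessThan_Suc)

lemma hnat_inject [simp]: "hnat m = hnat n \<longleftrightarrow> m = n"
proof -
  have "hnat m \<noteq> hnat n" if "m < n" for m n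
    using that not_mem_self[of "hnat n"] by (metis elts_hnat imageI lessThan_iff)
  then show ?thesis by (metis nat_neq_iff)
qed

lemma hnat_mem_hnat [simp]: "hnat m \<in> elts (hnat n) \<longleftrightarrow> m < n"
  by (auto simp: elts_hnat)

lemma elts_hset_Collect [simp]: "elts (hset {x \<in> elts a. P x}) = {x \<in> elts a. P x}"
  by (intro elts_hset countable_subset[OF _ countable_elts[of a]]) auto

lemma elts_hsucc [simp]: "elts (hsucc a) = insert a (elts a)"
  by (simp add: hsucc_def)

definition homega :: hc where
  "homega = hset (range hnat)"

lemma elts_homega [simp]: "elts homega = range hnat"
  by (simp add: homega_def)

definition hUnion :: "hc \<Rightarrow> hc" where
  "hUnion a = hset (\<Union>x\<in>elts a. elts x)"

lemma elts_hUnion [simp]: "elts (hUnion a) = (\<Union>x\<in>elts a. elts x)"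
  by (simp add: hUnion_def)

definition hprod :: "hc \<Rightarrow> hc \<Rightarrow> hc" where
  "hprod a b = hUnion (hset ((\<lambda>x. hset ((\<lambda>y. hpair x y) ` elts b)) ` elts a))"

lemma elts_hprod: "elts (hprod a b) = {hpair x y |x y. x \<in> elts a \<and> y \<in> elts b}"
  by (auto simp: hprod_def)

lemma hpair_mem_hprod [simp]: "hpair x y \<in> elts (hprod a b) \<longleftrightarrow> x \<in> elts a \<and> y \<in> elts b"
  by (auto simp: elts_hprod)

lemma elts_hseq: "elts (hseq f) = range (\<lambda>n. hpair (hnat n) (f n))"
  by (simp add: hseq_def)

lemma hpair_mem_hseq [simp]: "hpair (hnat n) y \<in> elts (hseq f) \<longleftrightarrow> y = f n"
  by (auto simp: elts_hseq)

lemma hseq_inject [simp]: "hseq f = hseq g \<longleftrightarrow> f = g"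
  by (metis hpair_mem_hseq ext)

lemma nat_parity_cases:
  obtains "i = 0" | k where "i = 2 * Suc k" | k where "i = Suc (2 * k)"
  by (metis evenE oddE not0_implies_Suc mult_0_right Suc_eq_plus1)

lemma merge_env_upd: "(merge_env w (cons_env a c))(0 := x) = merge_env w (cons_env x c)"
proof
  fix i show "((merge_env w (cons_env a c))(0 := x)) i = merge_env w (cons_env x c) i"
    by (cases i rule: nat_parity_cases) (simp_all del: mult_Suc_right, simp add: merge_env_def)
qed

lemma merge_env_upd2: "(merge_env w (cons_env a (cons_env b c)))(0 := x, 2 := y) = merge_env w (cons_env x (cons_env y c))"
proof
  fix i
  consider "i = 0" | "i = 2" | k where "i = 2 * Suc (Suc k)" | k where "i = Suc (2 * k)"
    by (cases i rule: nat_parity_cases) (metis mult_1_right One_nat_def not0_implies_Suc)+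
  then show "((merge_env w (cons_env a (cons_env b c)))(0 := x, 2 := y)) i = merge_env w (cons_env x (cons_env y c)) i"
    by cases (simp_all del: mult_Suc_right, simp_all add: merge_env_def)
qed

locale ctm =
  fixes M :: "hc set"
  assumes ctm: "ctm_ZFC M"
begin

lemma countable_M: "countable M"
  and transitive: "a \<in> M \<Longrightarrow> x \<in> elts a \<Longrightarrow> x \<in> M"
  and zfc: "models_ZFC M"
  using ctm by (auto simp: ctm_ZFC_def)

lemma nonempty: "M \<noteq> {}"
  using zfc by (auto simp: models_ZFC_def ax_infinity_def)

lemma elts_hset_subset: "B \<subseteq> M \<Longrightarrow> elts (hset B) = B"
  by (intro elts_hset countable_subset[OF _ countable_M])

text \<open>By transitivity it suffices to test membership inside \<open>M\<close>, so the graph of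
  a set-valued operation can be defined with quantifiers over \<open>M\<close>.\<close>

lemma eq_hset_iff:
  assumes "a \<in> M" "B \<subseteq> M"
  shows "a = hset B \<longleftrightarrow> (\<forall>z\<in>M. z \<in> elts a \<longleftrightarrow> z \<in> B)"
  using assms elts_hset_subset[OF assms(2)] hset_elts[of a]
  by (metis subsetD subset_antisym subsetI transitive)

named_theorems definability

lemmas [definability] = definable_not definable_conj definable_or definable_imp definable_iff
  definable_all definable_ex definable_term_const
  definable_const[OF nonempty] definable_term_var[OF nonempty]

lemma definable_eq [definability]:
  "definable_term M t \<Longrightarrow> definable_term M u \<Longrightarrow> definable M (\<lambda>c. t c = u c)"
  by (rule definable_subst2[of M "(=)", OF definable_eq_var[OF nonempty]])

lemma definable_mem [definability]:
  "definable_term M t \<Longrightarrow> definable_term M u \<Longrightarrow> definable M (\<lambda>c. t c \<in> elts (u c))"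
  by (rule definable_subst2[of M "\<lambda>x y. x \<in> elts y", OF definable_mem_var[OF nonempty]])

lemma definable_term_in: "definable_term M t \<Longrightarrow> range c \<subseteq> M \<Longrightarrow> t c \<in> M"
  by (simp add: definable_term_def)

lemma definable_ball [definability]:
  assumes "definable_term M t" "definable M (\<lambda>c. P (c 0) (tl_env c))"
  shows "definable M (\<lambda>c. \<forall>x\<in>elts (t c). P x c)"
proof -
  have "definable M (\<lambda>c. \<forall>x\<in>M. x \<in> elts (t c) \<longrightarrow> P x c)"
    by (intro definable_all definable_imp definable_mem definable_term_weaken assms definability)
  then show ?thesis
    by (rule definable_cong[rotated]) (use transitive definable_term_in[OF assms(1)] in blast)
qed

lemma definable_bex [definability]:
  assumes "definable_term M t" "definable M (\<lambda>c. P (c 0) (tl_env c))"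
  shows "definable M (\<lambda>c. \<exists>x\<in>elts (t c). P x c)"
  using definable_not[OF definable_ball[OF assms(1) definable_not[OF assms(2)]]] by simp

lemma definable_subseteq [definability]:
  "definable_term M t \<Longrightarrow> definable_term M u \<Longrightarrow> definable M (\<lambda>c. elts (t c) \<subseteq> elts (u c))"
  unfolding subset_iff
  by (rule definable_subst2) 
     (rule definable_cong[where Q="\<lambda>c. \<forall>x\<in>elts (c 0). x \<in> elts (c 1)"], blast, intro definability)

lemma definable_skip1:
  "definable M (\<lambda>c. P (c 0) (tl_env c)) \<Longrightarrow> definable M (\<lambda>c. P (c 0) (\<lambda>n. c (Suc (Suc n))))"
  using definable_rename[of M "\<lambda>c. P (c 0) (tl_env c)" "\<lambda>i. if i = 0 then 0 else Suc i"]
  by (auto simp: inj_def)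

lemma separation:
  assumes "a \<in> M" "definable M (\<lambda>c. P (c 0) (tl_env c))" "range c \<subseteq> M"
  shows "hset {x \<in> elts a. P x c} \<in> M"
proof -
  obtain p w where p: "range w \<subseteq> M"
    "\<And>c. range c \<subseteq> M \<Longrightarrow> P (c 0) (tl_env c) \<longleftrightarrow> sat M (merge_env w c) p"
    using assms(2) unfolding definable_def by blast
  \<comment> \<open>Here \<open>a\<close> only fills the slot of variable 0, which the axiom
    overwrites with \<open>x\<close>.\<close>
  define v where "v = merge_env w (cons_env a c)"
  have v: "range v \<subseteq> M" unfolding v_def by (intro range_merge_env range_cons_env assms p)
  have "ax_separation M" using zfc by (simp add: models_ZFC_def)
  from this[unfolded ax_separation_def, rule_format, OF v assms(1), of p]
  obtain b where b: "b \<in> M"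
    "\<And>x. x \<in> M \<Longrightarrow> x \<in> elts b \<longleftrightarrow> x \<in> elts a \<and> sat M (v(0 := x)) p"
    by blast
  have "v(0 := x) = merge_env w (cons_env x c)" for x
    unfolding v_def by (rule merge_env_upd)
  then have "x \<in> elts b \<longleftrightarrow> x \<in> elts a \<and> P x c" if "x \<in> M" for x
    using b(2)[OF that] p(2)[OF range_cons_env[OF that assms(3)]] by (simp del: fun_upd_apply)
  then have "b = hset {x \<in> elts a. P x c}"
    using b(1) transitive[OF assms(1)] by (subst eq_hset_iff) auto
  with b(1) show ?thesis by simp
qed

lemma definable_term_Collect [definability]:
  assumes t: "definable_term M t" and P: "definable M (\<lambda>c. P (c 0) (tl_env c))"
  shows "definable_term M (\<lambda>c. hset {x \<in> elts (t c). P x c})"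
  unfolding definable_term_def
proof (intro conjI allI impI)
  show "hset {x \<in> elts (t c). P x c} \<in> M" if "range c \<subseteq> M" for c
    using separation[OF definable_term_in[OF t that] P that] .
  have "definable M (\<lambda>c. \<forall>z\<in>M. z \<in> elts (c 0) \<longleftrightarrow> z \<in> elts (t (tl_env c)) \<and> P z (tl_env c))"
    by (intro definability definable_skip1[OF P] definable_term_weaken t)
  then show "definable M (\<lambda>c. c 0 = hset {x \<in> elts (t (tl_env c)). P x (tl_env c)})"
  proof (rule definable_cong[rotated])
    fix c :: "nat \<Rightarrow> hc" assume c: "range c \<subseteq> M"
    then have "range (tl_env c) \<subseteq> M" "c 0 \<in> M" by auto
    then show "(c 0 = hset {x \<in> elts (t (tl_env c)). P x (tl_env c)}) \<longleftrightarrow>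
        (\<forall>z\<in>M. z \<in> elts (c 0) \<longleftrightarrow> z \<in> elts (t (tl_env c)) \<and> P z (tl_env c))"
      using transitive[OF definable_term_in[OF t]] by (subst eq_hset_iff) auto
  qed
qed

lemma collect_in:
  assumes "a \<in> M" "definable M (\<lambda>c. P (c 0))"
  shows "hset {x \<in> elts a. P x} \<in> M"
proof -
  obtain d where "d \<in> M" using nonempty by blast
  then show ?thesis using separation[OF assms(1), of "\<lambda>x c. P x" "\<lambda>_. d"] assms(2) by auto
qed

lemma replacement:
  assumes "a \<in> M" "definable_term M (\<lambda>c. f (c 0) (tl_env c))" "range c \<subseteq> M"
  shows "\<exists>b\<in>M. (\<lambda>x. f x c) ` elts a \<subseteq> elts b"
proof -
  have f: "f x c \<in> M" if "x \<in> M" for x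
    using definable_term_in[OF assms(2) range_cons_env[OF that assms(3)]] by simp
  have "definable M (\<lambda>c. c 0 = f (c 1) (\<lambda>n. c (Suc (Suc n))))"
    using assms(2) by (simp add: definable_term_def)
  from definable_rename[OF this, of "\<lambda>i. if i = 0 then 1 else if i = 1 then 0 else i"]
  have "definable M (\<lambda>c. c 1 = f (c 0) (\<lambda>n. c (Suc (Suc n))))"
    by (auto simp: inj_def split: if_splits)
  then obtain p w where p: "range w \<subseteq> M"
    "\<And>c. range c \<subseteq> M \<Longrightarrow> c 1 = f (c 0) (\<lambda>n. c (Suc (Suc n))) \<longleftrightarrow> sat M (merge_env w c) p"
    unfolding definable_def by blast
  \<comment> \<open>The axiom has argument and value at the variables 0 and 1, whereas
    \<open>merge_env\<close> keeps the first two environment entries at 0 and 2.\<close>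
  define g :: "nat \<Rightarrow> nat" where "g = (\<lambda>i. if i = 1 then 2 else if i = 2 then 1 else i)"
  have g: "inj g" by (auto simp: g_def inj_def split: if_splits)
  define v where "v = (\<lambda>i. merge_env w (cons_env a (cons_env a c)) (g i))"
  have v: "range v \<subseteq> M"
    unfolding v_def using range_merge_env[OF p(1) range_cons_env[OF assms(1) range_cons_env[OF assms(1,3)]]]
    by auto
  have "(\<lambda>i. (v(0 := x, 1 := y)) (g i)) = merge_env w (cons_env x (cons_env y c))" for x y
  proof
    fix i
    have "(v(0 := x, 1 := y)) (g i) = ((merge_env w (cons_env a (cons_env a c)))(0 := x, 2 := y)) i"
      by (simp add: v_def g_def)
    then show "(v(0 := x, 1 := y)) (g i) = merge_env w (cons_env x (cons_env y c)) i"
      by (simp only: merge_env_upd2)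
  qed
  then have sat: "sat M (v(0 := x, 1 := y)) (rename_fm g p) \<longleftrightarrow> y = f x c" if "x \<in> M" "y \<in> M" for x y
    using p(2)[OF range_cons_env[OF that(1) range_cons_env[OF that(2) assms(3)]]]
    by (simp add: sat_rename_fm[OF g])
  have ex1: "\<exists>!y. y \<in> M \<and> sat M (v(0 := x, 1 := y)) (rename_fm g p)" if "x \<in> M" for x
    using sat[OF that] f[OF that] by blast
  have "ax_replacement M" using zfc by (simp add: models_ZFC_def)
  from this[unfolded ax_replacement_def, rule_format, OF v assms(1) ex1]
  obtain b where "b \<in> M"
    "\<And>x. x \<in> M \<Longrightarrow> x \<in> elts a \<Longrightarrow> \<exists>y\<in>M. y \<in> elts b \<and> sat M (v(0 := x, 1 := y)) (rename_fm g p)"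
    by auto
  then show ?thesis using sat transitive[OF assms(1)] by (intro bexI[of _ b]) auto
qed

text \<open>Replacement only bounds the image; Separation then cuts it out of the bound.\<close>

lemma definable_term_image [definability]:
  assumes t: "definable_term M t" and f: "definable_term M (\<lambda>c. f (c 0) (tl_env c))"
  shows "definable_term M (\<lambda>c. hset ((\<lambda>x. f x c) ` elts (t c)))"
proof -
  have fM: "f x c \<in> M" if "x \<in> M" "range c \<subseteq> M" for x c
    using definable_term_in[OF f range_cons_env[OF that]] by simp
  have f': "definable M (\<lambda>c. c 0 = f (c 1) (\<lambda>n. c (Suc (Suc n))))"
    using f by (simp add: definable_term_def)
  from definable_rename[OF this, of "\<lambda>i. if i = 0 then 1 else if i = 1 then 0 else i"]
  have f'': "definable M (\<lambda>c. c 1 = f (c 0) (\<lambda>n. c (Suc (Suc n))))"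
    by (auto simp: inj_def split: if_splits)
  have P: "definable M (\<lambda>c. \<exists>x\<in>elts (t (tl_env c)). c 0 = f x (tl_env c))"
    using f'' by (intro definable_bex definable_term_weaken t) simp
  show ?thesis
    unfolding definable_term_def
  proof (intro conjI allI impI)
    show "hset ((\<lambda>x. f x c) ` elts (t c)) \<in> M" if c: "range c \<subseteq> M" for c
    proof -
      obtain b where b: "b \<in> M" "(\<lambda>x. f x c) ` elts (t c) \<subseteq> elts b"
        using replacement[OF definable_term_in[OF t c] f c] by blast
      then have "(\<lambda>x. f x c) ` elts (t c) = {y \<in> elts b. \<exists>x\<in>elts (t c). y = f x c}" by auto
      then show ?thesis
        using separation[OF b(1), of "\<lambda>y c. \<exists>x\<in>elts (t c). y = f x c", OF P c] by simp
    qed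
    have "definable M (\<lambda>c. \<forall>z\<in>M. z \<in> elts (c 0) \<longleftrightarrow> (\<exists>x\<in>elts (t (tl_env c)). z = f x (tl_env c)))"
      by (intro definability definable_skip1[of "\<lambda>z c. \<exists>x\<in>elts (t c). z = f x c"] P)
    then show "definable M (\<lambda>c. c 0 = hset ((\<lambda>x. f x (tl_env c)) ` elts (t (tl_env c))))"
    proof (rule definable_cong[rotated])
      fix c :: "nat \<Rightarrow> hc" assume c: "range c \<subseteq> M"
      then have "range (tl_env c) \<subseteq> M" "c 0 \<in> M" by auto
      then show "(c 0 = hset ((\<lambda>x. f x (tl_env c)) ` elts (t (tl_env c)))) \<longleftrightarrow>
          (\<forall>z\<in>M. z \<in> elts (c 0) \<longleftrightarrow> (\<exists>x\<in>elts (t (tl_env c)). z = f x (tl_env c)))"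
        using transitive[OF definable_term_in[OF t]] fM by (subst eq_hset_iff) auto
    qed
  qed
qed

lemma doubleton_in: "x \<in> M \<Longrightarrow> y \<in> M \<Longrightarrow> hset {x, y} \<in> M"
proof -
  assume xy: "x \<in> M" "y \<in> M"
  have "ax_pairing M" using zfc by (simp add: models_ZFC_def)
  then obtain z where "z \<in> M" "\<forall>w\<in>M. w \<in> elts z \<longleftrightarrow> w = x \<or> w = y"
    using xy unfolding ax_pairing_def by blast
  then have "z = hset {x, y}" using xy by (subst eq_hset_iff) auto
  then show ?thesis using \<open>z \<in> M\<close> by simp
qed

lemma definable_term_doubleton [definability]:
  assumes "definable_term M t" "definable_term M u"
  shows "definable_term M (\<lambda>c. hset {t c, u c})"
proof (rule definable_term2[OF _ doubleton_in assms])
  have "definable M (\<lambda>c. \<forall>z\<in>M. z \<in> elts (c 0) \<longleftrightarrow> z = c 1 \<or> z = c 2)"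
    by (intro definability)
  then show "definable M (\<lambda>c. c 0 = hset {c 1, c 2})"
    by (rule definable_cong[rotated]) (subst eq_hset_iff, auto)
qed

lemma definable_term_singleton [definability]:
  "definable_term M t \<Longrightarrow> definable_term M (\<lambda>c. hset {t c})"
  using definable_term_doubleton[of t t] by simp

lemma definable_term_hpair [definability]:
  "definable_term M t \<Longrightarrow> definable_term M u \<Longrightarrow> definable_term M (\<lambda>c. hpair (t c) (u c))"
  unfolding hpair_def by (intro definability)

lemma Union_subset: "a \<in> M \<Longrightarrow> (\<Union>x\<in>elts a. elts x) \<subseteq> M"
  by (meson UN_least subsetI transitive)

lemma hUnion_in: "a \<in> M \<Longrightarrow> hUnion a \<in> M"
proof -
  assume a: "a \<in> M"
  have "ax_union M" using zfc by (simp add: models_ZFC_def)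
  then obtain u where u: "u \<in> M" "\<forall>w\<in>M. w \<in> elts u \<longleftrightarrow> (\<exists>y\<in>M. y \<in> elts a \<and> w \<in> elts y)"
    using a unfolding ax_union_def by blast
  then have "u = hUnion a"
    unfolding hUnion_def using transitive[OF a] Union_subset[OF a] by (subst eq_hset_iff) auto
  then show ?thesis using u by simp
qed

lemma definable_term_hUnion [definability]:
  assumes "definable_term M t" shows "definable_term M (\<lambda>c. hUnion (t c))"
proof (rule definable_term1[OF _ hUnion_in assms])
  have "definable M (\<lambda>c. \<forall>z\<in>M. z \<in> elts (c 0) \<longleftrightarrow> (\<exists>y\<in>elts (c 1). z \<in> elts y))"
    by (intro definability)
  then show "definable M (\<lambda>c. c 0 = hUnion (c 1))"
  proof (rule definable_cong[rotated])
    fix c :: "nat \<Rightarrow> hc" assume "range c \<subseteq> M"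
    then have c: "c 0 \<in> M" "c 1 \<in> M" by auto
    show "(c 0 = hUnion (c 1)) = (\<forall>z\<in>M. (z \<in> elts (c 0)) = (\<exists>y\<in>elts (c 1). z \<in> elts y))"
      unfolding hUnion_def using c(1) Union_subset[OF c(2)] by (simp add: eq_hset_iff)
  qed
qed

lemma definable_term_UN [definability]:
  assumes "definable_term M t" "definable_term M (\<lambda>c. f (c 0) (tl_env c))"
  shows "definable_term M (\<lambda>c. hset (\<Union>x\<in>elts (t c). elts (f x c)))"
  using definable_term_hUnion[OF definable_term_image[OF assms]] by (simp add: hUnion_def)

lemma definable_term_Un [definability]:
  assumes "definable_term M t" "definable_term M u"
  shows "definable_term M (\<lambda>c. hset (elts (t c) \<union> elts (u c)))"
  using definable_term_hUnion[OF definable_term_doubleton[OF assms]] by (simp add: hUnion_def)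

lemma definable_term_insert [definability]:
  assumes "definable_term M t" "definable_term M u"
  shows "definable_term M (\<lambda>c. hset (insert (t c) (elts (u c))))"
  using definable_term_Un[OF definable_term_singleton[OF assms(1)] assms(2)] by simp

lemma definable_term_hsucc [definability]:
  "definable_term M t \<Longrightarrow> definable_term M (\<lambda>c. hsucc (t c))"
  unfolding hsucc_def by (intro definability)

lemma term_in: assumes "definable_term M (\<lambda>c. a)" shows "a \<in> M"
proof -
  obtain d where "d \<in> M" using nonempty by blast
  then show ?thesis using definable_term_in[OF assms, of "\<lambda>_. d"] by auto
qed

lemma definable_term_hprod [definability]:
  "definable_term M t \<Longrightarrow> definable_term M u \<Longrightarrow> definable_term M (\<lambda>c. hprod (t c) (u c))"
  by (rule definable_term_subst2[where f = hprod], unfold hprod_def) (intro definability)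

definition power_in :: "hc \<Rightarrow> hc" where
  "power_in a = hset {w \<in> M. elts w \<subseteq> elts a}"

lemma elts_power_in [simp]: "elts (power_in a) = {w \<in> M. elts w \<subseteq> elts a}"
  by (auto simp: power_in_def intro!: elts_hset_subset)

lemma power_in_in: "a \<in> M \<Longrightarrow> power_in a \<in> M"
proof -
  assume a: "a \<in> M"
  have "ax_power_set M" using zfc by (simp add: models_ZFC_def)
  then obtain p where p: "p \<in> M" "\<forall>w\<in>M. w \<in> elts p \<longleftrightarrow> (\<forall>z\<in>M. z \<in> elts w \<longrightarrow> z \<in> elts a)"
    using a unfolding ax_power_set_def by blast
  moreover have "(\<forall>z\<in>M. z \<in> elts w \<longrightarrow> z \<in> elts a) \<longleftrightarrow> elts w \<subseteq> elts a" if "w \<in> M" for w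
    using transitive[OF that] by blast
  ultimately have "p = power_in a"
    unfolding power_in_def by (subst eq_hset_iff) auto
  then show ?thesis using p by simp
qed

lemma definable_term_power_in [definability]:
  assumes "definable_term M t" shows "definable_term M (\<lambda>c. power_in (t c))"
proof (rule definable_term1[OF _ power_in_in assms])
  have "definable M (\<lambda>c. \<forall>z\<in>M. z \<in> elts (c 0) \<longleftrightarrow> elts z \<subseteq> elts (c 1))"
    by (intro definability)
  then show "definable M (\<lambda>c. c 0 = power_in (c 1))"
    unfolding power_in_def by (rule definable_cong[rotated]) (subst eq_hset_iff, auto)
qed

lemma empty_in: "hset {} \<in> M"
proof -
  obtain a where "a \<in> M" using nonempty by blast
  then have "hset {x \<in> elts a. False} \<in> M" by (rule collect_in) (intro definability)
  then show ?thesis by simp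
qed

lemma finite_in: "finite A \<Longrightarrow> A \<subseteq> M \<Longrightarrow> hset A \<in> M"
proof (induction A rule: finite_induct)
  case (insert x A)
  then have "hset (insert x (elts (hset A))) \<in> M"
    by (rule_tac term_in, intro definability) auto
  then show ?case using insert by (simp add: countable_finite)
qed (simp add: empty_in)

lemma hnat_in [simp]: "hnat n \<in> M"
proof (induction n)
  case (Suc n)
  then show ?case by (simp, rule_tac term_in, intro definability)
qed (simp add: empty_in)

lemma homega_in [simp]: "homega \<in> M"
proof -
  have "ax_infinity M" using zfc by (simp add: models_ZFC_def)
  then obtain x e where x: "x \<in> M" "e \<in> M" "e \<in> elts x" "\<forall>z\<in>M. z \<notin> elts e"
    and step: "\<forall>y\<in>M. y \<in> elts x \<longrightarrow> (\<exists>s\<in>M. s \<in> elts x \<and> (\<forall>z\<in>M. z \<in> elts s \<longleftrightarrow> z \<in> elts y \<or> z = y))"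
    unfolding ax_infinity_def by (elim bexE conjE)
  have "e = hset {}" using x(2,4) by (subst eq_hset_iff) auto
  have hn: "hnat n \<in> elts x" for n
  proof (induction n)
    case 0 then show ?case using x(3) \<open>e = _\<close> by simp
  next
    case (Suc n)
    then obtain s where s: "s \<in> M" "s \<in> elts x" "\<forall>z\<in>M. z \<in> elts s \<longleftrightarrow> z \<in> elts (hnat n) \<or> z = hnat n"
      using step[rule_format, of "hnat n"] by auto
    then have "s = hnat (Suc n)"
      unfolding hnat.simps hsucc_def using transitive[of "hnat n"] by (subst eq_hset_iff) auto
    then show ?case using s by simp
  qed
  \<comment> \<open>Infinity gives only some inductive set \<open>x\<close>. A bounded formula
    separates the numerals from it: by membership induction, a transitive set that is, like all its
    elements, empty or a successor is a numeral.\<close>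
  define isnat where "isnat y \<longleftrightarrow> (\<forall>z\<in>elts y. elts z \<subseteq> elts y) \<and>
    (\<forall>z\<in>elts (hsucc y). z = hset {} \<or> (\<exists>w\<in>elts z. z = hsucc w))" for y
  have "isnat y \<Longrightarrow> y \<in> range hnat" for y
  proof (induction y rule: wf_induct_rule[OF wf_elts])
    case (1 y)
    show ?case
    proof (cases "y = hset {}")
      case True then show ?thesis by (auto intro: range_eqI[of _ _ 0])
    next
      case False
      then obtain w where w: "w \<in> elts y" "y = hsucc w"
        using 1(2) by (auto simp: isnat_def)
      have "isnat w"
        unfolding isnat_def
      proof (intro conjI ballI subsetI)
        fix u v assume uv: "u \<in> elts w" "v \<in> elts u"
        then have "v \<in> elts y" using 1(2) w by (auto simp: isnat_def)
        moreover have "v \<noteq> w"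
          using uv wf_not_sym[OF wf_elts, of v u] by auto
        ultimately show "v \<in> elts w" using w by simp
      next
        fix z assume "z \<in> elts (hsucc w)"
        then show "z = hset {} \<or> (\<exists>w\<in>elts z. z = hsucc w)"
          using 1(2) w by (auto simp: isnat_def)
      qed
      then obtain n where "w = hnat n" using 1(1)[of w] w(1) by auto
      then show ?thesis using w(2) by (auto intro: range_eqI[of _ _ "Suc n"])
    qed
  qed
  moreover have "isnat (hnat n)" for n
  proof -
    have "z = hset {} \<or> (\<exists>w\<in>elts z. z = hsucc w)" if z: "z \<in> elts (hnat (Suc n))" for z
    proof -
      obtain m where "z = hnat m" using z unfolding elts_hnat by blast
      then show ?thesis by (cases m) (simp_all add: bexI[of _ "hnat (m - 1)"])
    qed
    moreover have "elts (hsucc (hnat n)) = elts (hnat (Suc n))" by simp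
    ultimately show ?thesis by (auto simp: isnat_def elts_hnat simp del: hnat.simps elts_hsucc)
  qed
  ultimately have "{y \<in> elts x. isnat y} = range hnat" using hn by auto
  moreover have "hset {y \<in> elts x. isnat y} \<in> M"
    unfolding isnat_def by (rule collect_in[OF x(1)], intro definability empty_in)
  ultimately show ?thesis by (simp add: homega_def)
qed

definition nat_of :: "hc \<Rightarrow> nat" where
  "nat_of k = (THE n. hnat n = k)"

lemma nat_of_hnat [simp]: "nat_of (hnat n) = n"
  by (simp add: nat_of_def)

text \<open>The values of an iteration are given by the finite partial iterations in \<open>M\<close>.\<close>

lemma hseq_funpow_in:
  assumes a: "a \<in> M" and g: "definable_term M (\<lambda>c. g (c 0))"
  shows "hseq (\<lambda>n. (g ^^ n) a) \<in> M"
proof -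
  let ?f = "\<lambda>n. (g ^^ n) a"
  have gM: "g x \<in> M" if "x \<in> M" for x
    using definable_term_in[OF g, of "\<lambda>_. x"] that by auto
  have fM: "?f n \<in> M" for n by (induction n) (auto simp: a gM)
  note g2 = definable_term_subst[OF g]
  \<comment> \<open>\<open>att k y w\<close> says that \<open>w\<close> attests \<open>y\<close> as
    iterate number \<open>k\<close>. The clauses are equivalences, so up to \<open>k\<close> the set
    \<open>w\<close> has no other values.\<close>
  define att where "att k y w \<longleftrightarrow> (\<forall>z\<in>M. hpair (hnat 0) z \<in> elts w \<longleftrightarrow> z = a) \<and>
    (\<forall>j\<in>elts k. \<forall>z\<in>M. hpair (hsucc j) z \<in> elts w \<longleftrightarrow> (\<exists>u\<in>M. hpair j u \<in> elts w \<and> z = g u)) \<and>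
    hpair k y \<in> elts w" for k y w
  have att_unique: "y = ?f n" if "att (hnat n) y w" "y \<in> M" for n y w
  proof -
    have "hpair (hnat m) z \<in> elts w \<longleftrightarrow> z = ?f m" if "m \<le> n" "z \<in> M" for m z
      using that
    proof (induction m arbitrary: z)
      case 0
      then show ?case using \<open>att (hnat n) y w\<close> by (simp add: att_def del: hnat.simps)
    next
      case (Suc m)
      then have "hpair (hnat (Suc m)) z \<in> elts w \<longleftrightarrow> (\<exists>u\<in>M. hpair (hnat m) u \<in> elts w \<and> z = g u)"
        using \<open>att (hnat n) y w\<close> by (simp add: att_def)
      also have "\<dots> \<longleftrightarrow> (\<exists>u\<in>M. u = ?f m \<and> z = g u)"
        using Suc by (intro bex_cong) auto
      finally show ?case using fM by simp
    qed
    then show ?thesis using that by (auto simp: att_def)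
  qed
  have att_exists: "\<exists>w\<in>M. att (hnat n) (?f n) w" for n
  proof
    let ?A = "(\<lambda>m. hpair (hnat m) (?f m)) ` {..n}"
    have "hpair (hnat m) (?f m) \<in> M" for m
      by (rule term_in) (intro definability hnat_in fM)
    then show "hset ?A \<in> M" by (intro finite_in) auto
    have "hpair (hnat m) z \<in> ?A \<longleftrightarrow> m \<le> n \<and> z = ?f m" for m z by auto
    then show "att (hnat n) (?f n) (hset ?A)"
      using fM a by (auto simp: att_def elts_hnat countable_finite simp del: hnat.simps simp flip: hnat.simps(2))
  qed
  \<comment> \<open>A definable term has to be total on \<open>M\<close>; outside of
    \<open>homega\<close> the default value is \<open>k\<close> itself.\<close>
  define F where "F k = (if k \<in> elts homega then ?f (nat_of k) else k)" for k
  have F_iff: "y = F k \<longleftrightarrow> (if k \<in> elts homega then \<exists>w\<in>M. att k y w else y = k)" if "y \<in> M" for y k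
    using att_unique[OF _ that] att_exists by (auto simp: F_def)
  have "definable M (\<lambda>c. (c 1 \<in> elts homega \<longrightarrow> (\<exists>w\<in>M. att (c 1) (c 0) w)) \<and> (c 1 \<notin> elts homega \<longrightarrow> c 0 = c 1))"
    unfolding att_def by (intro definability g2 homega_in a hnat_in)
  then have "definable M (\<lambda>c. c 0 = F (c 1))"
    by (rule definable_cong[rotated]) (subst F_iff, auto)
  then have "definable_term M (\<lambda>c. F (c 0))"
    by (rule definable_term1[where f = F]) (auto simp: F_def fM definable_term_var[OF nonempty])
  then have "hset ((\<lambda>k. hpair k (F k)) ` elts homega) \<in> M"
    by (rule_tac term_in) (intro definability homega_in)
  moreover have "(\<lambda>k. hpair k (F k)) ` elts homega = range (\<lambda>n. hpair (hnat n) (?f n))"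
    by (auto simp: F_def image_iff)
  ultimately show ?thesis by (simp add: hseq_def)
qed

text \<open>The Axiom of Choice in \<open>M\<close> for a definable relation. What matters is that
  the graph of \<open>g\<close> is again in \<open>M\<close>, so that later definitions may use it
  as a parameter.\<close>

lemma uniformization:
  assumes I: "I \<in> M" and B: "B \<in> M" and R: "definable M (\<lambda>c. R (c 0) (c 1))"
    and ex: "\<And>i. i \<in> elts I \<Longrightarrow> \<exists>b\<in>elts B. R i b"
  obtains g where "\<And>i. i \<in> elts I \<Longrightarrow> g i \<in> elts B \<and> R i (g i)"
    "hset ((\<lambda>i. hpair i (g i)) ` elts I) \<in> M"
proof -
  have R': "definable M (\<lambda>c. R (t c) (u c))" if "definable_term M t" "definable_term M u" for t u
    using definable_subst2[OF R that] .
  \<comment> \<open>\<open>ax_choice\<close> speaks about disjoint families; tagging the candidates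
    with \<open>i\<close> makes them disjoint.\<close>
  define W where "W i = hset {p \<in> elts (hprod I B). \<exists>b\<in>elts B. p = hpair i b \<and> R i b}" for i
  have W: "definable_term M (\<lambda>c. W (c 0))"
    unfolding W_def by (intro definability R' I B)
  define X where "X = hset (W ` elts I)"
  have X: "X \<in> M"
    unfolding X_def by (rule term_in) (intro definability W I)
  have W_elts: "elts (W i) = {hpair i b |b. b \<in> elts B \<and> R i b}" if "i \<in> elts I" for i
    using that unfolding W_def elts_hset_Collect by auto
  have X_elts: "elts X = W ` elts I" by (simp add: X_def)
  have "ax_choice M" using zfc by (simp add: models_ZFC_def)
  have nonempty: "\<forall>y\<in>M. y \<in> elts X \<longrightarrow> (\<exists>z\<in>M. z \<in> elts y)"
  proof (intro ballI impI)
    fix y assume "y \<in> M" "y \<in> elts X"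
    then obtain i where "i \<in> elts I" "y = W i" by (auto simp: X_elts)
    then have "\<exists>z. z \<in> elts y" using ex[of i] W_elts[of i] by auto
    then show "\<exists>z\<in>M. z \<in> elts y" using transitive[OF \<open>y \<in> M\<close>] by blast
  qed
  have disjoint: "\<forall>y\<in>M. \<forall>y'\<in>M. y \<in> elts X \<and> y' \<in> elts X \<and> (\<exists>z\<in>M. z \<in> elts y \<and> z \<in> elts y') \<longrightarrow> y = y'"
    using W_elts by (auto simp: X_elts)
  obtain s where s: "s \<in> M" "\<forall>y\<in>M. y \<in> elts X \<longrightarrow> (\<exists>!z. z \<in> M \<and> z \<in> elts y \<and> z \<in> elts s)"
    using \<open>ax_choice M\<close>[unfolded ax_choice_def, rule_format, OF X] nonempty disjoint by blast
  have ex1: "\<exists>!b. b \<in> elts B \<and> R i b \<and> hpair i b \<in> elts s" if i: "i \<in> elts I" for i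
  proof -
    have WM: "W i \<in> M" "W i \<in> elts X" using i X transitive by (auto simp: X_elts)
    have "\<exists>!z. z \<in> M \<and> z \<in> elts (W i) \<and> z \<in> elts s"
      using s(2)[rule_format, OF WM] .
    then obtain z where z: "z \<in> M \<and> z \<in> elts (W i) \<and> z \<in> elts s"
      and z_unique: "\<forall>z'. z' \<in> M \<and> z' \<in> elts (W i) \<and> z' \<in> elts s \<longrightarrow> z' = z"
      by (rule ex1E)
    obtain b where b: "z = hpair i b" "b \<in> elts B" "R i b" using z W_elts[OF i] by auto
    show ?thesis
    proof (rule ex1I[of _ b])
      show "b \<in> elts B \<and> R i b \<and> hpair i b \<in> elts s" using b z by simp
      fix b' assume b': "b' \<in> elts B \<and> R i b' \<and> hpair i b' \<in> elts s"
      then have "hpair i b' \<in> elts (W i)" using W_elts[OF i] by simp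
      then have "hpair i b' = z" using b' transitive[OF WM(1)] by (intro z_unique[rule_format]) simp
      then show "b' = b" using b by simp
    qed
  qed
  define g where "g i = (THE b. b \<in> elts B \<and> R i b \<and> hpair i b \<in> elts s)" for i
  have g: "g i \<in> elts B \<and> R i (g i) \<and> hpair i (g i) \<in> elts s" if "i \<in> elts I" for i
    unfolding g_def using theI'[OF ex1[OF that]] .
  have g_eq: "b = g i" if "i \<in> elts I" "b \<in> elts B" "R i b" "hpair i b \<in> elts s" for i b
    unfolding g_def using that by (intro the1_equality[symmetric] ex1) auto
  have "(\<lambda>i. hpair i (g i)) ` elts I =
      {p \<in> elts (hprod I B). \<exists>i\<in>elts I. \<exists>b\<in>elts B. p = hpair i b \<and> R i b \<and> p \<in> elts s}"
    using g g_eq by (auto simp: elts_hprod image_iff)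
  moreover have "hset {p \<in> elts (hprod I B). \<exists>i\<in>elts I. \<exists>b\<in>elts B. p = hpair i b \<and> R i b \<and> p \<in> elts s} \<in> M"
    by (rule collect_in, rule term_in) (intro definability R' I B s)+
  ultimately show ?thesis using that[of g] g by simp
qed

end

section \<open>Category in the Cantor space of the model\<close>

definition pfx :: "bool list \<Rightarrow> real2 \<Rightarrow> bool" where
  "pfx s x \<longleftrightarrow> (\<forall>i<length s. x i = s ! i)"

lemma pfx_Nil [simp]: "pfx [] x" by (simp add: pfx_def)

lemma pfx_append: "pfx (s @ t) x \<longleftrightarrow> pfx s x \<and> (\<forall>i<length t. x (length s + i) = t ! i)"
proof
  assume *: "pfx (s @ t) x"
  have "x i = s ! i" if "i < length s" for i
    using * that by (auto simp: pfx_def nth_append dest: spec[of _ i])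
  moreover have "x (length s + i) = t ! i" if "i < length t" for i
    using * that by (auto simp: pfx_def nth_append dest: spec[of _ "length s + i"])
  ultimately show "pfx s x \<and> (\<forall>i<length t. x (length s + i) = t ! i)" by (simp add: pfx_def)
next
  assume *: "pfx s x \<and> (\<forall>i<length t. x (length s + i) = t ! i)"
  show "pfx (s @ t) x"
    unfolding pfx_def
  proof (intro allI impI)
    fix i assume i: "i < length (s @ t)"
    show "x i = (s @ t) ! i"
    proof (cases "i < length s")
      case True then show ?thesis using * by (simp add: pfx_def nth_append)
    next
      case False
      then have "x (length s + (i - length s)) = t ! (i - length s)"
        using * i by (intro conjunct2[OF *, rule_format]) auto
      then show ?thesis using False by (simp add: nth_append)
    qed
  qed
qed

lemma pfx_appendD: "pfx (s @ t) x \<Longrightarrow> pfx s x"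
  by (simp add: pfx_append)

lemma pfx_iff_map: "pfx s x \<longleftrightarrow> s = map x [0..<length s]"
  unfolding pfx_def by (subst list_eq_iff_nth_eq) auto

lemma pfx_map [simp]: "pfx (map x [0..<n]) x"
  by (simp add: pfx_def)

lemma pfx_compare: "pfx s x \<Longrightarrow> pfx t x \<Longrightarrow> length s \<le> length t \<Longrightarrow> \<exists>u. t = s @ u"
proof -
  assume s: "pfx s x" and t: "pfx t x" and le: "length s \<le> length t"
  have tk: "take (length s) t = take (length s) (map x [0..<length t])"
    using t[unfolded pfx_iff_map] by (rule arg_cong)
  also have "\<dots> = map x [0..<length s]" using le by (simp add: take_map)
  also have "\<dots> = s" using s[unfolded pfx_iff_map] by (rule sym)
  finally have "t = s @ drop (length s) t" by (metis append_take_drop_id)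
  then show "\<exists>u. t = s @ u" by blast
qed

declare hnat.simps [simp del]

definition hbit :: "bool \<Rightarrow> hc" where
  "hbit b = hnat (of_bool b)"

lemma hbit_inject [simp]: "hbit a = hbit b \<longleftrightarrow> a = b"
  by (cases a; cases b) (simp_all add: hbit_def)

definition hstr :: "bool list \<Rightarrow> hc" where
  "hstr s = hlist (map hbit s)"

lemma elts_hstr: "elts (hstr s) = {hpair (hnat i) (hbit (s ! i)) |i. i < length s}"
  unfolding hstr_def hlist_def by (auto simp: countable_finite)

lemma elts_hreal: "elts (hreal x) = range (\<lambda>n. hpair (hnat n) (hbit (x n)))"
  by (simp add: hreal_def elts_hseq hbit_def)

lemma hpair_mem_hreal [simp]: "hpair (hnat n) (hbit b) \<in> elts (hreal x) \<longleftrightarrow> b = x n"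
  by (auto simp: elts_hreal)

lemma hpair_mem_hstr [simp]:
  "hpair (hnat n) (hbit b) \<in> elts (hstr s) \<longleftrightarrow> n < length s \<and> b = s ! n"
  by (auto simp: elts_hstr)

lemma hreal_inject [simp]: "hreal x = hreal y \<longleftrightarrow> x = y"
  by (auto simp: hreal_def fun_eq_iff simp flip: hbit_def)

lemma hstr_subset_hreal [simp]: "elts (hstr s) \<subseteq> elts (hreal x) \<longleftrightarrow> pfx s x"
  by (auto simp: elts_hstr pfx_def)

lemma hstr_subset_hstr [simp]: "elts (hstr s) \<subseteq> elts (hstr t) \<longleftrightarrow> (\<exists>u. t = s @ u)"
proof
  assume *: "elts (hstr s) \<subseteq> elts (hstr t)"
  have "i < length t \<and> s ! i = t ! i" if "i < length s" for i
  proof -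
    have "hpair (hnat i) (hbit (s ! i)) \<in> elts (hstr t)"
      using * that by (auto simp: elts_hstr)
    then show ?thesis by simp
  qed
  note nth = this
  have "length s \<le> length t" using nth[of "length t"] by (meson not_le less_irrefl)
  then have "take (length s) t = s"
    by (intro nth_equalityI) (simp_all add: nth)
  then show "\<exists>u. t = s @ u" by (metis append_take_drop_id)
qed (auto simp: elts_hstr nth_append)

lemma hstr_inject [simp]: "hstr s = hstr t \<longleftrightarrow> s = t"
proof
  assume "hstr s = hstr t"
  then have "elts (hstr s) \<subseteq> elts (hstr t)" "elts (hstr t) \<subseteq> elts (hstr s)" by auto
  then show "s = t" by auto
qed simp

lemma hstr_Nil: "hstr [] = hset {}"
  by (rule hc_ext) (simp add: elts_hstr)

definition patch :: "bool list \<Rightarrow> real2 \<Rightarrow> real2" where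
  "patch s y i = (if i < length s then s ! i else y i)"

lemma pfx_patch [simp]: "pfx s (patch s y)"
  by (simp add: pfx_def patch_def)

definition dec :: "hc \<Rightarrow> real2 set" where
  "dec a = {x. hreal x \<in> elts a}"

text \<open>For subsets of the ground model reals, nowhere density in the ground model and in \<open>2\<^sup>\<omega>\<close> agree.\<close>

definition nwd :: "real2 set \<Rightarrow> bool" where
  "nwd X \<longleftrightarrow> (\<forall>s. \<exists>t. \<forall>x\<in>X. \<not> pfx (s @ t) x)"

lemma nwd_subset: "nwd Y \<Longrightarrow> X \<subseteq> Y \<Longrightarrow> nwd X"
  unfolding nwd_def by (meson subsetD)

lemma nwd_Un: "nwd X \<Longrightarrow> nwd Y \<Longrightarrow> nwd (X \<union> Y)"
  unfolding nwd_def
proof (intro allI)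
  fix s assume *: "\<forall>s. \<exists>t. \<forall>x\<in>X. \<not> pfx (s @ t) x" "\<forall>s. \<exists>t. \<forall>x\<in>Y. \<not> pfx (s @ t) x"
  obtain t where t: "\<forall>x\<in>X. \<not> pfx (s @ t) x" using * by blast
  obtain u where u: "\<forall>x\<in>Y. \<not> pfx ((s @ t) @ u) x" using * by blast
  show "\<exists>t. \<forall>x\<in>X \<union> Y. \<not> pfx (s @ t) x"
    using t u pfx_appendD[of "s @ t" u] by (intro exI[of _ "t @ u"]) auto
qed

lemma nwd_UN: "finite I \<Longrightarrow> (\<And>i. i \<in> I \<Longrightarrow> nwd (X i)) \<Longrightarrow> nwd (\<Union>i\<in>I. X i)"
proof (induction I rule: finite_induct)
  case empty then show ?case by (simp add: nwd_def)
next
  case (insert i I) then show ?case by (simp add: nwd_Un)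
qed

lemma open_pfx: "open {x. pfx s x}"
proof -
  have "{x. pfx s x} = (\<Inter>i\<in>{..<length s}. (\<lambda>x::real2. x i) -` {s ! i})"
    by (auto simp: pfx_def)
  also have "open \<dots>"
    by (intro open_INT ballI open_vimage continuous_on_product_coordinates)
      (auto simp: open_discrete)
  finally show ?thesis .
qed

lemma open_real2_iff: "open U \<longleftrightarrow> (\<forall>x\<in>U. \<exists>s. pfx s x \<and> {y. pfx s y} \<subseteq> U)" for U :: "real2 set"
proof
  assume U: "open U"
  show "\<forall>x\<in>U. \<exists>s. pfx s x \<and> {y. pfx s y} \<subseteq> U"
  proof
    fix x assume "x \<in> U"
    then obtain X where X: "x \<in> Pi\<^sub>E UNIV X" "finite {i. X i \<noteq> UNIV}" "Pi\<^sub>E UNIV X \<subseteq> U"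
      using product_topology_open_contains_basis[of "\<lambda>_. euclidean" UNIV U x] U
      unfolding open_fun_def by auto
    obtain n where n: "\<And>i. X i \<noteq> UNIV \<Longrightarrow> i < n"
      using X(2) finite_nat_set_iff_bounded by auto
    have "{y. pfx (map x [0..<n]) y} \<subseteq> Pi\<^sub>E UNIV X"
    proof
      fix y assume "y \<in> {y. pfx (map x [0..<n]) y}"
      then have "y i = x i" if "i < n" for i using that by (simp add: pfx_def)
      then have "y i \<in> X i" for i using n[of i] X(1) by (cases "i < n") (auto simp: PiE_def Pi_def)
      then show "y \<in> Pi\<^sub>E UNIV X" by auto
    qed
    then show "\<exists>s. pfx s x \<and> {y. pfx s y} \<subseteq> U" using X(3) by (intro exI[of _ "map x [0..<n]"]) auto
  qed
next
  assume "\<forall>x\<in>U. \<exists>s. pfx s x \<and> {y. pfx s y} \<subseteq> U"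
  then have "U = (\<Union>s\<in>{s. {y. pfx s y} \<subseteq> U}. {y. pfx s y})" by blast
  also have "open \<dots>" by (intro open_UN ballI open_pfx)
  finally show "open U" .
qed

context ctm
begin

definition CC :: hc where "CC = hreals (cantor_in M)"

lemma countable_cantor_in: "countable (cantor_in M)"
proof -
  have "countable (hreal ` cantor_in M)"
    by (rule countable_subset[OF _ countable_M]) (auto simp: cantor_in_def)
  then show ?thesis by (rule countable_image_inj_on) (simp add: inj_on_def)
qed

lemma elts_hreals: "A \<subseteq> cantor_in M \<Longrightarrow> elts (hreals A) = hreal ` A"
  unfolding hreals_def by (intro elts_hset countable_image countable_subset[OF _ countable_cantor_in])

lemma elts_CC: "elts CC = hreal ` cantor_in M"
  by (simp add: CC_def elts_hreals)

lemma hbit_in [simp]: "hbit b \<in> M"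
  by (simp add: hbit_def)

text \<open>\<open>M\<close> sees its Cantor space as a set: Power Set bounds it, and a bounded
  formula selects the graphs of total functions into the bits.\<close>

lemma CC_in [simp]: "CC \<in> M"
proof -
  define P where "P w \<longleftrightarrow> (\<forall>n\<in>elts homega. (hpair n (hbit False) \<in> elts w \<and> hpair n (hbit True) \<notin> elts w) \<or>
    (hpair n (hbit True) \<in> elts w \<and> hpair n (hbit False) \<notin> elts w))" for w
  let ?K = "power_in (hprod homega (hset {hbit False, hbit True}))"
  have sub: "elts (hreal x) \<subseteq> elts (hprod homega (hset {hbit False, hbit True}))" for x
    by (auto simp: elts_hreal)
  have "w \<in> hreal ` cantor_in M" if w: "w \<in> elts ?K" "P w" for w
  proof -
    define x where "x n \<longleftrightarrow> hpair (hnat n) (hbit True) \<in> elts w" for n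
    have "w = hreal x"
    proof (intro hc_ext set_eqI iffI)
      fix p assume p: "p \<in> elts w"
      then have "p \<in> elts (hprod homega (hset {hbit False, hbit True}))"
        using w(1) by auto
      then obtain n where n: "p = hpair (hnat n) (hbit False) \<or> p = hpair (hnat n) (hbit True)"
        unfolding elts_hprod by auto
      have "hpair (hnat n) (hbit False) \<notin> elts w \<or> hpair (hnat n) (hbit True) \<notin> elts w"
        using w(2) unfolding P_def by auto
      then show "p \<in> elts (hreal x)"
        using n p by (auto simp: x_def)
    next
      fix p assume "p \<in> elts (hreal x)"
      then obtain n where "p = hpair (hnat n) (hbit (x n))" by (auto simp: elts_hreal)
      then show "p \<in> elts w" using w(2) by (cases "x n") (auto simp: P_def x_def)
    qed
    then show ?thesis using w by (auto simp: cantor_in_def)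
  qed
  moreover have "hreal x \<in> elts ?K \<and> P (hreal x)" if "x \<in> cantor_in M" for x
    using that sub[of x] by (auto simp: P_def cantor_in_def)
  ultimately have "hreal ` cantor_in M = {w \<in> elts ?K. P w}" by blast
  moreover have "hset {w \<in> elts ?K. P w} \<in> M"
    unfolding P_def by (rule collect_in, rule term_in) (intro definability homega_in hbit_in)+
  ultimately show ?thesis by (simp add: CC_def hreals_def)
qed

definition SEQ :: hc where "SEQ = hset (range hstr)"

lemma elts_SEQ: "elts SEQ = range hstr"
  by (simp add: SEQ_def)

lemma hstr_in [simp]: "hstr s \<in> M"
proof -
  have "hpair (hnat i) (hbit b) \<in> M" for i b
    by (rule term_in) (intro definability hnat_in hbit_in)
  moreover have "finite (elts (hstr s))" by (auto simp: elts_hstr)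
  ultimately have "hset (elts (hstr s)) \<in> M" by (intro finite_in) (auto simp: elts_hstr)
  then show ?thesis by simp
qed

lemma SEQ_in [simp]: "SEQ \<in> M"
proof -
  define P where "P w \<longleftrightarrow> (\<exists>n\<in>elts homega. (\<forall>p\<in>elts w. \<exists>m\<in>elts n. \<exists>b\<in>elts (hset {hbit False, hbit True}). p = hpair m b) \<and>
    (\<forall>n\<in>elts n. (hpair n (hbit False) \<in> elts w \<and> hpair n (hbit True) \<notin> elts w) \<or>
    (hpair n (hbit True) \<in> elts w \<and> hpair n (hbit False) \<notin> elts w)))" for w
  let ?K = "power_in (hprod homega (hset {hbit False, hbit True}))"
  have "w \<in> range hstr" if w: "P w" for w
  proof -
    obtain k where k: "\<And>p. p \<in> elts w \<Longrightarrow> \<exists>m<k. p = hpair (hnat m) (hbit False) \<or> p = hpair (hnat m) (hbit True)"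
      "\<And>n. n < k \<Longrightarrow> (hpair (hnat n) (hbit False) \<in> elts w \<and> hpair (hnat n) (hbit True) \<notin> elts w) \<or>
        (hpair (hnat n) (hbit True) \<in> elts w \<and> hpair (hnat n) (hbit False) \<notin> elts w)"
      using w by (fastforce simp: P_def elts_hnat)
    define s where "s = map (\<lambda>n. hpair (hnat n) (hbit True) \<in> elts w) [0..<k]"
    have "w = hstr s"
    proof (intro hc_ext set_eqI iffI)
      fix p assume p: "p \<in> elts w"
      then show "p \<in> elts (hstr s)"
        using k(1)[OF p] k(2) by (auto simp: s_def) blast+
    next
      fix p assume "p \<in> elts (hstr s)"
      then obtain n where "n < k" "p = hpair (hnat n) (hbit (hpair (hnat n) (hbit True) \<in> elts w))"
        by (auto simp: elts_hstr s_def)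
      then show "p \<in> elts w" using k(2)[of n] by (auto)
    qed
    then show ?thesis by simp
  qed
  moreover have "hstr s \<in> elts ?K \<and> P (hstr s)" for s
  proof
    show "hstr s \<in> elts ?K" by (auto simp: elts_hstr)
    show "P (hstr s)"
      unfolding P_def
      by (intro bexI[of _ "hnat (length s)"] conjI) (auto simp: elts_hstr elts_hnat)
  qed
  ultimately have "range hstr = {w \<in> elts ?K. P w}" by blast
  moreover have "hset {w \<in> elts ?K. P w} \<in> M"
    unfolding P_def by (rule collect_in, rule term_in) (intro definability homega_in hbit_in)+
  ultimately show ?thesis by (simp add: SEQ_def)
qed

text \<open>Reals of \<open>M\<close> are closed under finite modification. Hence every cylinder
  meets \<open>cantor_in M\<close>, which turns density statements in \<open>cantor_top M\<close>
  into statements about strings.\<close>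

lemma patch_in: "y \<in> cantor_in M \<Longrightarrow> patch s y \<in> cantor_in M"
proof -
  assume y: "y \<in> cantor_in M"
  have "elts (hreal (patch s y)) = {p \<in> elts (hprod homega (hset {hbit False, hbit True})). p \<in> elts (hstr s) \<or>
      (p \<in> elts (hreal y) \<and> (\<exists>i\<in>elts homega. (\<exists>b\<in>elts (hset {hbit False, hbit True}). p = hpair i b) \<and> i \<notin> elts (hnat (length s))))}"
    by (auto simp: elts_hreal elts_hstr patch_def image_iff)
  moreover have "hset {p \<in> elts (hprod homega (hset {hbit False, hbit True})). p \<in> elts (hstr s) \<or>
      (p \<in> elts (hreal y) \<and> (\<exists>i\<in>elts homega. (\<exists>b\<in>elts (hset {hbit False, hbit True}). p = hpair i b) \<and> i \<notin> elts (hnat (length s))))} \<in> M"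
    using y by (rule_tac collect_in, rule_tac term_in)
      (unfold cantor_in_def mem_Collect_eq, (intro definability homega_in hbit_in hstr_in hnat_in; assumption)+)
  ultimately show ?thesis
    unfolding cantor_in_def by (metis hset_elts mem_Collect_eq)
qed

lemma cantor_in_nonempty: "cantor_in M \<noteq> {}"
proof -
  have "hreal (\<lambda>_. False) = hprod homega (hset {hbit False})"
    by (rule hc_ext) (auto simp: elts_hreal elts_hprod)
  moreover have "hprod homega (hset {hbit False}) \<in> M"
    by (rule term_in) (intro definability homega_in hbit_in)
  ultimately have "(\<lambda>_. False) \<in> cantor_in M" by (simp add: cantor_in_def)
  then show ?thesis by blast
qed

lemma cantor_in_dense: obtains x where "x \<in> cantor_in M" "pfx s x"
  using cantor_in_nonempty patch_in pfx_patch by blast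

end

lemma hreal_mem_image [simp]: "hreal x \<in> hreal ` A \<longleftrightarrow> x \<in> A"
  by auto

context ctm
begin

section \<open>Topology, category and Borel sets of \<open>M\<close> as predicates on codes\<close>

lemma openin_cantor_iff:
  "openin (cantor_top M) U \<longleftrightarrow>
     U \<subseteq> cantor_in M \<and> (\<forall>x\<in>U. \<exists>s. pfx s x \<and> {y \<in> cantor_in M. pfx s y} \<subseteq> U)"
proof
  assume "openin (cantor_top M) U"
  then obtain V where V: "open V" "U = cantor_in M \<inter> V" by (auto simp: openin_open)
  then show "U \<subseteq> cantor_in M \<and> (\<forall>x\<in>U. \<exists>s. pfx s x \<and> {y \<in> cantor_in M. pfx s y} \<subseteq> U)"
    unfolding open_real2_iff by blast
next
  assume U: "U \<subseteq> cantor_in M \<and> (\<forall>x\<in>U. \<exists>s. pfx s x \<and> {y \<in> cantor_in M. pfx s y} \<subseteq> U)"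
  let ?S = "{s. {y \<in> cantor_in M. pfx s y} \<subseteq> U}"
  have "U = cantor_in M \<inter> (\<Union>s\<in>?S. {y. pfx s y})" using U by blast
  moreover have "open (\<Union>s\<in>?S. {y. pfx s y})" by (intro open_UN ballI open_pfx)
  ultimately show "openin (cantor_top M) U" by (auto simp: openin_open)
qed

lemma openin_cylinder: "openin (cantor_top M) {y \<in> cantor_in M. pfx s y}"
  unfolding openin_cantor_iff by blast

lemma nowhere_dense_in_iff:
  assumes A: "A \<subseteq> cantor_in M" shows "nowhere_dense_in M A \<longleftrightarrow> nwd A"
proof
  assume nd: "nowhere_dense_in M A"
  show "nwd A"
    unfolding nwd_def
  proof
    fix s
    let ?U = "{y \<in> cantor_in M. pfx s y}"
    have "\<not> ?U \<subseteq> cantor_top M closure_of A"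
    proof
      assume "?U \<subseteq> cantor_top M closure_of A"
      then have "?U = {}"
        using nd interior_of_maximal[OF _ openin_cylinder] unfolding nowhere_dense_in_def by blast
      then show False using cantor_in_dense[of s] by blast
    qed
    then obtain x where x: "x \<in> cantor_in M" "pfx s x" "x \<notin> cantor_top M closure_of A" by blast
    then obtain T where T: "openin (cantor_top M) T" "x \<in> T" "A \<inter> T = {}"
      by (auto simp: in_closure_of)
    then obtain r where r: "pfx r x" "{y \<in> cantor_in M. pfx r y} \<subseteq> T"
      unfolding openin_cantor_iff by blast
    let ?q = "map x [0..<max (length r) (length s)]"
    obtain t u where q: "?q = s @ t" "?q = r @ u"
      using pfx_compare[OF x(2) pfx_map] pfx_compare[OF r(1) pfx_map]
      by (metis length_map length_upt diff_zero max.cobounded1 max.cobounded2)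
    have "\<not> pfx (s @ t) y" if "y \<in> A" for y
      using q pfx_appendD[of r u y] r(2) T(3) A that by auto
    then show "\<exists>t. \<forall>x\<in>A. \<not> pfx (s @ t) x" by blast
  qed
next
  assume nwd: "nwd A"
  show "nowhere_dense_in M A"
    unfolding nowhere_dense_in_def
  proof (rule ccontr)
    assume "cantor_top M interior_of (cantor_top M closure_of A) \<noteq> {}"
    then obtain x U where U: "x \<in> U" "openin (cantor_top M) U" "U \<subseteq> cantor_top M closure_of A"
      unfolding interior_of_def by blast
    then obtain s where s: "{y \<in> cantor_in M. pfx s y} \<subseteq> U"
      unfolding openin_cantor_iff by blast
    obtain t where t: "\<forall>x\<in>A. \<not> pfx (s @ t) x" using nwd unfolding nwd_def by blast
    obtain y where y: "y \<in> cantor_in M" "pfx (s @ t) y" using cantor_in_dense .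
    have "y \<in> U" using s y pfx_appendD[of s t y] by auto
    then have "y \<in> cantor_top M closure_of A" using U(3) by blast
    then have "\<forall>T. y \<in> T \<and> openin (cantor_top M) T \<longrightarrow> (\<exists>z. z \<in> A \<and> z \<in> T)"
      by (simp add: in_closure_of)
    from this[rule_format, of "{y \<in> cantor_in M. pfx (s @ t) y}"] obtain z where "z \<in> A" "pfx (s @ t) z"
      using y openin_cylinder[of "s @ t"] by auto
    then show False using t by blast
  qed
qed

lemma hreals_dec: "elts a \<subseteq> elts CC \<Longrightarrow> hreals (dec a) = a"
proof -
  assume "elts a \<subseteq> elts CC"
  then have "hreal ` dec a = elts a" by (auto simp: dec_def elts_CC)
  then show ?thesis by (simp add: hreals_def)
qed

lemma dec_hreals: "A \<subseteq> cantor_in M \<Longrightarrow> dec (hreals A) = A"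
  by (auto simp: dec_def elts_hreals)

lemma dec_subset: "elts a \<subseteq> elts CC \<Longrightarrow> dec a \<subseteq> cantor_in M"
  by (auto simp: dec_def elts_CC)

lemma subsets_in_iff: "A \<in> subsets_in M \<longleftrightarrow> A \<subseteq> cantor_in M \<and> hreals A \<in> elts (power_in CC)"
proof -
  have "elts (hreals A) \<subseteq> elts CC" if "A \<subseteq> cantor_in M"
    unfolding elts_hreals[OF that] elts_CC using that by (rule image_mono)
  then show ?thesis by (auto simp: subsets_in_def)
qed

lemma dec_in_subsets_in: "a \<in> elts (power_in CC) \<Longrightarrow> dec a \<in> subsets_in M"
  by (simp add: subsets_in_def hreals_dec dec_subset)

definition sec :: "hc \<Rightarrow> hc \<Rightarrow> hc" where
  "sec v n = hset {h \<in> elts CC. hpair n h \<in> elts v}"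

lemma definable_term_sec [definability]:
  "definable_term M t \<Longrightarrow> definable_term M u \<Longrightarrow> definable_term M (\<lambda>c. sec (t c) (u c))"
  by (rule definable_term_subst2[where f = sec], unfold sec_def) (intro definability CC_in)

lemma elts_sec: "elts (sec v n) = {h \<in> elts CC. hpair n h \<in> elts v}"
  by (simp add: sec_def)

definition cap :: "hc \<Rightarrow> hc \<Rightarrow> hc" where
  "cap t a = hset {h \<in> elts a. elts t \<subseteq> elts h}"

definition hdiff :: "hc \<Rightarrow> hc \<Rightarrow> hc" where
  "hdiff a b = hset {h \<in> elts a. h \<notin> elts b}"

lemma elts_cap [simp]: "elts (cap t a) = {h \<in> elts a. elts t \<subseteq> elts h}"
  by (simp add: cap_def)

lemma elts_hdiff [simp]: "elts (hdiff a b) = {h \<in> elts a. h \<notin> elts b}"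
  by (simp add: hdiff_def)

lemma definable_term_cap [definability]:
  "definable_term M t \<Longrightarrow> definable_term M u \<Longrightarrow> definable_term M (\<lambda>c. cap (t c) (u c))"
  by (rule definable_term_subst2[where f = cap], unfold cap_def) (intro definability)

lemma definable_term_hdiff [definability]:
  "definable_term M t \<Longrightarrow> definable_term M u \<Longrightarrow> definable_term M (\<lambda>c. hdiff (t c) (u c))"
  by (rule definable_term_subst2[where f = hdiff], unfold hdiff_def) (intro definability)

text \<open>From here on, \<open>hnwd\<close>, \<open>hmeager\<close>, \<open>hopen\<close>,
  \<open>hsigma\<close>, \<open>hborel\<close> and \<open>hcond\<close> restate the notions of
  category and Borel sets for elements of \<open>M\<close>. Being definable over \<open>M\<close>,
  they may occur in Separation and in dense sets.\<close>

definition hnwd :: "hc \<Rightarrow> bool" where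
  "hnwd a \<longleftrightarrow> (\<forall>s\<in>elts SEQ. \<exists>t\<in>elts SEQ. elts s \<subseteq> elts t \<and> (\<forall>h\<in>elts a. \<not> elts t \<subseteq> elts h))"

lemma definable_hnwd [definability]:
  "definable_term M t \<Longrightarrow> definable M (\<lambda>c. hnwd (t c))"
  by (rule definable_subst1[where P = hnwd], unfold hnwd_def) (intro definability SEQ_in)

lemma hnwd_iff:
  assumes "elts a \<subseteq> elts CC" shows "hnwd a \<longleftrightarrow> nwd (dec a)"
proof -
  have "(\<forall>h\<in>elts a. \<not> elts (hstr t) \<subseteq> elts h) \<longleftrightarrow> (\<forall>x\<in>dec a. \<not> pfx t x)" for t
    using assms by (auto simp: dec_def elts_CC simp flip: hstr_subset_hreal)
  then show ?thesis
    unfolding hnwd_def nwd_def by (simp add: elts_SEQ) metis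
qed

definition hmeager :: "hc \<Rightarrow> bool" where
  "hmeager a \<longleftrightarrow> (\<exists>v\<in>M. (\<forall>n\<in>elts homega. hnwd (sec v n)) \<and>
     (\<forall>h\<in>elts a. \<exists>n\<in>elts homega. hpair n h \<in> elts v))"

lemma definable_hmeager [definability]:
  "definable_term M t \<Longrightarrow> definable M (\<lambda>c. hmeager (t c))"
  by (rule definable_subst1[where P = hmeager], unfold hmeager_def) (intro definability homega_in)

lemma hmeager_subset: "hmeager b \<Longrightarrow> elts a \<subseteq> elts b \<Longrightarrow> hmeager a"
  unfolding hmeager_def by blast

text \<open>A set in \<open>M\<close> of pairs codes the sequence of its sections.\<close>

lemma seqs_in_iff:
  "s \<in> seqs_in M \<longleftrightarrow> (\<exists>v\<in>M. \<forall>n. hreals (s n) = sec v (hnat n)) \<and> (\<forall>n. s n \<subseteq> cantor_in M)"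
proof
  assume s: "s \<in> seqs_in M"
  let ?w = "hseq (\<lambda>n. hreals (s n))"
  have w: "?w \<in> M" "\<And>n. s n \<in> subsets_in M" using s by (auto simp: seqs_in_def)
  let ?P = "\<lambda>p. \<exists>n\<in>elts homega. \<exists>h\<in>elts CC. \<exists>a\<in>elts (power_in CC). p = hpair n h \<and> hpair n a \<in> elts ?w \<and> h \<in> elts a"
  let ?v = "hset {p \<in> elts (hprod homega CC). ?P p}"
  have "?v \<in> M"
    using w by (rule_tac collect_in, rule_tac term_in) (intro definability homega_in CC_in; assumption)+
  moreover have "hreals (s n) = sec ?v (hnat n)" for n
  proof (rule hc_ext)
    have "elts (sec ?v (hnat n)) = {h \<in> elts CC. \<exists>a\<in>elts (power_in CC). a = hreals (s n) \<and> h \<in> elts a}"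
      unfolding elts_sec elts_hset_Collect by auto
    then show "elts (hreals (s n)) = elts (sec ?v (hnat n))"
      using w(2)[of n] unfolding subsets_in_iff by auto
  qed
  moreover have "s n \<subseteq> cantor_in M" for n using w(2)[of n] by (simp add: subsets_in_def)
  ultimately show "(\<exists>v\<in>M. \<forall>n. hreals (s n) = sec v (hnat n)) \<and> (\<forall>n. s n \<subseteq> cantor_in M)"
    by (intro conjI bexI[of _ ?v] allI)
next
  assume "(\<exists>v\<in>M. \<forall>n. hreals (s n) = sec v (hnat n)) \<and> (\<forall>n. s n \<subseteq> cantor_in M)"
  then obtain v where v: "v \<in> M" "\<And>n. hreals (s n) = sec v (hnat n)" "\<And>n. s n \<subseteq> cantor_in M"
    by blast
  have sec: "sec v n \<in> M" if "n \<in> M" for n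
    using v(1) that by (rule_tac term_in) (intro definability)
  have "hset ((\<lambda>n. hpair n (sec v n)) ` elts homega) \<in> M"
    using v(1) by (rule_tac term_in) (intro definability homega_in)
  moreover have "(\<lambda>n. hpair n (sec v n)) ` elts homega = range (\<lambda>n. hpair (hnat n) (hreals (s n)))"
    by (auto simp: v(2))
  ultimately show "s \<in> seqs_in M"
    using v sec[OF hnat_in] by (auto simp: seqs_in_def subsets_in_def hseq_def)
qed

lemma elts_dec: "elts a \<subseteq> elts CC \<Longrightarrow> elts a = hreal ` dec a"
  by (auto simp: dec_def elts_CC)

lemma sec_subset: "elts (sec v n) \<subseteq> elts CC"
  by (auto simp: elts_sec)

lemma meager_in_iff:
  assumes A: "A \<subseteq> cantor_in M" shows "meager_in M A \<longleftrightarrow> hmeager (hreals A)"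
proof
  assume "meager_in M A"
  then obtain s where s: "s \<in> seqs_in M" "\<And>n. nowhere_dense_in M (s n)" "A \<subseteq> (\<Union>n. s n)"
    unfolding meager_in_def by blast
  then obtain v where v: "v \<in> M" "\<And>n. hreals (s n) = sec v (hnat n)" "\<And>n. s n \<subseteq> cantor_in M"
    unfolding seqs_in_iff by blast
  have "hnwd (sec v (hnat n))" for n
  proof -
    have "elts (hreals (s n)) \<subseteq> elts CC" using v(3)[of n] by (auto simp: elts_hreals elts_CC)
    then have "hnwd (hreals (s n))"
      using s(2)[of n] v(3)[of n] by (simp add: hnwd_iff nowhere_dense_in_iff dec_hreals)
    then show ?thesis by (simp only: v(2))
  qed
  moreover have "\<exists>n. hpair (hnat n) h \<in> elts v" if h: "h \<in> elts (hreals A)" for h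
  proof -
    obtain x where x: "x \<in> A" "h = hreal x" using h by (auto simp: elts_hreals[OF A])
    then obtain n where "x \<in> s n" using s(3) by blast
    then have "h \<in> elts (sec v (hnat n))" using x v(3)[of n] by (simp add: elts_hreals flip: v(2))
    then show ?thesis by (auto simp: elts_sec)
  qed
  ultimately show "hmeager (hreals A)" unfolding hmeager_def using v(1) by auto
next
  assume "hmeager (hreals A)"
  then obtain v where v: "v \<in> M" "\<And>n. hnwd (sec v (hnat n))"
    "\<And>h. h \<in> elts (hreals A) \<Longrightarrow> \<exists>n. hpair (hnat n) h \<in> elts v"
    unfolding hmeager_def by auto
  let ?s = "\<lambda>n. dec (sec v (hnat n))"
  have "?s \<in> seqs_in M"
    unfolding seqs_in_iff using v(1) by (auto simp: hreals_dec[OF sec_subset] dest: dec_subset[OF sec_subset, THEN subsetD])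
  moreover have "nowhere_dense_in M (?s n)" for n
    using v(2) by (simp add: nowhere_dense_in_iff dec_subset[OF sec_subset] hnwd_iff[OF sec_subset])
  moreover have "A \<subseteq> (\<Union>n. ?s n)"
    using v(3) A by (auto simp: elts_hreals[OF A] dec_def elts_sec elts_CC)
  ultimately show "meager_in M A" unfolding meager_in_def by (intro bexI[of _ ?s] conjI allI)
qed

definition hopen :: "hc \<Rightarrow> bool" where
  "hopen u \<longleftrightarrow> (\<forall>h\<in>elts u. \<exists>s\<in>elts SEQ. elts s \<subseteq> elts h \<and> (\<forall>k\<in>elts CC. elts s \<subseteq> elts k \<longrightarrow> k \<in> elts u))"

lemma openin_iff_hopen:
  assumes "U \<subseteq> cantor_in M" shows "openin (cantor_top M) U \<longleftrightarrow> hopen (hreals U)"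
proof -
  have "(\<exists>s\<in>elts SEQ. elts s \<subseteq> elts (hreal x) \<and> (\<forall>k\<in>elts CC. elts s \<subseteq> elts k \<longrightarrow> k \<in> elts (hreals U))) \<longleftrightarrow>
      (\<exists>s. pfx s x \<and> {y \<in> cantor_in M. pfx s y} \<subseteq> U)" for x
    by (auto simp: elts_hreals[OF assms] elts_SEQ elts_CC)
  then show ?thesis
    using assms by (simp add: openin_cantor_iff hopen_def elts_hreals)
qed

definition hsigma :: "hc \<Rightarrow> bool" where
  "hsigma S \<longleftrightarrow> elts S \<subseteq> elts (power_in CC) \<and> hset {} \<in> elts S \<and> (\<forall>a\<in>elts S. hdiff CC a \<in> elts S) \<and>
     (\<forall>v\<in>M. (\<forall>n\<in>elts homega. sec v n \<in> elts S) \<longrightarrow>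
        hset {h \<in> elts CC. \<exists>n\<in>elts homega. h \<in> elts (sec v n)} \<in> elts S)"

definition hborel :: "hc \<Rightarrow> bool" where
  "hborel a \<longleftrightarrow> a \<in> elts (power_in CC) \<and>
     (\<forall>S\<in>M. hsigma S \<and> (\<forall>u\<in>elts (power_in CC). hopen u \<longrightarrow> u \<in> elts S) \<longrightarrow> a \<in> elts S)"

lemma definable_hsigma [definability]:
  "definable_term M t \<Longrightarrow> definable M (\<lambda>c. hsigma (t c))"
  by (rule definable_subst1[where P = hsigma], unfold hsigma_def) (intro definability homega_in CC_in empty_in)

lemma definable_hopen [definability]:
  "definable_term M t \<Longrightarrow> definable M (\<lambda>c. hopen (t c))"
  by (rule definable_subst1[where P = hopen], unfold hopen_def) (intro definability CC_in SEQ_in)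

lemma definable_hborel [definability]:
  "definable_term M t \<Longrightarrow> definable M (\<lambda>c. hborel (t c))"
  by (rule definable_subst1[where P = hborel], unfold hborel_def) (intro definability CC_in SEQ_in)

definition hcond :: "hc \<Rightarrow> bool" where
  "hcond a \<longleftrightarrow> hborel a \<and> \<not> hmeager a"

lemma definable_hcond [definability]:
  "definable_term M t \<Longrightarrow> definable M (\<lambda>c. hcond (t c))"
  by (rule definable_subst1[where P = hcond], unfold hcond_def) (intro definability)

lemma elts_hfamily: "S \<subseteq> subsets_in M \<Longrightarrow> elts (hfamily S) = hreals ` S"
  unfolding hfamily_def by (rule elts_hset_subset) (auto simp: subsets_in_def)

lemma hreals_inj: "A \<subseteq> cantor_in M \<Longrightarrow> B \<subseteq> cantor_in M \<Longrightarrow> hreals A = hreals B \<Longrightarrow> A = B"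
  by (metis dec_hreals)

lemma hreals_mem_hfamily:
  "S \<subseteq> subsets_in M \<Longrightarrow> A \<subseteq> cantor_in M \<Longrightarrow> hreals A \<in> elts (hfamily S) \<longleftrightarrow> A \<in> S"
proof -
  assume S: "S \<subseteq> subsets_in M" and A: "A \<subseteq> cantor_in M"
  have "A = B" if "B \<in> S" "hreals A = hreals B" for B
    using S that by (intro hreals_inj[OF A]) (auto simp: subsets_in_def)
  then show ?thesis unfolding elts_hfamily[OF S] by auto
qed

lemma hdiff_CC: "A \<subseteq> cantor_in M \<Longrightarrow> hdiff CC (hreals A) = hreals (cantor_in M - A)"
  by (rule hc_ext) (auto simp: elts_hreals elts_CC)

lemma hUN_sec:
  assumes "\<And>n. hreals (s n) = sec v (hnat n)" "\<And>n. s n \<subseteq> cantor_in M"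
  shows "hset {h \<in> elts CC. \<exists>n\<in>elts homega. h \<in> elts (sec v n)} = hreals (\<Union>n. s n)"
proof (rule hc_ext)
  have "(\<Union>n. s n) \<subseteq> cantor_in M" using assms(2) by blast
  then show "elts (hset {h \<in> elts CC. \<exists>n\<in>elts homega. h \<in> elts (sec v n)}) = elts (hreals (\<Union>n. s n))"
    unfolding elts_hset_Collect using assms(2) by (auto simp: elts_hreals elts_CC simp flip: assms(1))
qed

lemma sigma_algebra_in_iff:
  assumes S: "S \<subseteq> subsets_in M" "hfamily S \<in> M"
  shows "sigma_algebra_in M S \<longleftrightarrow> hsigma (hfamily S)"
proof -
  have sub: "A \<subseteq> cantor_in M" if "A \<in> S" for A using S that by (auto simp: subsets_in_def)
  have "elts (hfamily S) \<subseteq> elts (power_in CC)"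
    using S(1) unfolding elts_hfamily[OF S(1)] by (auto simp: subsets_in_iff simp del: elts_power_in)
  moreover have "hset {} \<in> elts (hfamily S) \<longleftrightarrow> {} \<in> S"
    using hreals_mem_hfamily[OF S(1), of "{}"] by (simp add: hreals_def)
  moreover have "(\<forall>a\<in>elts (hfamily S). hdiff CC a \<in> elts (hfamily S)) \<longleftrightarrow> (\<forall>A\<in>S. cantor_in M - A \<in> S)"
    using hreals_mem_hfamily[OF S(1)] sub by (auto simp: elts_hfamily[OF S(1)] hdiff_CC)
  moreover have "(\<forall>v\<in>M. (\<forall>n\<in>elts homega. sec v n \<in> elts (hfamily S)) \<longrightarrow>
        hset {h \<in> elts CC. \<exists>n\<in>elts homega. h \<in> elts (sec v n)} \<in> elts (hfamily S)) \<longleftrightarrow>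
      (\<forall>s\<in>seqs_in M. range s \<subseteq> S \<longrightarrow> (\<Union>n. s n) \<in> S)" (is "?L \<longleftrightarrow> ?R")
  proof
    assume L: ?L
    show ?R
    proof (intro ballI impI)
      fix s assume s: "s \<in> seqs_in M" "range s \<subseteq> S"
      then obtain v where v: "v \<in> M" "\<And>n. hreals (s n) = sec v (hnat n)" "\<And>n. s n \<subseteq> cantor_in M"
        unfolding seqs_in_iff by blast
      have "sec v (hnat n) \<in> elts (hfamily S)" for n
        using s(2) v(3)[of n] by (auto simp: hreals_mem_hfamily[OF S(1)] simp flip: v(2))
      then have "hreals (\<Union>n. s n) \<in> elts (hfamily S)"
        using L[rule_format, OF v(1)] hUN_sec[OF v(2,3)] by auto
      then show "(\<Union>n. s n) \<in> S"
        using v(3) by (subst (asm) hreals_mem_hfamily[OF S(1)]) auto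
    qed
  next
    assume R: ?R
    show ?L
    proof (intro ballI impI)
      fix v assume v: "v \<in> M" "\<forall>n\<in>elts homega. sec v n \<in> elts (hfamily S)"
      let ?s = "\<lambda>n. dec (sec v (hnat n))"
      have s: "hreals (?s n) = sec v (hnat n)" "?s n \<subseteq> cantor_in M" for n
        by (simp_all add: hreals_dec[OF sec_subset] dec_subset[OF sec_subset])
      have "?s \<in> seqs_in M" unfolding seqs_in_iff using s v by blast
      moreover have "?s n \<in> S" for n
        using v(2) s(2) s(1)[of n] by (subst hreals_mem_hfamily[OF S(1), symmetric]) auto
      ultimately have "(\<Union>n. ?s n) \<in> S" using R[rule_format, of ?s] by auto
      then show "hset {h \<in> elts CC. \<exists>n\<in>elts homega. h \<in> elts (sec v n)} \<in> elts (hfamily S)"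
        using hUN_sec[OF s] by (auto simp: elts_hfamily[OF S(1)])
    qed
  qed
  ultimately show ?thesis
    unfolding sigma_algebra_in_def hsigma_def using S by simp
qed

lemma hfamily_dec:
  assumes "T \<in> M" "elts T \<subseteq> elts (power_in CC)"
  shows "hfamily (dec ` elts T) = T" "dec ` elts T \<subseteq> subsets_in M"
proof -
  show *: "dec ` elts T \<subseteq> subsets_in M" using assms(2) dec_in_subsets_in by blast
  have "hreals (dec a) = a" if "a \<in> elts T" for a
    using assms(2) that by (intro hreals_dec) auto
  then show "hfamily (dec ` elts T) = T"
    by (intro hc_ext) (simp add: elts_hfamily[OF *] image_image)
qed

text \<open>\<open>hfamily\<close> and \<open>dec\<close> match the sigma-algebras of
  \<open>M\<close> with their codes in \<open>M\<close>, so both sides quantify over the same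
  objects.\<close>

lemma borel_in_iff:
  assumes A: "A \<subseteq> cantor_in M" shows "A \<in> borel_in M \<longleftrightarrow> hborel (hreals A)"
proof (cases "hreals A \<in> M")
  case False
  then show ?thesis by (auto simp: borel_in_def hborel_def subsets_in_def)
next
  case True
  then have A': "A \<in> subsets_in M" "hreals A \<in> elts (power_in CC)"
    using A by (auto simp: subsets_in_def elts_hreals elts_CC)
  have opens: "(\<forall>U\<in>subsets_in M. openin (cantor_top M) U \<longrightarrow> U \<in> S) \<longleftrightarrow>
      (\<forall>u\<in>elts (power_in CC). hopen u \<longrightarrow> u \<in> elts (hfamily S))" if S: "S \<subseteq> subsets_in M" for S
  proof
    assume L: "\<forall>U\<in>subsets_in M. openin (cantor_top M) U \<longrightarrow> U \<in> S"
    show "\<forall>u\<in>elts (power_in CC). hopen u \<longrightarrow> u \<in> elts (hfamily S)"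
    proof (intro ballI impI)
      fix u assume u: "u \<in> elts (power_in CC)" "hopen u"
      then have "hreals (dec u) = u" "dec u \<subseteq> cantor_in M" "dec u \<in> subsets_in M"
        by (simp_all add: hreals_dec dec_subset dec_in_subsets_in)
      then show "u \<in> elts (hfamily S)"
        using L u openin_iff_hopen[of "dec u"] hreals_mem_hfamily[OF S, of "dec u"] by auto
    qed
  next
    assume R: "\<forall>u\<in>elts (power_in CC). hopen u \<longrightarrow> u \<in> elts (hfamily S)"
    show "\<forall>U\<in>subsets_in M. openin (cantor_top M) U \<longrightarrow> U \<in> S"
    proof (intro ballI impI)
      fix U assume "U \<in> subsets_in M" and U: "openin (cantor_top M) U"
      then have U': "U \<subseteq> cantor_in M" "hreals U \<in> elts (power_in CC)"
        by (simp_all only: subsets_in_iff)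
      then show "U \<in> S"
        using R[rule_format, OF U'(2)] U openin_iff_hopen[OF U'(1)] hreals_mem_hfamily[OF S U'(1)] by simp
    qed
  qed
  show ?thesis
  proof
    assume L: "A \<in> borel_in M"
    show "hborel (hreals A)"
      unfolding hborel_def
    proof (intro conjI A' ballI impI, elim conjE)
      fix T assume T: "T \<in> M" "hsigma T" "\<forall>u\<in>elts (power_in CC). hopen u \<longrightarrow> u \<in> elts T"
      then have "elts T \<subseteq> elts (power_in CC)" by (auto simp: hsigma_def)
      note fam = hfamily_dec[OF T(1) this]
      have "sigma_algebra_in M (dec ` elts T)"
        using sigma_algebra_in_iff[OF fam(2)] T fam by simp
      moreover have "\<forall>U\<in>subsets_in M. openin (cantor_top M) U \<longrightarrow> U \<in> dec ` elts T"
        using opens[OF fam(2)] T(3) fam(1) by simp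
      ultimately have "A \<in> dec ` elts T" using L unfolding borel_in_def by blast
      then show "hreals A \<in> elts T" using hreals_mem_hfamily[OF fam(2) A] fam(1) by simp
    qed
  next
    assume R: "hborel (hreals A)"
    have "A \<in> S" if S: "sigma_algebra_in M S" "\<forall>U\<in>subsets_in M. openin (cantor_top M) U \<longrightarrow> U \<in> S" for S
    proof -
      have S': "S \<subseteq> subsets_in M" "hfamily S \<in> M" using S by (auto simp: sigma_algebra_in_def)
      have "hreals A \<in> elts (hfamily S)"
        using R S S' opens[OF S'(1)] sigma_algebra_in_iff[OF S'] unfolding hborel_def by blast
      then show ?thesis using hreals_mem_hfamily[OF S'(1) A] by simp
    qed
    then show "A \<in> borel_in M" unfolding borel_in_def using A' by blast
  qed
qed

lemma cohen_poset_iff: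
  "A \<in> cohen_poset M \<longleftrightarrow> A \<subseteq> cantor_in M \<and> hcond (hreals A)"
proof (cases "A \<subseteq> cantor_in M")
  case True
  then show ?thesis by (simp add: cohen_poset_def borel_in_iff meager_in_iff hcond_def)
next
  case False
  then show ?thesis by (auto simp: cohen_poset_def borel_in_def subsets_in_def)
qed

lemma hcondD: "hcond a \<Longrightarrow> a \<in> M" "hcond a \<Longrightarrow> elts a \<subseteq> elts CC"
  by (auto simp: hcond_def hborel_def)

lemma hcond_dec: "hcond a \<Longrightarrow> dec a \<in> cohen_poset M"
  by (simp add: cohen_poset_iff hreals_dec dec_subset hcondD)

end

text \<open>The domain of a string. Comparing it with a numeral expresses the length of a string by
  bounded quantifiers, without a length function in \<open>M\<close>.\<close>

definition hdom :: "hc \<Rightarrow> hc \<Rightarrow> bool" where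
  "hdom i s \<longleftrightarrow> hpair i (hbit False) \<in> elts s \<or> hpair i (hbit True) \<in> elts s"

lemma hdom_hstr [simp]: "hdom (hnat i) (hstr s) \<longleftrightarrow> i < length s"
  by (auto simp: hdom_def)

lemma all_less_imp_less_iff: "(\<forall>i::nat. i < m \<longrightarrow> i < n) \<longleftrightarrow> m \<le> n"
  by (meson dual_order.strict_trans2 linorder_not_less order_less_irrefl)

lemma all_less_iff_less_iff: "(\<forall>i::nat. i < m \<longleftrightarrow> i < n) \<longleftrightarrow> m = n"
  by (metis linorder_less_linear order_less_irrefl)

section \<open>The ideal of meager sets and the Baire property in \<open>M\<close>\<close>

context ctm
begin

lemma definable_hdom [definability]:
  "definable_term M t \<Longrightarrow> definable_term M u \<Longrightarrow> definable M (\<lambda>c. hdom (t c) (u c))"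
  unfolding hdom_def by (intro definability hbit_in)

text \<open>
  Choice in \<open>M\<close> picks a witness for every section; taking finite unions of the chosen nowhere dense
  sets yields a sequence without a pairing function.
\<close>

lemma hmeager_UN:
  assumes R: "definable M (\<lambda>c. R (c 0) (c 1))"
    and meager: "\<And>s. hmeager (hset {h \<in> elts CC. R (hstr s) h})"
  shows "hmeager (hset {h \<in> elts CC. \<exists>s\<in>elts SEQ. R s h})"
proof -
  note R' = definable_subst2[of M R, OF R]
  define Q where "Q s v \<longleftrightarrow> (\<forall>n\<in>elts homega. hnwd (sec v n)) \<and>
    (\<forall>h\<in>elts CC. R s h \<longrightarrow> (\<exists>n\<in>elts homega. hpair n h \<in> elts v))" for s v
  let ?B = "power_in (hprod homega CC)"
  have prod: "hprod homega CC \<in> M"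
    by (rule term_in) (intro definability homega_in CC_in)
  have "\<exists>v\<in>elts ?B. Q i v" if i: "i \<in> elts SEQ" for i
  proof -
    obtain s where s: "i = hstr s" using i by (auto simp: elts_SEQ)
    obtain w where w: "w \<in> M" "\<And>n. hnwd (sec w (hnat n))"
      "\<And>h. h \<in> elts CC \<Longrightarrow> R (hstr s) h \<Longrightarrow> \<exists>n. hpair (hnat n) h \<in> elts w"
      using meager[of s] unfolding hmeager_def elts_hset_Collect by auto
    let ?v = "hset {p \<in> elts (hprod homega CC). p \<in> elts w}"
    have "?v \<in> M" using prod w(1) by (intro collect_in definability)
    moreover have "sec ?v (hnat n) = sec w (hnat n)" for n
      by (rule hc_ext) (simp add: elts_sec)
    ultimately show ?thesis
      using w by (intro bexI[of _ ?v]) (auto simp: Q_def s)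
  qed
  moreover have "definable M (\<lambda>c. Q (c 0) (c 1))"
    unfolding Q_def by (intro definability R' homega_in CC_in)
  ultimately obtain g where g: "\<And>i. i \<in> elts SEQ \<Longrightarrow> g i \<in> elts ?B \<and> Q i (g i)"
    and gM: "hset ((\<lambda>i. hpair i (g i)) ` elts SEQ) \<in> M"
    using uniformization[OF SEQ_in power_in_in[OF prod], of Q] by blast
  let ?g = "hset ((\<lambda>i. hpair i (g i)) ` elts SEQ)"
  have g_mem: "hpair (hstr s) v \<in> elts ?g \<longleftrightarrow> v = g (hstr s)" for s v
    by (auto simp: elts_SEQ)
  \<comment> \<open>The clause on \<open>hdom\<close> says that \<open>s\<close> has length at most
    \<open>n\<close>.\<close>
  define P where "P n h \<longleftrightarrow> (\<exists>s\<in>elts SEQ.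
      (\<forall>i\<in>elts homega. hdom i s \<longrightarrow> i \<in> elts n) \<and>
      (\<exists>v\<in>elts ?B. hpair s v \<in> elts ?g \<and> (\<exists>m\<in>elts n. hpair m h \<in> elts v)))" for n h
  let ?V = "hset {p \<in> elts (hprod homega CC). \<exists>n\<in>elts homega. \<exists>h\<in>elts CC. p = hpair n h \<and> P n h}"
  have P_iff: "P (hnat n) h \<longleftrightarrow> (\<exists>s m. length s \<le> n \<and> m < n \<and> hpair (hnat m) h \<in> elts (g (hstr s)))" for n h
  proof -
    have "(\<forall>i\<in>elts homega. hdom i (hstr s) \<longrightarrow> i \<in> elts (hnat n)) \<longleftrightarrow> length s \<le> n" for s
      by (simp add: all_less_imp_less_iff)
    moreover have "(\<exists>v\<in>elts ?B. hpair (hstr s) v \<in> elts ?g \<and> (\<exists>m\<in>elts (hnat n). hpair m h \<in> elts v)) \<longleftrightarrow>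
        (\<exists>m<n. hpair (hnat m) h \<in> elts (g (hstr s)))" for s
      unfolding g_mem using g[of "hstr s"] by (auto simp: elts_SEQ elts_hnat)
    ultimately show ?thesis unfolding P_def by (auto simp: elts_SEQ)
  qed
  have VM: "?V \<in> M"
    unfolding P_def by (rule collect_in[OF prod]) (intro definability homega_in CC_in SEQ_in prod gM power_in_in)
  have "hnwd (sec ?V (hnat n))" for n
  proof -
    let ?I = "{s :: bool list. length s \<le> n} \<times> {..<n}"
    have "dec (sec ?V (hnat n)) \<subseteq> (\<Union>(s, m)\<in>?I. dec (sec (g (hstr s)) (hnat m)))"
      unfolding dec_def elts_sec elts_hset_Collect by (auto simp: P_iff)
    moreover have "nwd (\<Union>(s, m)\<in>?I. dec (sec (g (hstr s)) (hnat m)))"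
    proof (rule nwd_UN)
      show "finite ?I" using finite_lists_length_le[of "UNIV :: bool set" n] by simp
      show "nwd (case i of (s, m) \<Rightarrow> dec (sec (g (hstr s)) (hnat m)))" for i
        using g by (cases i) (auto simp: Q_def elts_SEQ simp flip: hnwd_iff[OF sec_subset])
    qed
    ultimately have "nwd (dec (sec ?V (hnat n)))" by (rule nwd_subset[rotated])
    then show ?thesis by (simp add: hnwd_iff[OF sec_subset])
  qed
  moreover have "\<exists>n. hpair (hnat n) h \<in> elts ?V" if h: "h \<in> elts CC" "R (hstr s) h" for h s
  proof -
    obtain m where "hpair (hnat m) h \<in> elts (g (hstr s))"
      using g[of "hstr s"] h unfolding Q_def by (auto simp: elts_SEQ)
    then have "P (hnat (max (length s) (Suc m))) h" unfolding P_iff by (intro exI[of _ s] exI[of _ m]) auto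
    then show ?thesis using h(1) unfolding elts_hset_Collect by auto
  qed
  ultimately show ?thesis
    unfolding hmeager_def elts_hset_Collect
    by (intro bexI[OF _ VM] conjI) (auto simp: elts_SEQ simp del: elts_hset_Collect)
qed

lemma hmeager_Un:
  assumes "hmeager a" "hmeager b" "a \<in> M" "b \<in> M" "elts c \<subseteq> elts CC" "elts c \<subseteq> elts a \<union> elts b"
  shows "hmeager c"
proof -
  \<comment> \<open>The index set consists of strings: the empty one stands for \<open>a\<close>,
    all others for \<open>b\<close>.\<close>
  let ?R = "\<lambda>s h. (s = hset {} \<and> h \<in> elts a) \<or> (s \<noteq> hset {} \<and> h \<in> elts b)"
  have "hmeager (hset {h \<in> elts CC. \<exists>s\<in>elts SEQ. ?R s h})"
  proof (rule hmeager_UN)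
    show "definable M (\<lambda>c. ?R (c 0) (c 1))" using assms by (intro definability empty_in)
    show "hmeager (hset {h \<in> elts CC. ?R (hstr s) h})" for s
      by (cases "hstr s = hset {}") (auto intro: hmeager_subset[OF assms(1)] hmeager_subset[OF assms(2)])
  qed
  moreover have "hstr [] \<in> elts SEQ" "hstr [True] \<in> elts SEQ" "hstr [True] \<noteq> hset {}"
    by (simp_all add: elts_SEQ flip: hstr_Nil)
  ultimately show ?thesis
    using assms(5,6) by (elim hmeager_subset) (auto simp: hstr_Nil)
qed

lemma hmeager_hnwd:
  assumes "hnwd a" "a \<in> M" "elts a \<subseteq> elts CC" shows "hmeager a"
  unfolding hmeager_def
proof (rule bexI[of _ "hprod homega a"], intro conjI ballI)
  show "hprod homega a \<in> M" using assms(2) by (rule_tac term_in) (intro definability homega_in)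
  have "sec (hprod homega a) n = a" if "n \<in> elts homega" for n
    using that assms(3) by (intro hc_ext) (auto simp: elts_sec)
  then show "hnwd (sec (hprod homega a) n)" if "n \<in> elts homega" for n
    using that assms(1) by simp
  show "\<exists>n\<in>elts homega. hpair n h \<in> elts (hprod homega a)" if "h \<in> elts a" for h
    using that by auto
qed

lemma hmeager_empty: "elts a = {} \<Longrightarrow> hmeager a"
  unfolding hmeager_def using hc_ext[of _ "hset {}"]
  by (intro bexI[OF _ empty_in]) (auto simp: hnwd_def elts_sec)

lemma cap_in: "t \<in> M \<Longrightarrow> a \<in> M \<Longrightarrow> cap t a \<in> M"
  by (rule term_in) (intro definability)

lemma hdiff_in: "t \<in> M \<Longrightarrow> a \<in> M \<Longrightarrow> hdiff t a \<in> M"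
  by (rule term_in) (intro definability)

text \<open>The Banach category theorem for the countable base of cylinders: the reals of
  \<open>M\<close> extending \<open>s\<close> that avoid all cylinders from \<open>W\<close> form a
  nowhere dense set \<open>?N\<close>, and \<open>hmeager_UN\<close> collects the parts of
  \<open>a\<close> in the cylinders from \<open>W\<close>.\<close>

lemma hmeager_dense:
  assumes W: "definable M (\<lambda>c. W (c 0))" and a: "a \<in> M" "elts a \<subseteq> elts CC"
    and dense: "\<And>t. \<exists>u. W (hstr (s @ t @ u))"
    and meager: "\<And>t. W (hstr t) \<Longrightarrow> hmeager (cap (hstr t) a)"
  shows "hmeager (cap (hstr s) a)"
proof -
  note W' = definable_subst1[of M W, OF W]
  let ?N = "hset {h \<in> elts CC. elts (hstr s) \<subseteq> elts h \<and> (\<forall>r\<in>elts SEQ. W r \<longrightarrow> \<not> elts r \<subseteq> elts h)}"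
  \<comment> \<open>The part of \<open>a\<close> inside \<open>?N\<close> is included for every
    \<open>t\<close>, so one union over the strings covers everything.\<close>
  let ?R = "\<lambda>t h. h \<in> elts a \<and> elts (hstr s) \<subseteq> elts h \<and>
    ((W t \<and> elts t \<subseteq> elts h) \<or> (\<forall>r\<in>elts SEQ. W r \<longrightarrow> \<not> elts r \<subseteq> elts h))"
  have N: "?N \<in> M" by (intro collect_in) (intro definability W' CC_in hstr_in SEQ_in)+
  have "nwd (dec ?N)"
    unfolding nwd_def
  proof
    fix q
    show "\<exists>t. \<forall>x\<in>dec ?N. \<not> pfx (q @ t) x"
    proof (cases "\<exists>x\<in>dec ?N. pfx q x")
      case True
      then obtain x where x: "pfx s x" "pfx q x"
        unfolding dec_def elts_hset_Collect by auto
      have "\<exists>t v. q @ t = s @ v"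
        using pfx_compare[OF x] pfx_compare[OF x(2,1)] by (metis append_Nil2 linear)
      then obtain t v where tv: "q @ t = s @ v" by blast
      then obtain u where u: "W (hstr (s @ v @ u))" using dense by blast
      have "\<not> pfx (q @ t @ u) y" if "y \<in> dec ?N" for y
        using that u tv unfolding dec_def elts_hset_Collect
        by (auto simp: elts_SEQ) (metis append.assoc)
      then show ?thesis by blast
    next
      case False then show ?thesis by (intro exI[of _ "[]"]) simp
    qed
  qed
  then have meagerN: "hmeager ?N"
    using N by (intro hmeager_hnwd) (auto simp: hnwd_iff)
  have "hmeager (hset {h \<in> elts CC. \<exists>t\<in>elts SEQ. ?R t h})"
  proof (rule hmeager_UN)
    show "definable M (\<lambda>c. ?R (c 0) (c 1))" using a by (intro definability W' hstr_in SEQ_in)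
    show "hmeager (hset {h \<in> elts CC. ?R (hstr t) h})" for t
    proof (cases "W (hstr t)")
      case True
      show ?thesis
        by (rule hmeager_Un[OF meager[OF True] meagerN cap_in[OF hstr_in a(1)] N]) auto
    next
      case False
      then show ?thesis by (intro hmeager_subset[OF meagerN]) auto
    qed
  qed
  moreover have "hstr [] \<in> elts SEQ" by (simp add: elts_SEQ)
  ultimately show ?thesis
    using a(2) by (elim hmeager_subset, unfold elts_cap elts_hset_Collect) blast
qed

text \<open>The Baire property, localized: \<open>a\<close> is meager or comeager in densely many
  cylinders. In this form it passes to complements at once and is a dense set of strings for a Cohen
  real to meet.\<close>

definition hbp :: "hc \<Rightarrow> bool" where
  "hbp a \<longleftrightarrow> (\<forall>s\<in>elts SEQ. \<exists>t\<in>elts SEQ. elts s \<subseteq> elts t \<and>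
     (hmeager (cap t a) \<or> hmeager (hdiff (cap t CC) a)))"

lemma hbp_iff: "hbp a \<longleftrightarrow>
    (\<forall>s. \<exists>u. hmeager (cap (hstr (s @ u)) a) \<or> hmeager (hdiff (cap (hstr (s @ u)) CC) a))"
  unfolding hbp_def by (simp add: elts_SEQ) metis

lemma definable_hbp [definability]:
  "definable_term M t \<Longrightarrow> definable M (\<lambda>c. hbp (t c))"
  by (rule definable_subst1[where P = hbp], unfold hbp_def) (intro definability CC_in SEQ_in)

text \<open>If some section is comeager in a cylinder below \<open>s\<close>, then so is the union.
  Otherwise the Baire property makes every section meager in densely many cylinders below
  \<open>s\<close>, hence meager below \<open>s\<close>, and the union is meager there too.\<close>

lemma hbp_UN:
  assumes v: "v \<in> M" and bp: "\<And>n. hbp (sec v (hnat n))"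
  shows "hbp (hset {h \<in> elts CC. \<exists>n\<in>elts homega. h \<in> elts (sec v n)})" (is "hbp ?U")
  unfolding hbp_iff
proof
  fix s
  have sec: "sec v (hnat n) \<in> M" for n using v by (rule_tac term_in) (intro definability hnat_in)
  show "\<exists>u. hmeager (cap (hstr (s @ u)) ?U) \<or> hmeager (hdiff (cap (hstr (s @ u)) CC) ?U)"
  proof (cases "\<exists>n u. hmeager (hdiff (cap (hstr (s @ u)) CC) (sec v (hnat n)))")
    case True
    then obtain n u where "hmeager (hdiff (cap (hstr (s @ u)) CC) (sec v (hnat n)))" by blast
    then have "hmeager (hdiff (cap (hstr (s @ u)) CC) ?U)"
      by (rule hmeager_subset) auto
    then show ?thesis by blast
  next
    case False
    have "hmeager (cap (hstr s) (sec v (hnat n)))" for n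
    proof (rule hmeager_dense[of "\<lambda>t. hmeager (cap t (sec v (hnat n)))"])
      show "definable M (\<lambda>c. hmeager (cap (c 0) (sec v (hnat n))))"
        using v by (intro definability hnat_in)
      show "\<exists>u. hmeager (cap (hstr (s @ t @ u)) (sec v (hnat n)))" for t
        using bp[of n] False unfolding hbp_iff by (metis append.assoc)
    qed (auto simp: sec sec_subset[THEN subsetD])
    note m = this
    \<comment> \<open>\<open>hmeager_UN\<close> is indexed by strings, so the strings of length
      \<open>n\<close> represent the index \<open>n\<close>.\<close>
    let ?R = "\<lambda>t h. elts (hstr s) \<subseteq> elts h \<and> (\<exists>n\<in>elts homega. h \<in> elts (sec v n) \<and>
      (\<forall>i\<in>elts homega. hdom i t \<longleftrightarrow> i \<in> elts n))"
    have len: "(\<forall>i\<in>elts homega. hdom i (hstr t) \<longleftrightarrow> i \<in> elts (hnat n)) \<longleftrightarrow> length t = n" for t n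
      by (simp add: all_less_iff_less_iff)
    have "hmeager (hset {h \<in> elts CC. \<exists>t\<in>elts SEQ. ?R t h})"
    proof (rule hmeager_UN)
      show "definable M (\<lambda>c. ?R (c 0) (c 1))"
        using v by (intro definability hstr_in homega_in hbit_in)
      show "hmeager (hset {h \<in> elts CC. ?R (hstr t) h})" for t
        using m[of "length t"] by (rule hmeager_subset) (auto simp: all_less_iff_less_iff)
    qed
    then have "hmeager (cap (hstr s) ?U)"
    proof (rule hmeager_subset)
      have "\<exists>t\<in>elts SEQ. ?R t h" if "elts (hstr s) \<subseteq> elts h" "h \<in> elts (sec v (hnat n))" for h n
        using that by (intro bexI[of _ "hstr (replicate n True)"]) (auto simp: elts_SEQ)
      then show "elts (cap (hstr s) ?U) \<subseteq> elts (hset {h \<in> elts CC. \<exists>t\<in>elts SEQ. ?R t h})"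
        unfolding elts_cap elts_hset_Collect by auto
    qed
    then show ?thesis by (intro exI[of _ "[]"]) simp
  qed
qed

lemma hbp_hopen:
  assumes u: "elts u \<subseteq> elts CC" "hopen u" shows "hbp u"
  unfolding hbp_iff
proof
  fix s
  show "\<exists>v. hmeager (cap (hstr (s @ v)) u) \<or> hmeager (hdiff (cap (hstr (s @ v)) CC) u)"
  proof (cases "\<exists>x\<in>dec u. pfx s x")
    case True
    then obtain x where x: "hreal x \<in> elts u" "pfx s x" by (auto simp: dec_def)
    then obtain r where r: "pfx r x" "\<And>k. k \<in> elts CC \<Longrightarrow> elts (hstr r) \<subseteq> elts k \<Longrightarrow> k \<in> elts u"
      using u(2) unfolding hopen_def by (auto simp: elts_SEQ)
    have "\<exists>v w. s @ v = r @ w"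
      using pfx_compare[OF x(2) r(1)] pfx_compare[OF r(1) x(2)] by (metis append_Nil2 linear)
    then obtain v w where vw: "s @ v = r @ w" by blast
    have "elts (hstr r) \<subseteq> elts (hstr (s @ v))" unfolding vw by simp
    then have "elts (hdiff (cap (hstr (s @ v)) CC) u) = {}"
      unfolding elts_hdiff elts_cap using r(2) by blast
    then show ?thesis using hmeager_empty by blast
  next
    case False
    then have "elts (cap (hstr s) u) = {}" unfolding elts_cap using elts_dec[OF u(1)] by auto
    then show ?thesis using hmeager_empty by (intro exI[of _ "[]"]) auto
  qed
qed

text \<open>Since \<open>hbp\<close> is definable, the sets with the Baire property form an element
  of \<open>M\<close>. It is a sigma-algebra there and contains the open sets, so every Borel set of
  \<open>M\<close> belongs to it.\<close>

lemma hborel_hbp: assumes "hborel a" shows "hbp a"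
proof -
  let ?S = "hset {a \<in> elts (power_in CC). hbp a}"
  have "?S \<in> M" by (intro collect_in power_in_in) (intro definability CC_in)+
  moreover have "hsigma ?S"
    unfolding hsigma_def elts_hset_Collect
  proof (intro conjI ballI impI)
    show "hset {} \<in> {a \<in> elts (power_in CC). hbp a}"
      using empty_in hmeager_empty unfolding hbp_iff by auto
  next
    fix b assume b: "b \<in> {a \<in> elts (power_in CC). hbp a}"
    have "elts (cap t (hdiff CC b)) = elts (hdiff (cap t CC) b)"
      "elts (hdiff (cap t CC) (hdiff CC b)) = elts (cap t b)" for t
      using b by auto
    then have "cap t (hdiff CC b) = hdiff (cap t CC) b" "hdiff (cap t CC) (hdiff CC b) = cap t b" for t
      by (simp_all add: hc_ext)
    then show "hdiff CC b \<in> {a \<in> elts (power_in CC). hbp a}"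
      using b hdiff_in[OF CC_in, of b] by (auto simp: hbp_iff)
  next
    fix v assume v: "v \<in> M" "\<forall>n\<in>elts homega. sec v n \<in> {a \<in> elts (power_in CC). hbp a}"
    have "hset {h \<in> elts CC. \<exists>n\<in>elts homega. h \<in> elts (sec v n)} \<in> M"
      using v(1) by (intro collect_in) (intro definability CC_in homega_in)+
    moreover have "hbp (hset {h \<in> elts CC. \<exists>n\<in>elts homega. h \<in> elts (sec v n)})"
      using v by (intro hbp_UN) auto
    ultimately show "hset {h \<in> elts CC. \<exists>n\<in>elts homega. h \<in> elts (sec v n)} \<in> {a \<in> elts (power_in CC). hbp a}"
      by auto
  qed auto
  moreover have "u \<in> elts ?S" if "u \<in> elts (power_in CC)" "hopen u" for u
    using hbp_hopen that unfolding elts_hset_Collect by auto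
  ultimately have "a \<in> elts ?S" using assms unfolding hborel_def by blast
  then show ?thesis unfolding elts_hset_Collect by simp
qed

lemma hborel_hopen: "u \<in> elts (power_in CC) \<Longrightarrow> hopen u \<Longrightarrow> hborel u"
  unfolding hborel_def by blast

lemma hborel_hdiff: "hborel a \<Longrightarrow> hborel (hdiff CC a)"
  unfolding hborel_def hsigma_def using hdiff_in[OF CC_in, of a] by auto

lemma hborel_Int:
  assumes "hborel a" "hborel b" shows "hborel (hset {h \<in> elts a. h \<in> elts b})"
proof -
  have ab: "a \<in> M" "b \<in> M" "elts a \<subseteq> elts CC" "elts b \<subseteq> elts CC" using assms by (auto simp: hborel_def)
  \<comment> \<open>De Morgan: the complement of \<open>a\<close> becomes section 0 and that of
    \<open>b\<close> every other section.\<close>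
  let ?P = "\<lambda>p. \<exists>n\<in>elts homega. \<exists>h\<in>elts CC. p = hpair n h \<and> ((n = hnat 0 \<and> h \<notin> elts a) \<or> (n \<noteq> hnat 0 \<and> h \<notin> elts b))"
  define v where "v = hset {p \<in> elts (hprod homega CC). ?P p}"
  have v: "v \<in> M"
    unfolding v_def by (rule collect_in, rule term_in) (intro definability homega_in CC_in hnat_in ab)+
  have sec: "sec v (hnat n) = (if n = 0 then hdiff CC a else hdiff CC b)" for n
    by (rule hc_ext) (auto simp: elts_sec v_def)
  have eq: "hset {h \<in> elts a. h \<in> elts b} = hdiff CC (hset {h \<in> elts CC. \<exists>n\<in>elts homega. h \<in> elts (sec v n)})"
  proof (rule hc_ext)
    have "(\<exists>n\<in>elts homega. h \<in> elts (sec v n)) \<longleftrightarrow> h \<in> elts CC \<and> (h \<notin> elts a \<or> h \<notin> elts b)" for h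
      by (auto simp: sec split: if_splits intro: exI[of _ 0] exI[of _ "Suc 0"])
    then show "elts (hset {h \<in> elts a. h \<in> elts b}) = elts (hdiff CC (hset {h \<in> elts CC. \<exists>n\<in>elts homega. h \<in> elts (sec v n)}))"
      unfolding elts_hdiff elts_hset_Collect using ab by auto
  qed
  show ?thesis
    unfolding hborel_def
  proof (intro conjI ballI impI)
    have "hset {h \<in> elts a. h \<in> elts b} \<in> M" by (rule collect_in[OF ab(1)]) (intro definability ab)
    then show "hset {h \<in> elts a. h \<in> elts b} \<in> elts (power_in CC)" using ab by auto
  next
    fix S assume S: "S \<in> M" "hsigma S \<and> (\<forall>u\<in>elts (power_in CC). hopen u \<longrightarrow> u \<in> elts S)"
    then have "a \<in> elts S" "b \<in> elts S" using assms unfolding hborel_def by blast+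
    then have "hdiff CC a \<in> elts S" "hdiff CC b \<in> elts S" using S unfolding hsigma_def by blast+
    then have "\<forall>n\<in>elts homega. sec v n \<in> elts S" by (auto simp: sec)
    then have "hset {h \<in> elts CC. \<exists>n\<in>elts homega. h \<in> elts (sec v n)} \<in> elts S"
      using S(2) v unfolding hsigma_def by blast
    then show "hset {h \<in> elts a. h \<in> elts b} \<in> elts S"
      unfolding eq using S(2) unfolding hsigma_def by blast
  qed
qed

lemma hborel_cylinder: "hborel (cap (hstr s) CC)"
proof (rule hborel_hopen)
  show "cap (hstr s) CC \<in> elts (power_in CC)" by (auto simp: cap_in)
  show "hopen (cap (hstr s) CC)"
    unfolding hopen_def by (auto simp: elts_SEQ intro!: exI[of _ s])
qed

lemma hborel_cap: "hborel a \<Longrightarrow> hborel (cap (hstr s) a)"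
proof -
  assume a: "hborel a"
  then have "cap (hstr s) a = hset {h \<in> elts a. h \<in> elts (cap (hstr s) CC)}"
    by (intro hc_ext) (auto simp: hborel_def)
  then show ?thesis using hborel_Int[OF a hborel_cylinder[of s]] by simp
qed

text \<open>Changing finitely many bits of the elements of a nowhere dense set keeps it nowhere dense.\<close>

lemma hmeager_cylinder:
  assumes "hmeager (cap (hstr s) CC)" shows "hmeager CC"
proof -
  obtain v where v: "v \<in> M" "\<And>n. hnwd (sec v (hnat n))"
    "\<And>h. h \<in> elts (cap (hstr s) CC) \<Longrightarrow> \<exists>n. hpair (hnat n) h \<in> elts v"
    using assms unfolding hmeager_def by auto
  define P where "P n h \<longleftrightarrow> (\<exists>k\<in>elts CC. elts (hstr s) \<subseteq> elts k \<and> hpair n k \<in> elts v \<and>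
    (\<forall>i\<in>elts homega. i \<notin> elts (hnat (length s)) \<longrightarrow> (hpair i (hbit True) \<in> elts h \<longleftrightarrow> hpair i (hbit True) \<in> elts k)))" for n h
  let ?w = "hset {p \<in> elts (hprod homega CC). \<exists>n\<in>elts homega. \<exists>h\<in>elts CC. p = hpair n h \<and> P n h}"
  have w: "?w \<in> M"
    unfolding P_def using v(1)
    by (rule_tac collect_in, rule_tac term_in) (intro definability homega_in CC_in hbit_in hnat_in hstr_in; assumption)+
  have P_iff: "P (hnat n) (hreal y) \<longleftrightarrow> (\<exists>z\<in>dec (sec v (hnat n)). pfx s z \<and> (\<forall>i\<ge>length s. y i = z i))" for n y
    unfolding P_def by (auto simp: elts_CC dec_def elts_sec not_less)
  have dec_w: "dec (sec ?w (hnat n)) = {y \<in> cantor_in M. P (hnat n) (hreal y)}" for n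
    unfolding dec_def elts_sec elts_hset_Collect by (auto simp: elts_CC)
  have "nwd (dec (sec ?w (hnat n)))" for n
    unfolding nwd_def
  proof
    fix q :: "bool list"
    have nwd: "nwd (dec (sec v (hnat n)))" using v(2) by (simp add: hnwd_iff[OF sec_subset])
    \<comment> \<open>The padding makes \<open>?q\<close> at least as long as \<open>s\<close>, so
      that its first \<open>length s\<close> bits can be exchanged for \<open>s\<close>. An
      extension that avoids the section of \<open>v\<close> after the exchange avoids the section of
      \<open>?w\<close> before it.\<close>
    let ?q = "q @ replicate (length s - length q) True"
    obtain t where t: "\<And>z. z \<in> dec (sec v (hnat n)) \<Longrightarrow> \<not> pfx ((s @ drop (length s) ?q) @ t) z"
      using nwd unfolding nwd_def by blast
    have "\<not> pfx (?q @ t) y" if y: "y \<in> dec (sec ?w (hnat n))" for y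
    proof
      assume pfx: "pfx (?q @ t) y"
      obtain z where z: "z \<in> dec (sec v (hnat n))" "pfx s z" "\<And>i. i \<ge> length s \<Longrightarrow> y i = z i"
        using y unfolding dec_w P_iff by blast
      have "pfx ((s @ drop (length s) ?q) @ t) z"
        unfolding pfx_def
      proof (intro allI impI)
        fix i assume i: "i < length ((s @ drop (length s) ?q) @ t)"
        show "z i = ((s @ drop (length s) ?q) @ t) ! i"
        proof (cases "i < length s")
          case True
          then show ?thesis using z(2) by (simp add: pfx_def nth_append)
        next
          case False
          have len: "length s \<le> length ?q" by simp
          have eq: "length s + (length q - length s) = length q + (length s - length q)" by arith
          have "((s @ drop (length s) ?q) @ t) ! i = (?q @ t) ! i"
            using False len by (auto simp: nth_append not_less eq)
          moreover have "i < length (?q @ t)" using i len by simp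
          then have "y i = (?q @ t) ! i" using pfx by (simp add: pfx_def)
          ultimately show ?thesis using z(3)[of i] False by simp
        qed
      qed
      then show False using t z(1) by blast
    qed
    then show "\<exists>t. \<forall>x\<in>dec (sec ?w (hnat n)). \<not> pfx (q @ t) x"
      by (intro exI[of _ "replicate (length s - length q) True @ t"]) simp
  qed
  then have "hnwd (sec ?w (hnat n))" for n by (simp add: hnwd_iff[OF sec_subset])
  moreover have "\<exists>n. hpair (hnat n) h \<in> elts ?w" if h: "h \<in> elts CC" for h
  proof -
    obtain y where y: "y \<in> cantor_in M" "h = hreal y" using h by (auto simp: elts_CC)
    let ?z = "patch s y"
    have z: "?z \<in> cantor_in M" using y patch_in by blast
    then obtain n where n: "hpair (hnat n) (hreal ?z) \<in> elts v"
      using v(3)[of "hreal ?z"] by (auto simp: elts_CC)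
    have "P (hnat n) h"
      unfolding y P_iff using n z by (intro bexI[of _ ?z]) (auto simp: dec_def elts_sec elts_CC patch_def)
    then show ?thesis using h unfolding elts_hset_Collect by auto
  qed
  ultimately show ?thesis
    unfolding hmeager_def by (intro bexI[OF _ w] conjI) (auto simp del: elts_hset_Collect)
qed

end

section \<open>Cohen reals\<close>

context ctm
begin

text \<open>The filter as a set of codes, which is the form in which names refer to it.\<close>

definition gen :: "real2 \<Rightarrow> hc set" where
  "gen x = hreals ` cohen_filter M x"

lemma gen_iff: "a \<in> gen x \<longleftrightarrow> hcond a \<and> dec a \<in> cohen_filter M x"
proof
  assume "a \<in> gen x"
  then obtain A where A: "A \<in> cohen_filter M x" "a = hreals A" by (auto simp: gen_def)
  then have "A \<in> cohen_poset M" by (auto simp: cohen_filter_def)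
  then show "hcond a \<and> dec a \<in> cohen_filter M x"
    using A by (simp add: cohen_poset_iff dec_hreals)
next
  assume "hcond a \<and> dec a \<in> cohen_filter M x"
  then show "a \<in> gen x"
    unfolding gen_def using hreals_dec[OF hcondD(2)] by (metis imageI)
qed

lemma gen_hcond: "a \<in> gen x \<Longrightarrow> hcond a"
  by (simp add: gen_iff)

lemma dec_subset_iff:
  "elts a \<subseteq> elts CC \<Longrightarrow> elts b \<subseteq> elts CC \<Longrightarrow> dec a \<subseteq> dec b \<longleftrightarrow> elts a \<subseteq> elts b"
  using elts_dec[of a] elts_dec[of b] inj_image_subset_iff[of hreal "dec a" "dec b"] by (simp add: inj_def)

text \<open>Genericity becomes usable for definable dense classes of conditions: Separation inside
  the power set of \<open>CC\<close> turns such a class into an element of \<open>M\<close>.\<close>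

lemma cohen_realsD:
  assumes "x \<in> cohen_reals M"
  shows gen_nonempty: "gen x \<noteq> {}"
    and gen_up: "\<lbrakk>a \<in> gen x; hcond b; elts a \<subseteq> elts b\<rbrakk> \<Longrightarrow> b \<in> gen x"
    and gen_compat: "\<lbrakk>a \<in> gen x; b \<in> gen x\<rbrakk> \<Longrightarrow> \<exists>r\<in>gen x. elts r \<subseteq> elts a \<and> elts r \<subseteq> elts b"
    and gen_dense: "\<lbrakk>definable M (\<lambda>c. D (c 0));
      \<And>a. hcond a \<Longrightarrow> \<exists>d. hcond d \<and> D d \<and> elts d \<subseteq> elts a\<rbrakk> \<Longrightarrow> \<exists>d\<in>gen x. D d"
proof -
  let ?G = "cohen_filter M x"
  have filter: "is_filter_on (cohen_poset M) ?G"
    and generic: "\<And>D. dense_subset (cohen_poset M) D \<Longrightarrow> hfamily D \<in> M \<Longrightarrow> ?G \<inter> D \<noteq> {}"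
    using assms by (auto simp: cohen_reals_def generic_filter_def)
  show "gen x \<noteq> {}" using filter by (auto simp: gen_def is_filter_on_def)
  show "b \<in> gen x" if a: "a \<in> gen x" and b: "hcond b" and ab: "elts a \<subseteq> elts b"
  proof -
    have a': "hcond a" "dec a \<in> ?G" using a by (auto simp: gen_iff)
    have "dec a \<subseteq> dec b" using ab a' b by (simp add: dec_subset_iff hcondD)
    then have "dec b \<in> ?G" using filter a' hcond_dec[OF b] unfolding is_filter_on_def by blast
    then show ?thesis using b by (simp add: gen_iff)
  qed
  show "\<exists>r\<in>gen x. elts r \<subseteq> elts a \<and> elts r \<subseteq> elts b" if a: "a \<in> gen x" and b: "b \<in> gen x"
  proof -
    have ab: "hcond a" "dec a \<in> ?G" "hcond b" "dec b \<in> ?G" using a b by (auto simp: gen_iff)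
    have "\<forall>p\<in>?G. \<forall>q\<in>?G. \<exists>r\<in>?G. r \<subseteq> p \<and> r \<subseteq> q"
      using filter by (simp add: is_filter_on_def)
    from this[rule_format, OF ab(2,4)] obtain R where R: "R \<in> ?G" "R \<subseteq> dec a" "R \<subseteq> dec b"
      by blast
    then have "R \<in> cohen_poset M" using filter by (auto simp: is_filter_on_def)
    then have R': "R \<subseteq> cantor_in M" by (simp add: cohen_poset_iff)
    have "elts (hreals R) \<subseteq> elts a" "elts (hreals R) \<subseteq> elts b"
      using R by (auto simp: elts_hreals[OF R'] dec_def)
    then show ?thesis using R by (auto simp: gen_def)
  qed
  show "\<exists>d\<in>gen x. D d" if D: "definable M (\<lambda>c. D (c 0))"
    and dense: "\<And>a. hcond a \<Longrightarrow> \<exists>d. hcond d \<and> D d \<and> elts d \<subseteq> elts a"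
  proof -
    let ?d = "hset {d \<in> elts (power_in CC). hcond d \<and> D d}"
    let ?D = "dec ` elts ?d"
    have "?d \<in> M"
      by (intro collect_in power_in_in CC_in) (intro definability D)
    moreover have sub: "elts ?d \<subseteq> elts (power_in CC)" unfolding elts_hset_Collect by blast
    ultimately have "hfamily ?D \<in> M" using hfamily_dec(1) by simp
    moreover have "dense_subset (cohen_poset M) ?D"
      unfolding dense_subset_def
    proof (intro conjI subsetI ballI)
      show "B \<in> cohen_poset M" if "B \<in> ?D" for B
        using that hcond_dec unfolding elts_hset_Collect by auto
    next
      fix B assume "B \<in> cohen_poset M"
      then have B: "B \<subseteq> cantor_in M" "hcond (hreals B)" by (auto simp: cohen_poset_iff)
      then obtain d where d: "hcond d" "D d" "elts d \<subseteq> elts (hreals B)" using dense by blast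
      then have "dec d \<in> ?D" unfolding elts_hset_Collect using hcondD[OF d(1)] by auto
      moreover have "dec d \<subseteq> B" using d(3) by (auto simp: dec_def elts_hreals[OF B(1)])
      ultimately show "\<exists>e\<in>?D. e \<subseteq> B" by blast
    qed
    ultimately obtain d where "d \<in> elts ?d" "dec d \<in> ?G" using generic by blast
    then show ?thesis unfolding elts_hset_Collect by (auto simp: gen_iff)
  qed
qed

text \<open>The filter of \<open>x\<close> contains a nonmeager set, so \<open>CC\<close> is
  nonmeager, and \<open>hmeager_cylinder\<close> transfers this to every cylinder.\<close>

lemma hcond_cylinder:
  assumes "x \<in> cohen_reals M" shows "hcond (cap (hstr s) CC)"
proof -
  obtain a where "hcond a" using gen_nonempty[OF assms] gen_hcond by blast
  then have "\<not> hmeager CC" using hmeager_subset[of CC a] by (auto simp: hcond_def hborel_def)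
  then show ?thesis using hmeager_cylinder hborel_cylinder by (auto simp: hcond_def)
qed

lemma hcode_Basic: "hcode (Basic s) = hpair (hnat 0) (hstr s)"
proof -
  have "(\<lambda>b. hnat (of_bool b)) = hbit" by (auto simp: hbit_def)
  then show ?thesis by (simp add: hstr_def)
qed

lemma hpair_in: "a \<in> M \<Longrightarrow> b \<in> M \<Longrightarrow> hpair a b \<in> M"
  by (rule term_in) (intro definability)

lemma interp_Basic [simp]: "interp X (Basic s) = {x \<in> X. pfx s x}"
  by (simp add: pfx_def)

declare interp.simps(1) [simp del] hcode.simps(1) [simp del]

lemma hreals_cylinder: "hreals (interp (cantor_in M) (Basic s)) = cap (hstr s) CC"
  by (rule hc_ext) (auto simp: elts_hreals elts_CC dest: hstr_subset_hreal[THEN iffD2, THEN subsetD])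

lemma hreals_compl_cylinder: "hreals (interp (cantor_in M) (Complement (Basic s))) = hdiff CC (cap (hstr s) CC)"
  by (rule hc_ext) (auto simp: elts_hreals elts_CC dest: hstr_subset_hreal[THEN iffD2, THEN subsetD])

lemma gen_interpI:
  "\<lbrakk>hcode c \<in> M; interp (cantor_in M) c \<subseteq> cantor_in M; hcond (hreals (interp (cantor_in M) c)); x \<in> interp UNIV c\<rbrakk>
    \<Longrightarrow> hreals (interp (cantor_in M) c) \<in> gen x"
  by (auto simp: gen_def cohen_filter_def cohen_poset_iff)

text \<open>A condition enters the filter through some code whose interpretation contains
  \<open>x\<close>, and another code of the same condition might a priori exclude \<open>x\<close>.
  The filter property rules this out: the complement of the cylinder would belong to the filter as
  well, and the two have no common refinement.\<close>

lemma gen_cylinder_iff: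
  assumes x: "x \<in> cohen_reals M" shows "cap (hstr s) CC \<in> gen x \<longleftrightarrow> pfx s x"
proof
  assume "pfx s x"
  then have "hreals (interp (cantor_in M) (Basic s)) \<in> gen x"
    by (intro gen_interpI, unfold hreals_cylinder)
      (auto simp: hcode_Basic hpair_in intro: hcond_cylinder[OF x])
  then show "cap (hstr s) CC \<in> gen x" by (simp only: hreals_cylinder)
next
  assume gen: "cap (hstr s) CC \<in> gen x"
  show "pfx s x"
  proof (rule ccontr)
    assume npfx: "\<not> pfx s x"
    let ?c = "Complement (Basic s)"
    \<comment> \<open>The complement contains the cylinder of the one-letter string with the
      opposite bit, so it is a condition.\<close>
    obtain b r where s: "s = b # r" using npfx by (cases s) auto
    have "hborel (hdiff CC (cap (hstr s) CC))" by (intro hborel_hdiff hborel_cylinder)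
    moreover have "\<not> hmeager (hdiff CC (cap (hstr s) CC))"
    proof
      assume "hmeager (hdiff CC (cap (hstr s) CC))"
      moreover have "elts (cap (hstr [\<not> b]) CC) \<subseteq> elts (hdiff CC (cap (hstr s) CC))"
        by (auto simp: elts_CC s pfx_def)
      ultimately have "hmeager (cap (hstr [\<not> b]) CC)" by (rule hmeager_subset)
      then show False using hcond_cylinder[OF x] by (auto simp: hcond_def)
    qed
    ultimately have "hcond (hdiff CC (cap (hstr s) CC))" by (simp add: hcond_def)
    then have "hreals (interp (cantor_in M) ?c) \<in> gen x"
      using npfx by (intro gen_interpI, unfold hreals_compl_cylinder)
        (auto simp: hcode_Basic hpair_in)
    then have "hdiff CC (cap (hstr s) CC) \<in> gen x" by (simp only: hreals_compl_cylinder)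
    then obtain r where "r \<in> gen x" "elts r \<subseteq> elts (hdiff CC (cap (hstr s) CC))" "elts r \<subseteq> elts (cap (hstr s) CC)"
      using gen_compat[OF x gen] by blast
    then have "hcond r" "elts r = {}" using gen_hcond by auto
    then show False using hmeager_empty by (simp add: hcond_def)
  qed
qed

text \<open>The passage from conditions to strings: by \<open>hmeager_dense\<close>, a nonmeager set
  is nonmeager in some cylinder of a dense family \<open>W\<close>, so the conditions contained in
  such cylinders are dense.\<close>

lemma cohen_real_meets:
  assumes x: "x \<in> cohen_reals M" and W: "definable M (\<lambda>c. W (c 0))"
    and dense: "\<And>s. \<exists>t. W (hstr (s @ t))"
  obtains s where "pfx s x" "W (hstr s)"
proof -
  let ?D = "\<lambda>d. \<exists>s\<in>elts SEQ. W s \<and> elts d \<subseteq> elts (cap s CC)"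
  have "\<exists>d\<in>gen x. ?D d"
  proof (rule gen_dense[OF x])
    show "definable M (\<lambda>c. ?D (c 0))"
      by (intro definability definable_subst1[of M W, OF W] SEQ_in CC_in)
    fix a assume a: "hcond a"
    have "\<exists>t. W (hstr t) \<and> \<not> hmeager (cap (hstr t) a)"
    proof (rule ccontr)
      assume *: "\<not> (\<exists>t. W (hstr t) \<and> \<not> hmeager (cap (hstr t) a))"
      have "hmeager (cap (hstr []) a)"
        by (rule hmeager_dense[of W, OF W]) (use a hcondD dense * in auto)
      moreover have "cap (hstr []) a = a" by (rule hc_ext) (auto simp: hstr_Nil)
      ultimately show False using a by (simp add: hcond_def)
    qed
    then obtain t where t: "W (hstr t)" "\<not> hmeager (cap (hstr t) a)" by blast
    then have "hcond (cap (hstr t) a)" using a hborel_cap by (simp add: hcond_def)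
    moreover have "?D (cap (hstr t) a)"
      using t hcondD(2)[OF a] by (intro bexI[of _ "hstr t"]) (auto simp: elts_SEQ)
    ultimately show "\<exists>d. hcond d \<and> ?D d \<and> elts d \<subseteq> elts a"
      by (intro exI[of _ "cap (hstr t) a"]) auto
  qed
  then obtain d s where d: "d \<in> gen x" "W (hstr s)" "elts d \<subseteq> elts (cap (hstr s) CC)"
    by (auto simp: elts_SEQ simp del: elts_cap)
  then have "cap (hstr s) CC \<in> gen x" using gen_up[OF x] hcond_cylinder[OF x] by blast
  then show ?thesis using that d gen_cylinder_iff[OF x] by blast
qed

text \<open>This makes membership in the filter a property of finite strings that \<open>M\<close>
  can define. By the Baire property, some prefix of \<open>x\<close> has \<open>a\<close> meager or
  comeager below it, and meagerness contradicts the compatibility of \<open>a\<close> with the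
  cylinder.\<close>

lemma gen_iff_comeager:
  assumes x: "x \<in> cohen_reals M" and a: "hcond a"
  shows "a \<in> gen x \<longleftrightarrow> (\<exists>s. pfx s x \<and> hmeager (hdiff (cap (hstr s) CC) a))"
proof
  assume gen: "a \<in> gen x"
  let ?W = "\<lambda>s. hmeager (cap s a) \<or> hmeager (hdiff (cap s CC) a)"
  obtain s where s: "pfx s x" "?W (hstr s)"
  proof (rule cohen_real_meets[OF x, of ?W])
    show "definable M (\<lambda>c. ?W (c 0))" using hcondD(1)[OF a] by (intro definability CC_in)
    show "\<exists>t. ?W (hstr (s @ t))" for s
      using hborel_hbp a by (auto simp: hcond_def hbp_iff)
  qed
  have "\<not> hmeager (cap (hstr s) a)"
  proof
    assume "hmeager (cap (hstr s) a)"
    moreover obtain r where "r \<in> gen x" "elts r \<subseteq> elts a" "elts r \<subseteq> elts (cap (hstr s) CC)"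
      using gen_compat[OF x gen] gen_cylinder_iff[OF x] s by blast
    then have "hcond r" "elts r \<subseteq> elts (cap (hstr s) a)" using gen_hcond by auto
    ultimately show False using hmeager_subset by (auto simp: hcond_def)
  qed
  then show "\<exists>s. pfx s x \<and> hmeager (hdiff (cap (hstr s) CC) a)" using s by blast
next
  assume "\<exists>s. pfx s x \<and> hmeager (hdiff (cap (hstr s) CC) a)"
  then obtain s where s: "pfx s x" "hmeager (hdiff (cap (hstr s) CC) a)" by blast
  \<comment> \<open>Dense because \<open>a\<close> is comeager in the cylinder of \<open>s\<close>:
    from a condition that is meager in the cylinder one removes the cylinder, any other one is
    intersected with the cylinder and \<open>a\<close>. In the filter only the first alternative is
    possible, since \<open>x\<close> extends \<open>s\<close>.\<close>
  let ?D = "\<lambda>d. elts d \<subseteq> elts a \<or> (\<forall>h\<in>elts d. \<not> elts (hstr s) \<subseteq> elts h)"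
  have "\<exists>d\<in>gen x. ?D d"
  proof (rule gen_dense[OF x])
    show "definable M (\<lambda>c. ?D (c 0))" using hcondD(1)[OF a] by (intro definability hstr_in)
    fix p assume p: "hcond p"
    have pM: "p \<in> M" "elts p \<subseteq> elts CC" "hborel p" using p hcondD by (auto simp: hcond_def)
    have aM: "a \<in> M" "elts a \<subseteq> elts CC" "hborel a" using a hcondD by (auto simp: hcond_def)
    show "\<exists>d. hcond d \<and> ?D d \<and> elts d \<subseteq> elts p"
    proof (cases "hmeager (cap (hstr s) p)")
      case True
      let ?d = "hset {h \<in> elts p. h \<in> elts (hdiff CC (cap (hstr s) CC))}"
      have d: "hborel ?d" by (intro hborel_Int hborel_hdiff hborel_cylinder pM)
      have "\<not> hmeager ?d"
      proof
        assume "hmeager ?d"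
        then have "hmeager p"
          using d pM by (elim hmeager_Un[OF _ True]) (auto simp: hborel_def cap_in)
        then show False using p by (simp add: hcond_def)
      qed
      then show ?thesis using d pM by (intro exI[of _ ?d]) (auto simp: hcond_def)
    next
      case False
      let ?d = "hset {h \<in> elts (cap (hstr s) p). h \<in> elts a}"
      have d: "hborel ?d" by (intro hborel_Int hborel_cap pM aM)
      have "\<not> hmeager ?d"
      proof
        assume "hmeager ?d"
        then have "hmeager (cap (hstr s) p)"
          using d pM aM by (elim hmeager_Un[OF _ s(2)]) (auto simp: hborel_def cap_in hdiff_in)
        then show False using False by simp
      qed
      then show ?thesis using d pM by (intro exI[of _ ?d]) (auto simp: hcond_def)
    qed
  qed
  then obtain d where d: "d \<in> gen x" "?D d" by blast
  moreover have "\<not> (\<forall>h\<in>elts d. \<not> elts (hstr s) \<subseteq> elts h)"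
  proof
    assume *: "\<forall>h\<in>elts d. \<not> elts (hstr s) \<subseteq> elts h"
    obtain r where "r \<in> gen x" "elts r \<subseteq> elts d" "elts r \<subseteq> elts (cap (hstr s) CC)"
      using gen_compat[OF x d(1)] gen_cylinder_iff[OF x] s(1) by blast
    moreover from this have "elts r = {}" unfolding elts_cap using * by blast
    ultimately show False using hmeager_empty gen_hcond by (auto simp: hcond_def)
  qed
  ultimately show "a \<in> gen x" using gen_up[OF x d(1) a] by blast
qed

end

section \<open>Names for reals\<close>

text \<open>Zermelo numerals: unlike von Neumann numerals, they admit a one-step recursion for forced equality.\<close>

primrec hz :: "nat \<Rightarrow> hc" where
  "hz 0 = hset {}"
| "hz (Suc n) = hset {hz n}"

lemma hz_inject [simp]: "hz m = hz n \<longleftrightarrow> m = n"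
proof (induction m arbitrary: n)
  case 0
  have "hset {} \<noteq> hset {a}" for a
    using elts_hset[of "{a}"] elts_hset[of "{}"] by (metis countable_empty countable_insert insert_not_empty)
  then show ?case by (cases n) auto
next
  case (Suc m)
  have "hset {} \<noteq> hset {a}" for a
    using elts_hset[of "{a}"] elts_hset[of "{}"] by (metis countable_empty countable_insert insert_not_empty)
  moreover have "hset {a} = hset {b} \<longleftrightarrow> a = b" for a b
    using hset_doubleton_eq[of a a b b] by simp
  ultimately show ?case using Suc by (cases n) (auto, metis)
qed

lemma countable_hpairs: "countable {(u, a). hpair u a \<in> elts t}"
proof -
  have "countable ((\<lambda>(s, p). hpair s p) ` {(s, p). hpair s p \<in> elts t})"
    by (rule countable_subset[OF _ countable_elts[of t]]) auto
  then show ?thesis by (rule countable_image_inj_on) (auto simp: inj_on_def)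
qed

lemma elts_val: "elts (val G t) = val G ` {s. \<exists>p\<in>G. hpair s p \<in> elts t}"
proof -
  have "countable (fst ` {(s, p). hpair s p \<in> elts t})"
    by (intro countable_image countable_hpairs)
  then have "countable {s. \<exists>p\<in>G. hpair s p \<in> elts t}"
    by (rule countable_subset[rotated]) force
  then show ?thesis by (subst val.simps) simp
qed

text \<open>The double union undoes the two levels of a Kuratowski pair. It bounds quantifiers over
  the values of a function in \<open>M\<close>.\<close>

definition hfield :: "hc \<Rightarrow> hc" where
  "hfield a = hUnion (hUnion a)"

lemma hpair_mem_hfield: "hpair u v \<in> elts a \<Longrightarrow> u \<in> elts (hfield a) \<and> v \<in> elts (hfield a)"
  unfolding hfield_def hpair_def elts_hUnion by (fastforce intro: bexI)

context ctm
begin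

lemma hfield_in: "a \<in> M \<Longrightarrow> hfield a \<in> M"
  unfolding hfield_def by (intro hUnion_in)

lemma generic_ext_eq: "generic_ext M x = val (gen x) ` M"
  by (simp add: generic_ext_def gen_def)

lemma CC_in_gen: "x \<in> cohen_reals M \<Longrightarrow> CC \<in> gen x"
proof -
  assume x: "x \<in> cohen_reals M"
  have "cap (hstr []) CC = CC" by (rule hc_ext) (auto simp: hstr_Nil)
  then show ?thesis using gen_cylinder_iff[OF x, of "[]"] by simp
qed

text \<open>Canonical names of the numerals \<open>hz n\<close>, with the largest condition
  \<open>CC\<close> as their only label; written as an iteration so that
  \<open>hseq_funpow_in\<close> applies.\<close>

definition check_name :: "nat \<Rightarrow> hc" where
  "check_name n = ((\<lambda>u. hset {hpair u CC}) ^^ n) (hset {})"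

lemma check_name_simps: "check_name 0 = hset {}" "check_name (Suc n) = hset {hpair (check_name n) CC}"
  by (simp_all add: check_name_def)

lemma hseq_check_name_in: "hseq check_name \<in> M"
  unfolding check_name_def by (rule hseq_funpow_in[OF empty_in]) (intro definability CC_in)

lemma val_check_name: assumes x: "x \<in> cohen_reals M" shows "val (gen x) (check_name n) = hz n"
proof (induction n)
  case 0 show ?case by (rule hc_ext) (simp add: elts_val check_name_simps)
next
  case (Suc n)
  show ?case
    by (rule hc_ext) (use Suc CC_in_gen[OF x] in \<open>auto simp: elts_val check_name_simps\<close>)
qed

text \<open>Its value for a Cohen real \<open>x\<close> is the set of the \<open>hz n\<close> with \<open>x n\<close>.\<close>

definition generic_name :: hc where
  "generic_name = hset {hpair (check_name n) (cap (hstr s) CC) |n s. n < length s \<and> s ! n}"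

lemma countable_generic_name:
  "countable {hpair (check_name n) (cap (hstr s) CC) |n s. n < length s \<and> s ! n}"
  by (rule countable_subset[of _ "(\<lambda>(n, s). hpair (check_name n) (cap (hstr s) CC)) ` UNIV"]) auto

lemma generic_name_in: "generic_name \<in> M"
proof -
  let ?C = "hseq check_name"
  let ?D = "hset ((\<lambda>s. cap s CC) ` elts SEQ)"
  let ?P = "\<lambda>p. \<exists>n\<in>elts homega. \<exists>k\<in>elts (hfield ?C). \<exists>s\<in>elts SEQ.
    hpair n k \<in> elts ?C \<and> hpair n (hbit True) \<in> elts s \<and> p = hpair k (cap s CC)"
  have D: "?D \<in> M" by (rule term_in) (intro definability SEQ_in CC_in)
  have k: "check_name n \<in> elts (hfield ?C)" for n
    using hpair_mem_hfield[of "hnat n" "check_name n" ?C] by simp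
  have "{hpair (check_name n) (cap (hstr s) CC) |n s. n < length s \<and> s ! n} =
      {p \<in> elts (hprod (hfield ?C) ?D). ?P p}"
    using k by (auto simp: elts_SEQ)
  moreover have "hset {p \<in> elts (hprod (hfield ?C) ?D). ?P p} \<in> M"
    by (rule collect_in, rule term_in)
      (intro definability homega_in SEQ_in CC_in hbit_in D hfield_in hseq_check_name_in)+
  ultimately show ?thesis by (simp only: generic_name_def)
qed

lemma val_generic_name:
  assumes x: "x \<in> cohen_reals M"
  shows "hz n \<in> elts (val (gen x) generic_name) \<longleftrightarrow> x n"
proof -
  have "elts (val (gen x) generic_name) = val (gen x) ` {check_name n |n s. n < length s \<and> s ! n \<and> pfx s x}"
    unfolding elts_val generic_name_def elts_hset[OF countable_generic_name]
    by (intro arg_cong[of _ _ "image (val (gen x))"]) (auto simp: gen_cylinder_iff[OF x], blast, metis gen_cylinder_iff[OF x])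
  also have "\<dots> = {hz n |n s. n < length s \<and> s ! n \<and> pfx s x}"
    by (auto simp: val_check_name[OF x] image_iff) (metis val_check_name[OF x])
  finally have *: "hz n \<in> elts (val (gen x) generic_name) \<longleftrightarrow> (\<exists>s. n < length s \<and> s ! n \<and> pfx s x)"
    by auto
  show ?thesis
  proof
    assume "x n"
    then show "hz n \<in> elts (val (gen x) generic_name)"
      unfolding * by (intro exI[of _ "map x [0..<Suc n]"]) (auto simp del: upt_Suc)
  qed (auto simp: * pfx_def)
qed

text \<open>
  A Cohen real has the property \<open>P\<close> iff it meets the open set \<open>Q\<close> of finite strings. By genericity
  it meets \<open>Q\<close> or \<open>forces_not Q\<close>, so representable properties are closed under negation; this
  replaces the forcing theorem.
\<close>

definition represents :: "(hc \<Rightarrow> bool) \<Rightarrow> (real2 \<Rightarrow> bool) \<Rightarrow> bool" where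
  "represents Q P \<longleftrightarrow> (\<forall>s u. Q (hstr s) \<longrightarrow> Q (hstr (s @ u))) \<and>
     (\<forall>x\<in>cohen_reals M. P x \<longleftrightarrow> (\<exists>s. pfx s x \<and> Q (hstr s)))"

definition forces_not :: "(hc \<Rightarrow> bool) \<Rightarrow> hc \<Rightarrow> bool" where
  "forces_not Q s \<longleftrightarrow> (\<forall>r\<in>elts SEQ. elts s \<subseteq> elts r \<longrightarrow> \<not> Q r)"

lemma forces_not_hstr: "forces_not Q (hstr s) \<longleftrightarrow> (\<forall>u. \<not> Q (hstr (s @ u)))"
  unfolding forces_not_def by (auto simp: elts_SEQ)

lemma represents_iff: "represents Q P \<Longrightarrow> x \<in> cohen_reals M \<Longrightarrow> P x \<longleftrightarrow> (\<exists>s. pfx s x \<and> Q (hstr s))"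
  by (simp add: represents_def)

lemma represents_extend: "represents Q P \<Longrightarrow> Q (hstr s) \<Longrightarrow> Q (hstr (s @ u))"
  by (simp add: represents_def)

lemma pfx_common:
  assumes "pfx s x" "pfx t x"
  obtains r u v where "pfx r x" "r = s @ u" "r = t @ v"
  using pfx_compare[OF assms] pfx_compare[OF assms(2,1)] assms
  by (metis append_Nil2 linear)

lemma represents_not:
  assumes "represents Q P" "definable M (\<lambda>c. Q (c 0))"
  shows "represents (forces_not Q) (\<lambda>x. \<not> P x)"
  unfolding represents_def
proof (intro conjI allI impI ballI)
  show "forces_not Q (hstr (s @ u))" if "forces_not Q (hstr s)" for s u
    using that by (auto simp: forces_not_hstr)
  fix x assume x: "x \<in> cohen_reals M"
  obtain s where s: "pfx s x" "Q (hstr s) \<or> forces_not Q (hstr s)"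
  proof (rule cohen_real_meets[OF x, of "\<lambda>s. Q s \<or> forces_not Q s"])
    show "definable M (\<lambda>c. Q (c 0) \<or> forces_not Q (c 0))"
      unfolding forces_not_def by (intro definability definable_subst1[of M Q, OF assms(2)] SEQ_in)
    show "\<exists>t. Q (hstr (s @ t)) \<or> forces_not Q (hstr (s @ t))" for s
      unfolding forces_not_hstr by (metis append_Nil2)
  qed
  have "\<not> P x" if t: "pfx t x" "forces_not Q (hstr t)" for t
  proof
    assume "P x"
    then obtain s where "pfx s x" "Q (hstr s)" using represents_iff[OF assms(1) x] by blast
    then show False
      using pfx_common[OF t(1), of s] represents_extend[OF assms(1)] t(2) by (metis forces_not_hstr)
  qed
  then show "\<not> P x \<longleftrightarrow> (\<exists>s. pfx s x \<and> forces_not Q (hstr s))"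
    using s represents_iff[OF assms(1) x] by blast
qed

lemma represents_conj:
  assumes "represents Q P" "represents Q' P'"
  shows "represents (\<lambda>s. Q s \<and> Q' s) (\<lambda>x. P x \<and> P' x)"
  unfolding represents_def
proof (intro conjI allI impI ballI)
  fix x assume x: "x \<in> cohen_reals M"
  have "\<exists>r. pfx r x \<and> Q (hstr r) \<and> Q' (hstr r)"
    if "pfx s x" "Q (hstr s)" "pfx t x" "Q' (hstr t)" for s t
    using that pfx_common[OF that(1,3)] represents_extend[OF assms(1)] represents_extend[OF assms(2)] by metis
  then show "P x \<and> P' x \<longleftrightarrow> (\<exists>s. pfx s x \<and> Q (hstr s) \<and> Q' (hstr s))"
    unfolding represents_iff[OF assms(1) x] represents_iff[OF assms(2) x] by blast
qed (use assms in \<open>auto simp: represents_def\<close>)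

lemma represents_ex:
  assumes "\<And>i. i \<in> I \<Longrightarrow> represents (Q i) (P i)"
  shows "represents (\<lambda>s. \<exists>i\<in>I. Q i s) (\<lambda>x. \<exists>i\<in>I. P i x)"
  using assms unfolding represents_def by blast

lemma represents_const: "represents (\<lambda>s. b) (\<lambda>x. b)"
  unfolding represents_def using pfx_Nil by blast

lemma represents_cong:
  assumes "represents Q P" "\<And>s. Q' (hstr s) \<longleftrightarrow> Q (hstr s)" "\<And>x. x \<in> cohen_reals M \<Longrightarrow> P' x \<longleftrightarrow> P x"
  shows "represents Q' P'"
  using assms unfolding represents_def by simp

definition forces_gen :: "hc \<Rightarrow> hc \<Rightarrow> bool" where
  "forces_gen s a \<longleftrightarrow> hcond a \<and> hmeager (hdiff (cap s CC) a)"

lemma definable_forces_gen [definability]: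
  "definable_term M t \<Longrightarrow> definable_term M u \<Longrightarrow> definable M (\<lambda>c. forces_gen (t c) (u c))"
  unfolding forces_gen_def by (intro definability CC_in)

text \<open>The atomic case, supplied by \<open>gen_iff_comeager\<close>.\<close>

lemma represents_gen: "represents (\<lambda>s. forces_gen s a) (\<lambda>x. a \<in> gen x)"
  unfolding represents_def
proof (intro conjI allI impI ballI)
  show "forces_gen (hstr (s @ u)) a" if "forces_gen (hstr s) a" for s u
  proof -
    have "elts (hstr s) \<subseteq> elts (hstr (s @ u))" by simp
    then have "elts (hdiff (cap (hstr (s @ u)) CC) a) \<subseteq> elts (hdiff (cap (hstr s) CC) a)"
      unfolding elts_hdiff elts_cap by blast
    then show ?thesis using that hmeager_subset unfolding forces_gen_def by blast
  qed
  show "a \<in> gen x \<longleftrightarrow> (\<exists>s. pfx s x \<and> forces_gen (hstr s) a)" if "x \<in> cohen_reals M" for x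
    using gen_iff_comeager[OF that, of a] gen_hcond[of a x] by (auto simp: forces_gen_def)
qed

lemma transitive_superset:
  assumes t: "t \<in> M"
  obtains T where "T \<in> M" "t \<in> elts T" "\<forall>v\<in>elts T. elts v \<subseteq> elts T"
proof -
  let ?T = "\<lambda>n. (hUnion ^^ n) (hset {t})"
  \<comment> \<open>The field of the sequence also contains the numerals; their elements are
    numerals again, so transitivity is not affected.\<close>
  let ?S = "hUnion (hfield (hseq ?T))"
  have "hset {t} \<in> M" using t by (intro finite_in) auto
  then have "hseq ?T \<in> M" by (rule hseq_funpow_in) (intro definability)
  then have "?S \<in> M" by (intro hUnion_in hfield_in)
  have S: "elts ?S = (\<Union>n. elts (?T n)) \<union> (\<Union>n. elts (hnat n))"
    unfolding hfield_def elts_hUnion elts_hseq hpair_def by auto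
  have "t \<in> elts (?T 0)" by simp
  then have "t \<in> elts ?S" unfolding S by blast
  moreover have "elts v \<subseteq> elts ?S" if v: "v \<in> elts ?S" for v
  proof -
    consider n where "v \<in> elts (?T n)" | n where "v \<in> elts (hnat n)" using v unfolding S by blast
    then show ?thesis
    proof cases
      case 1
      then have "elts v \<subseteq> elts (?T (Suc n))" by auto
      then show ?thesis unfolding S by blast
    next
      case 2
      then obtain m where "v = hnat m" by (auto simp: elts_hnat)
      then show ?thesis unfolding S by blast
    qed
  qed
  ultimately show ?thesis using that[of ?S] \<open>?S \<in> M\<close> by blast
qed

text \<open>Only positive information is recorded: a pair \<open>hpair s n\<close> gives bit
  \<open>n\<close> to every real extending \<open>s\<close>. On Cohen reals the absence of a bit is
  decided by strings as well, through \<open>forces_not\<close>.\<close>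

definition real_code :: "hc \<Rightarrow> bool" where
  "real_code Q \<longleftrightarrow> Q \<in> M \<and>
     (\<forall>s u n. hpair (hstr s) n \<in> elts Q \<longrightarrow> hpair (hstr (s @ u)) n \<in> elts Q)"

definition decode :: "hc \<Rightarrow> real2 \<Rightarrow> real2" where
  "decode Q x n \<longleftrightarrow> (\<exists>s. pfx s x \<and> hpair (hstr s) (hnat n) \<in> elts Q)"

lemma represents_decode:
  "real_code Q \<Longrightarrow> represents (\<lambda>s. hpair s (hnat n) \<in> elts Q) (\<lambda>x. decode Q x n)"
  by (auto simp: represents_def real_code_def decode_def)

text \<open>
  In the proof, \<open>(step ^^ n) R0\<close> consists of the pairs of a string \<open>s\<close> and a name \<open>v\<close> such that \<open>s\<close>
  forces the value of \<open>v\<close> to be \<open>hz n\<close>.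
\<close>

lemma real_code_of_name:
  assumes t: "t \<in> M"
  obtains Q where "real_code Q"
    "\<And>x n. x \<in> cohen_reals M \<Longrightarrow> decode Q x n \<longleftrightarrow> hz n \<in> elts (val (gen x) t)"
proof -
  obtain T where T: "T \<in> M" "t \<in> elts T" "\<forall>v\<in>elts T. elts v \<subseteq> elts T"
    by (rule transitive_superset[OF t])
  have TT: "u \<in> elts T \<and> a \<in> elts T" if "v \<in> elts T" "hpair u a \<in> elts v" for u v a
  proof -
    have "hpair u a \<in> elts T" using T(3) that by blast
    then have "hset {u, a} \<in> elts T" using T(3)[rule_format, of "hpair u a"] by (auto simp: hpair_def)
    then show ?thesis using T(3)[rule_format, of "hset {u, a}"] by auto
  qed
  have val_elts: "y \<in> elts (val (gen x) v) \<longleftrightarrow>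
      (\<exists>u\<in>elts T. \<exists>a\<in>elts T. hpair u a \<in> elts v \<and> a \<in> gen x \<and> val (gen x) u = y)"
    if "v \<in> elts T" for v x y
    unfolding elts_val using TT[OF that] by blast
  \<comment> \<open>\<open>inh K v s\<close>: some member of the name \<open>v\<close> is put into
    its value by \<open>s\<close> and satisfies \<open>K\<close> at \<open>s\<close>.\<close>
  define inh where "inh K v s \<longleftrightarrow> (\<exists>u\<in>elts T. \<exists>a\<in>elts T. hpair u a \<in> elts v \<and> forces_gen s a \<and> K u s)"
    for K :: "hc \<Rightarrow> hc \<Rightarrow> bool" and v s
  have rep_inh: "represents (inh K v) (\<lambda>x. \<exists>u\<in>elts T. \<exists>a\<in>elts T. hpair u a \<in> elts v \<and> a \<in> gen x \<and> P u x)"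
    if "\<And>u. u \<in> elts T \<Longrightarrow> represents (K u) (P u)" for K P v
    unfolding inh_def by (intro represents_ex represents_conj represents_const represents_gen that)
  let ?N = "hprod SEQ T"
  have N: "?N \<in> M" by (rule term_in) (intro definability SEQ_in T)
  let ?in = "\<lambda>R u s. hpair s u \<in> elts R"
  define R0 where "R0 = hset {p \<in> elts ?N. \<exists>s\<in>elts SEQ. \<exists>v\<in>elts T. p = hpair s v \<and>
    forces_not (inh (\<lambda>u s. True) v) s}"
  \<comment> \<open>A value is \<open>hz (Suc n)\<close> iff some member has the value
    \<open>hz n\<close> and no member has another value. Both clauses refer only to the relation for
    \<open>n\<close>.\<close>
  define step where "step R = hset {p \<in> elts ?N. \<exists>s\<in>elts SEQ. \<exists>v\<in>elts T. p = hpair s v \<and>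
    inh (?in R) v s \<and> forces_not (inh (\<lambda>u. forces_not (?in R u)) v) s}" for R
  have R0_in: "R0 \<in> M"
    unfolding R0_def inh_def forces_not_def by (rule collect_in[OF N]) (intro definability SEQ_in T)
  have step_def': "definable_term M (\<lambda>c. step (c 0))"
    unfolding step_def inh_def forces_not_def by (intro definability SEQ_in T)
  let ?R = "\<lambda>n. (step ^^ n) R0"
  have Rseq: "hseq ?R \<in> M" by (rule hseq_funpow_in[OF R0_in step_def'])
  have R_in: "?R n \<in> M" for n
    using R0_in definable_term_in[OF step_def', of "\<lambda>_. x" for x] by (induction n) auto
  have rep_R: "represents (?in (?R n) v) (\<lambda>x. val (gen x) v = hz n)" if "v \<in> elts T" for n v
    using that
  proof (induction n arbitrary: v)
    case 0
    have "represents (forces_not (inh (\<lambda>u s. True) v))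
        (\<lambda>x. \<not> (\<exists>u\<in>elts T. \<exists>a\<in>elts T. hpair u a \<in> elts v \<and> a \<in> gen x \<and> True))"
    proof (intro represents_not rep_inh represents_const)
      show "definable M (\<lambda>c. inh (\<lambda>u s. True) v (c 0))"
        unfolding inh_def using 0 T transitive[OF T(1)] by (intro definability) auto
    qed
    then show ?case
    proof (rule represents_cong)
      show "hpair (hstr s) v \<in> elts (?R 0) \<longleftrightarrow> forces_not (inh (\<lambda>u s. True) v) (hstr s)" for s
        using 0 by (auto simp: R0_def elts_SEQ)
      have "val (gen x) v = hz 0 \<longleftrightarrow> (\<forall>y. y \<notin> elts (val (gen x) v))" for x
        using hc_ext[of "val (gen x) v" "hset {}"] by auto
      then show "val (gen x) v = hz 0 \<longleftrightarrow>
          \<not> (\<exists>u\<in>elts T. \<exists>a\<in>elts T. hpair u a \<in> elts v \<and> a \<in> gen x \<and> True)" for x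
        using val_elts[OF 0] by auto
    qed
  next
    case (Suc n)
    have vM: "v \<in> M" using Suc.prems T(1) transitive by blast
    have "represents (\<lambda>s. inh (?in (?R n)) v s \<and> forces_not (inh (\<lambda>u. forces_not (?in (?R n) u)) v) s)
        (\<lambda>x. (\<exists>u\<in>elts T. \<exists>a\<in>elts T. hpair u a \<in> elts v \<and> a \<in> gen x \<and> val (gen x) u = hz n) \<and>
          \<not> (\<exists>u\<in>elts T. \<exists>a\<in>elts T. hpair u a \<in> elts v \<and> a \<in> gen x \<and> \<not> val (gen x) u = hz n))"
    proof (intro represents_conj represents_not rep_inh Suc.IH)
      show "definable M (\<lambda>c. hpair (c 0) u \<in> elts (?R n))" if "u \<in> elts T" for u
        using that T transitive[OF T(1)] R_in by (intro definability) auto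
      show "definable M (\<lambda>c. inh (\<lambda>u. forces_not (?in (?R n) u)) v (c 0))"
        unfolding inh_def forces_not_def by (intro definability T SEQ_in vM R_in)
    qed
    then show ?case
    proof (rule represents_cong)
      show "hpair (hstr s) v \<in> elts (?R (Suc n)) \<longleftrightarrow>
          inh (?in (?R n)) v (hstr s) \<and> forces_not (inh (\<lambda>u. forces_not (?in (?R n) u)) v) (hstr s)" for s
        using Suc.prems by (auto simp: step_def elts_SEQ)
      have "val (gen x) v = hz (Suc n) \<longleftrightarrow> hz n \<in> elts (val (gen x) v) \<and>
          \<not> (\<exists>y. y \<in> elts (val (gen x) v) \<and> y \<noteq> hz n)" for x
        using hc_ext[of "val (gen x) v" "hset {hz n}"] by auto
      then show "val (gen x) v = hz (Suc n) \<longleftrightarrow>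
          (\<exists>u\<in>elts T. \<exists>a\<in>elts T. hpair u a \<in> elts v \<and> a \<in> gen x \<and> val (gen x) u = hz n) \<and>
          \<not> (\<exists>u\<in>elts T. \<exists>a\<in>elts T. hpair u a \<in> elts v \<and> a \<in> gen x \<and> \<not> val (gen x) u = hz n)" for x
        unfolding val_elts[OF Suc.prems] by blast
    qed
  qed
  \<comment> \<open>All stages are needed at once, so stage \<open>R\<close> is looked up in the
    sequence of stages, which lies in \<open>M\<close>.\<close>
  let ?P = "\<lambda>p. \<exists>s\<in>elts SEQ. \<exists>n\<in>elts homega. p = hpair s n \<and>
    (\<exists>R\<in>elts (hfield (hseq ?R)). hpair n R \<in> elts (hseq ?R) \<and> inh (?in R) t s)"
  let ?Q = "hset {p \<in> elts (hprod SEQ homega). ?P p}"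
  have QM: "?Q \<in> M"
    unfolding inh_def
    by (rule collect_in, rule term_in) (intro definability SEQ_in homega_in T(1) t Rseq hfield_in)+
  have Q: "hpair (hstr s) n \<in> elts ?Q \<longleftrightarrow> (\<exists>k. n = hnat k \<and> inh (?in (?R k)) t (hstr s))" for s n
  proof -
    have "?R k \<in> elts (hfield (hseq ?R))" for k
      using hpair_mem_hfield[of "hnat k" "?R k" "hseq ?R"] by simp
    then show ?thesis unfolding elts_hset_Collect by (auto simp: elts_SEQ)
  qed
  have rep: "represents (inh (?in (?R n)) t) (\<lambda>x. hz n \<in> elts (val (gen x) t))" for n
  proof (rule represents_cong)
    show "represents (inh (?in (?R n)) t)
        (\<lambda>x. \<exists>u\<in>elts T. \<exists>a\<in>elts T. hpair u a \<in> elts t \<and> a \<in> gen x \<and> val (gen x) u = hz n)"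
      by (intro rep_inh rep_R)
    show "hz n \<in> elts (val (gen x) t) \<longleftrightarrow>
      (\<exists>u\<in>elts T. \<exists>a\<in>elts T. hpair u a \<in> elts t \<and> a \<in> gen x \<and> val (gen x) u = hz n)" for x
      unfolding val_elts[OF T(2)] by blast
  qed simp
  show ?thesis
  proof (rule that[of ?Q])
    show "real_code ?Q"
      unfolding real_code_def Q using QM represents_extend[OF rep] by blast
    show "decode ?Q x n \<longleftrightarrow> hz n \<in> elts (val (gen x) t)" if "x \<in> cohen_reals M" for x n
      using represents_iff[OF rep that] unfolding decode_def Q by auto
  qed
qed

text \<open>The value of \<open>generic_name\<close> at \<open>y\<close> lies in
  \<open>M[y] = M[x]\<close>, so it is the value at \<open>x\<close> of some name \<open>t\<close>
  in \<open>M\<close>, and \<open>real_code_of_name\<close> turns \<open>t\<close> into a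
  code.\<close>

lemma generic_ext_decode:
  assumes x: "x \<in> cohen_reals M" and y: "y \<in> cohen_reals M"
    and eq: "generic_ext M x = generic_ext M y"
  obtains Q where "real_code Q" "decode Q x = y"
proof -
  have "val (gen y) generic_name \<in> val (gen x) ` M"
    using eq generic_name_in by (auto simp: generic_ext_eq)
  then obtain t where t: "t \<in> M" "val (gen y) generic_name = val (gen x) t" by blast
  obtain Q where Q: "real_code Q"
    "\<And>x n. x \<in> cohen_reals M \<Longrightarrow> decode Q x n \<longleftrightarrow> hz n \<in> elts (val (gen x) t)"
    using real_code_of_name[OF t(1)] by blast
  have "decode Q x = y"
    using Q(2)[OF x] val_generic_name[OF y] t(2) by (auto simp: fun_eq_iff)
  then show ?thesis using that Q(1) by blast
qed

end

section \<open>Sparse dense families of cylinders\<close>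

context ctm
begin

lemma represents_all_less:
  fixes n :: nat
  assumes "\<And>i. i < n \<Longrightarrow> represents (Q i) (P i)"
  shows "represents (\<lambda>s. \<forall>i<n. Q i s) (\<lambda>x. \<forall>i<n. P i x)"
  using assms
proof (induction n)
  case 0 then show ?case using represents_const[of True] by simp
next
  case (Suc n)
  have "represents (\<lambda>s. Q n s \<and> (\<forall>i<n. Q i s)) (\<lambda>x. P n x \<and> (\<forall>i<n. P i x))"
    using Suc by (intro represents_conj) auto
  then show ?case by (simp add: All_less_Suc conj_commute)
qed

lemma represents_bit: "represents (\<lambda>s. hpair (hnat m) (hbit b) \<in> elts s) (\<lambda>x. x m = b)"
  unfolding represents_def
proof (intro conjI allI impI ballI)
  fix x show "x m = b \<longleftrightarrow> (\<exists>s. pfx s x \<and> hpair (hnat m) (hbit b) \<in> elts (hstr s))"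
  proof
    assume "x m = b"
    then show "\<exists>s. pfx s x \<and> hpair (hnat m) (hbit b) \<in> elts (hstr s)"
      by (intro exI[of _ "map x [0..<Suc m]"]) (auto simp del: upt_Suc)
  qed (auto simp: pfx_def)
qed (auto simp: nth_append)

section \<open>Codes for compositions\<close>

definition forces_pfx :: "hc \<Rightarrow> hc \<Rightarrow> hc \<Rightarrow> bool" where
  "forces_pfx Q r s \<longleftrightarrow> (\<forall>i\<in>elts homega. (hpair i (hbit True) \<in> elts r \<longrightarrow> hpair s i \<in> elts Q) \<and>
     (hpair i (hbit False) \<in> elts r \<longrightarrow> forces_not (\<lambda>s. hpair s i \<in> elts Q) s))"

lemma represents_forces_pfx:
  assumes Q: "real_code Q"
  shows "represents (forces_pfx Q (hstr r)) (\<lambda>x. pfx r (decode Q x))"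
proof -
  have QM: "Q \<in> M" using Q by (simp add: real_code_def)
  let ?K = "\<lambda>i s. if r ! i then hpair s (hnat i) \<in> elts Q else forces_not (\<lambda>s. hpair s (hnat i) \<in> elts Q) s"
  have "represents (\<lambda>s. \<forall>i<length r. ?K i s) (\<lambda>x. \<forall>i<length r. decode Q x i = r ! i)"
  proof (rule represents_all_less)
    fix i
    have "represents (forces_not (\<lambda>s. hpair s (hnat i) \<in> elts Q)) (\<lambda>x. \<not> decode Q x i)"
      by (intro represents_not represents_decode Q) (intro definability QM hnat_in)
    then show "represents (?K i) (\<lambda>x. decode Q x i = r ! i)"
      using represents_decode[OF Q, of i] by (cases "r ! i") simp_all
  qed
  then show ?thesis
    by (rule represents_cong) (auto simp: forces_pfx_def pfx_def)
qed

definition hcomp :: "hc \<Rightarrow> hc \<Rightarrow> hc" where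
  "hcomp Q R = hset {p \<in> elts (hprod SEQ homega). \<exists>s\<in>elts SEQ. \<exists>n\<in>elts homega. p = hpair s n \<and>
     (\<exists>r\<in>elts SEQ. hpair r n \<in> elts R \<and> forces_pfx Q r s)}"

lemma definable_term_hcomp [definability]:
  "definable_term M t \<Longrightarrow> definable_term M u \<Longrightarrow> definable_term M (\<lambda>c. hcomp (t c) (u c))"
  by (rule definable_term_subst2[where f = hcomp], unfold hcomp_def forces_pfx_def forces_not_def) (intro definability SEQ_in homega_in hbit_in)

lemma hpair_mem_hcomp:
  "hpair (hstr s) n \<in> elts (hcomp Q R) \<longleftrightarrow>
     n \<in> elts homega \<and> (\<exists>r. hpair (hstr r) n \<in> elts R \<and> forces_pfx Q (hstr r) (hstr s))"
  unfolding hcomp_def elts_hset_Collect by (auto simp: elts_SEQ)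

text \<open>Only \<open>x\<close> has to be Cohen: there the prefixes of \<open>decode Q x\<close>
  are decided by prefixes of \<open>x\<close>, while decoding \<open>R\<close> merely looks at
  prefixes of its argument.\<close>

lemma hcomp:
  assumes Q: "real_code Q" and R: "real_code R"
  shows real_code_hcomp: "real_code (hcomp Q R)"
    and decode_hcomp: "x \<in> cohen_reals M \<Longrightarrow> decode (hcomp Q R) x = decode R (decode Q x)"
proof -
  have "hcomp Q R \<in> M" using Q R by (rule_tac term_in) (intro definability, auto simp: real_code_def)
  then show "real_code (hcomp Q R)"
    unfolding real_code_def hpair_mem_hcomp using represents_extend[OF represents_forces_pfx[OF Q]] by blast
  show "decode (hcomp Q R) x = decode R (decode Q x)" if x: "x \<in> cohen_reals M"
  proof
    fix n
    have "decode (hcomp Q R) x n \<longleftrightarrow> (\<exists>r. hpair (hstr r) (hnat n) \<in> elts R \<and> (\<exists>s. pfx s x \<and> forces_pfx Q (hstr r) (hstr s)))"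
      unfolding decode_def hpair_mem_hcomp by auto
    also have "\<dots> \<longleftrightarrow> (\<exists>r. hpair (hstr r) (hnat n) \<in> elts R \<and> pfx r (decode Q x))"
      by (simp add: represents_iff[OF represents_forces_pfx[OF Q] x])
    finally show "decode (hcomp Q R) x n \<longleftrightarrow> decode R (decode Q x) n"
      by (auto simp: decode_def[of R])
  qed
qed

definition hident :: hc where
  "hident = hset {p \<in> elts (hprod SEQ homega). \<exists>s\<in>elts SEQ. \<exists>n\<in>elts homega. p = hpair s n \<and>
     hpair n (hbit True) \<in> elts s}"

lemma hpair_mem_hident: "hpair (hstr s) n \<in> elts hident \<longleftrightarrow> (\<exists>k<length s. n = hnat k \<and> s ! k)"
  unfolding hident_def elts_hset_Collect by (auto simp: elts_SEQ)

lemma real_code_hident: "real_code hident"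
proof -
  have "hident \<in> M"
    unfolding hident_def by (rule collect_in, rule term_in) (intro definability SEQ_in homega_in hbit_in)+
  then show ?thesis by (auto simp: real_code_def hpair_mem_hident nth_append)
qed

lemma decode_hident: "decode hident x = x"
proof
  fix n
  have "\<exists>s. pfx s x \<and> n < length s \<and> s ! n" if "x n"
    using that by (intro exI[of _ "map x [0..<Suc n]"]) (auto simp del: upt_Suc)
  then show "decode hident x n \<longleftrightarrow> x n"
    by (auto simp: decode_def hpair_mem_hident pfx_def)
qed

definition hcomps :: "hc \<Rightarrow> hc" where
  "hcomps A = hset (\<Union>Q\<in>elts A. elts (hset ((\<lambda>R. hcomp Q R) ` elts A)))"

lemma elts_hcomps: "elts (hcomps A) = {hcomp Q R |Q R. Q \<in> elts A \<and> R \<in> elts A}"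
proof -
  have "hcomps A = hUnion (hset ((\<lambda>Q. hset ((\<lambda>R. hcomp Q R) ` elts A)) ` elts A))"
    unfolding hcomps_def hUnion_def by simp
  then have "elts (hcomps A) = (\<Union>Q\<in>elts A. hcomp Q ` elts A)"
    unfolding elts_hUnion by simp
  then show ?thesis by blast
qed

text \<open>Both ends have to be Cohen reals because \<open>decode Q x\<close> need not be one,
  while compositions of codes are evaluated at Cohen reals only.\<close>

definition moves :: "hc set \<Rightarrow> real2 rel" where
  "moves F = {(x, y). x \<in> cohen_reals M \<and> y \<in> cohen_reals M \<and> (\<exists>Q\<in>F. y = decode Q x)}"

lemma moves_relpow_cohen: "(x, y) \<in> moves F ^^ m \<Longrightarrow> x \<in> cohen_reals M \<Longrightarrow> y \<in> cohen_reals M"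
proof (induction m arbitrary: y)
  case (Suc m)
  then obtain z where "(z, y) \<in> moves F" by (meson relpow_Suc_E)
  then show ?case by (simp add: moves_def)
qed simp

definition words :: "hc set \<Rightarrow> nat \<Rightarrow> hc" where
  "words F k = (hcomps ^^ k) (hset (insert hident F))"

lemma words:
  assumes "finite F" "\<And>Q. Q \<in> F \<Longrightarrow> real_code Q"
  shows finite_words: "finite (elts (words F k))"
    and real_code_words: "Q \<in> elts (words F k) \<Longrightarrow> real_code Q"
proof -
  have "finite (elts (words F k)) \<and> (\<forall>Q\<in>elts (words F k). real_code Q)"
  proof (induction k)
    case 0
    have "elts (words F 0) = insert hident F" using assms(1) by (simp add: words_def countable_finite)
    then show ?case using assms real_code_hident by auto
  next
    case (Suc k)
    have eq: "elts (words F (Suc k)) = (\<lambda>(Q, R). hcomp Q R) ` (elts (words F k) \<times> elts (words F k))"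
      by (auto simp: words_def elts_hcomps)
    then show ?case using Suc by (auto simp: real_code_hcomp)
  qed
  then show "finite (elts (words F k))" "Q \<in> elts (words F k) \<Longrightarrow> real_code Q" by auto
qed

lemma hseq_words_in:
  assumes "finite F" "\<And>Q. Q \<in> F \<Longrightarrow> real_code Q"
  shows "hseq (words F) \<in> M"
  unfolding words_def
proof (rule hseq_funpow_in)
  show "hset (insert hident F) \<in> M"
    using assms real_code_hident by (intro finite_in) (auto simp: real_code_def)
  show "definable_term M (\<lambda>c. hcomps (c 0))" unfolding hcomps_def by (intro definability)
qed

lemma moves_relpow_words:
  assumes F: "finite F" "\<And>Q. Q \<in> F \<Longrightarrow> real_code Q"
  shows "(x, y) \<in> moves F ^^ m \<Longrightarrow> m \<le> 2 ^ k \<Longrightarrow> x \<in> cohen_reals M \<Longrightarrow> \<exists>Q\<in>elts (words F k). decode Q x = y"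
proof (induction k arbitrary: m x y)
  case 0
  have eq: "elts (words F 0) = insert hident F" using F(1) by (simp add: words_def countable_finite)
  consider "m = 0" | "m = 1" using 0(2) by force
  then show ?case
    using 0(1) unfolding eq by cases (auto simp: decode_hident moves_def)
next
  case (Suc k)
  \<comment> \<open>A path of length at most \<open>2 ^ Suc k\<close> splits into two of length at
    most \<open>2 ^ k\<close>.\<close>
  define a where "a = min m (2 ^ k)"
  have ab: "m = a + (m - a)" "a \<le> 2 ^ k" "m - a \<le> 2 ^ k" using Suc.prems(2) by (auto simp: a_def)
  have "(x, y) \<in> moves F ^^ a O moves F ^^ (m - a)"
    using Suc.prems(1) ab(1) by (metis relpow_add)
  then obtain z where z: "(x, z) \<in> moves F ^^ a" "(z, y) \<in> moves F ^^ (m - a)" by blast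
  have "z \<in> cohen_reals M" using moves_relpow_cohen[OF z(1) Suc.prems(3)] .
  then obtain Q R where "Q \<in> elts (words F k)" "decode Q x = z" "R \<in> elts (words F k)" "decode R z = y"
    using Suc.IH[OF z(1) ab(2) Suc.prems(3)] Suc.IH[OF z(2) ab(3)] by blast
  then have "hcomp Q R \<in> elts (words F (Suc k))" "decode (hcomp Q R) x = y"
    using decode_hcomp[OF real_code_words[OF F] real_code_words[OF F] Suc.prems(3)]
    by (auto simp: words_def elts_hcomps)
  then show ?case by blast
qed

text \<open>
  If \<open>settled Q s\<close>, then either all Cohen reals extending \<open>s\<close> are fixed by \<open>decode Q\<close>, or all of them
  are mapped outside of the cylinder of \<open>s\<close>.
\<close>

definition moved :: "hc \<Rightarrow> hc \<Rightarrow> bool" where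
  "moved Q s \<longleftrightarrow> (\<exists>m\<in>elts homega. (hpair m (hbit True) \<in> elts s \<and> forces_not (\<lambda>s. hpair s m \<in> elts Q) s) \<or>
     (hpair m (hbit False) \<in> elts s \<and> hpair s m \<in> elts Q))"

definition settled :: "hc \<Rightarrow> hc \<Rightarrow> bool" where
  "settled Q s \<longleftrightarrow> moved Q s \<or> forces_not (moved Q) s"

lemma represents_disj:
  assumes "represents Q P" "represents Q' P'"
  shows "represents (\<lambda>s. Q s \<or> Q' s) (\<lambda>x. P x \<or> P' x)"
  using assms unfolding represents_def by blast

lemma represents_moved:
  assumes Q: "real_code Q"
  shows "represents (moved Q) (\<lambda>x. decode Q x \<noteq> x)"
proof -
  have QM: "Q \<in> M" using Q by (simp add: real_code_def)
  have "represents (forces_not (\<lambda>s. hpair s (hnat i) \<in> elts Q)) (\<lambda>x. \<not> decode Q x i)" for i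
    by (intro represents_not represents_decode Q) (intro definability QM hnat_in)
  then have "represents (\<lambda>s. \<exists>m\<in>UNIV. (hpair (hnat m) (hbit True) \<in> elts s \<and> forces_not (\<lambda>s. hpair s (hnat m) \<in> elts Q) s) \<or>
     (hpair (hnat m) (hbit False) \<in> elts s \<and> hpair s (hnat m) \<in> elts Q))
     (\<lambda>x. \<exists>m\<in>UNIV. (x m = True \<and> \<not> decode Q x m) \<or> (x m = False \<and> decode Q x m))"
    by (intro represents_ex represents_disj represents_conj represents_bit represents_decode Q)
  then show ?thesis
    by (rule represents_cong) (auto simp: moved_def fun_eq_iff)
qed

lemma definable_moved [definability]:
  "definable_term M t \<Longrightarrow> definable_term M u \<Longrightarrow> definable M (\<lambda>c. moved (t c) (u c))"
  by (rule definable_subst2[where P = moved], unfold moved_def forces_not_def) (intro definability homega_in SEQ_in hbit_in)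

lemma definable_settled [definability]:
  "definable_term M t \<Longrightarrow> definable_term M u \<Longrightarrow> definable M (\<lambda>c. settled (t c) (u c))"
  by (rule definable_subst2[where P = settled], unfold settled_def forces_not_def) (intro definability homega_in SEQ_in hbit_in)

lemma settled_extend:
  assumes "real_code Q" "settled Q (hstr s)" shows "settled Q (hstr (s @ u))"
  using assms represents_extend[OF represents_moved[OF assms(1)]]
  by (auto simp: settled_def forces_not_hstr)

lemma settled_dense: "\<exists>u. settled Q (hstr (s @ u))"
  unfolding settled_def forces_not_hstr by (metis append_Nil2)

lemma settled_dense_finite:
  assumes "finite F" "\<And>Q. Q \<in> F \<Longrightarrow> real_code Q"
  shows "\<exists>u. \<forall>Q\<in>F. settled Q (hstr (s @ u))"
  using assms
proof (induction F rule: finite_induct)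
  case (insert Q F)
  then obtain u where u: "\<forall>Q\<in>F. settled Q (hstr (s @ u))" by auto
  obtain v where "settled Q (hstr ((s @ u) @ v))" using settled_dense by blast
  then have "\<forall>R\<in>insert Q F. settled R (hstr ((s @ u) @ v))"
    using u settled_extend insert.prems by blast
  then show ?case by (metis append.assoc)
qed simp

lemma settled_fixed:
  assumes Q: "real_code Q" and x: "x \<in> cohen_reals M"
    and s: "settled Q (hstr s)" "pfx s x" "pfx s (decode Q x)"
  shows "decode Q x = x"
proof -
  have QM: "Q \<in> M" using Q by (simp add: real_code_def)
  from s(1) consider "moved Q (hstr s)" | "forces_not (moved Q) (hstr s)" by (auto simp: settled_def)
  then show ?thesis
  proof cases
    \<comment> \<open>Some bit of \<open>decode Q x\<close> below \<open>length s\<close> is forced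
      to differ from that of \<open>s\<close>, contrary to the assumption that
      \<open>decode Q x\<close> extends \<open>s\<close>.\<close>
    case 1
    then obtain m where m: "m < length s"
      "(s ! m \<and> forces_not (\<lambda>s. hpair s (hnat m) \<in> elts Q) (hstr s)) \<or> (\<not> s ! m \<and> hpair (hstr s) (hnat m) \<in> elts Q)"
      by (auto simp: moved_def)
    have *: "represents (forces_not (\<lambda>s. hpair s (hnat m) \<in> elts Q)) (\<lambda>x. \<not> decode Q x m)"
      by (intro represents_not represents_decode Q) (intro definability QM hnat_in)
    have "decode Q x m = s ! m" using s(3) m(1) by (simp add: pfx_def)
    moreover have "decode Q x m \<noteq> s ! m"
      using m(2) s(2) represents_iff[OF * x] by (auto simp: decode_def)
    ultimately show ?thesis by simp
  next
    case 2
    have "represents (forces_not (moved Q)) (\<lambda>x. \<not> decode Q x \<noteq> x)"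
      by (intro represents_not represents_moved Q) (intro definability QM)
    from represents_iff[OF this x] show ?thesis using 2 s(2) by blast
  qed
qed

text \<open>Function application as a definable term: the union removes the braces around the unique
  value.\<close>

definition happ :: "hc \<Rightarrow> hc \<Rightarrow> hc" where
  "happ f a = hUnion (hset {b \<in> elts (hfield f). hpair a b \<in> elts f})"

lemma happ_hseq: "happ (hseq f) (hnat n) = f n"
proof -
  have "{b \<in> elts (hfield (hseq f)). hpair (hnat n) b \<in> elts (hseq f)} = {f n}"
    using hpair_mem_hfield[of "hnat n" "f n" "hseq f"] by auto
  then show ?thesis unfolding happ_def by (intro hc_ext) simp
qed

text \<open>Doubling is an iteration of two successors, and the powers of 2 are an iteration of
  doubling; \<open>hseq_funpow_in\<close> puts both into \<open>M\<close>.\<close>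

lemma hseq_two_power_in: "hseq (\<lambda>n. hnat (2 ^ n)) \<in> M"
proof -
  have "((\<lambda>a. hsucc (hsucc a)) ^^ n) (hnat 0) = hnat (2 * n)" for n
    by (induction n) (simp_all add: hnat.simps)
  moreover have "hseq (\<lambda>n. ((\<lambda>a. hsucc (hsucc a)) ^^ n) (hnat 0)) \<in> M"
    by (rule hseq_funpow_in[OF hnat_in]) (intro definability)
  ultimately have dbl: "hseq (\<lambda>n. hnat (2 * n)) \<in> M" by simp
  have "((\<lambda>a. happ (hseq (\<lambda>n. hnat (2 * n))) a) ^^ n) (hnat 1) = hnat (2 ^ n)" for n
    by (induction n) (simp_all add: happ_hseq)
  moreover have "hseq (\<lambda>n. ((\<lambda>a. happ (hseq (\<lambda>n. hnat (2 * n))) a) ^^ n) (hnat 1)) \<in> M"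
    unfolding happ_def by (rule hseq_funpow_in[OF hnat_in]) (intro definability dbl hfield_in)
  ultimately show ?thesis by simp
qed

text \<open>Each \<open>t\<close> is extended to a string \<open>c t\<close> that settles the
  finitely many words in question. As \<open>c\<close> is chosen in \<open>M\<close>, its values
  form a dense set there, which every Cohen real meets. The bound depends on the length of
  \<open>t\<close>, which \<open>M\<close> reads off directly; by \<open>string_index_less\<close>
  it is large enough for the index of \<open>t\<close> in the later enumeration of strings.\<close>

lemma sparse_strings:
  assumes F: "finite F" "\<And>Q. Q \<in> F \<Longrightarrow> real_code Q"
  obtains c :: "bool list \<Rightarrow> bool list" where
    "\<And>x. x \<in> cohen_reals M \<Longrightarrow> \<exists>t. pfx (c t) x"
    "\<And>t x y m. \<lbrakk>x \<in> cohen_reals M; (x, y) \<in> moves F ^^ m; m \<le> 2 ^ (2 ^ Suc (length t));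
       pfx (c t) x; pfx (c t) y\<rbrakk> \<Longrightarrow> x = y"
proof -
  let ?W = "hseq (words F)" and ?P = "hseq (\<lambda>n. hnat (2 ^ n))"
  \<comment> \<open>The two lookups produce \<open>k = 2 ^ Suc (length t)\<close> and then
    \<open>w = words F k\<close>.\<close>
  define R where "R t s \<longleftrightarrow> elts t \<subseteq> elts s \<and> (\<exists>n\<in>elts homega. (\<forall>i\<in>elts homega. hdom i t \<longleftrightarrow> i \<in> elts n) \<and>
    (\<exists>k\<in>elts homega. hpair (hsucc n) k \<in> elts ?P \<and>
      (\<exists>w\<in>elts (hfield ?W). hpair k w \<in> elts ?W \<and> (\<forall>Q\<in>elts w. settled Q s))))" for t s
  have R: "R (hstr t) (hstr s) \<longleftrightarrow> (\<exists>u. s = t @ u) \<and> (\<forall>Q\<in>elts (words F (2 ^ Suc (length t))). settled Q (hstr s))" for t s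
  proof -
    have "words F k \<in> elts (hfield ?W)" for k
      using hpair_mem_hfield[of "hnat k" "words F k" ?W] by simp
    then show ?thesis
      unfolding R_def by (auto simp: all_less_iff_less_iff simp flip: hnat.simps(2))
  qed
  have "definable M (\<lambda>c. R (c 0) (c 1))"
    unfolding R_def
    by (intro definability homega_in hfield_in hseq_words_in[OF F] hseq_two_power_in)
  moreover have "\<exists>s\<in>elts SEQ. R t s" if t: "t \<in> elts SEQ" for t
  proof -
    obtain r where r: "t = hstr r" using t by (auto simp: elts_SEQ)
    have "\<exists>u. \<forall>Q\<in>elts (words F (2 ^ Suc (length r))). settled Q (hstr (r @ u))"
      by (rule settled_dense_finite[OF finite_words[OF F] real_code_words[OF F]])
    then show ?thesis unfolding r by (auto simp: elts_SEQ R)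
  qed
  ultimately obtain g where g: "\<And>t. t \<in> elts SEQ \<Longrightarrow> g t \<in> elts SEQ \<and> R t (g t)"
    and gM: "hset ((\<lambda>t. hpair t (g t)) ` elts SEQ) \<in> M"
    using uniformization[OF SEQ_in SEQ_in, of R] by blast
  define c where "c t = (SOME s. g (hstr t) = hstr s)" for t
  have gc: "g (hstr t) = hstr (c t)" for t
    unfolding c_def by (rule someI_ex) (use g[of "hstr t"] in \<open>auto simp: elts_SEQ\<close>)
  have Rc: "R (hstr t) (hstr (c t))" for t using g[of "hstr t"] by (simp add: gc elts_SEQ)
  show ?thesis
  proof (rule that[of c])
    fix x assume x: "x \<in> cohen_reals M"
    let ?G = "hset ((\<lambda>t. hpair t (g t)) ` elts SEQ)"
    let ?D = "\<lambda>s. \<exists>t\<in>elts SEQ. hpair t s \<in> elts ?G"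
    have D: "?D (hstr s) \<longleftrightarrow> (\<exists>t. s = c t)" for s by (auto simp: elts_SEQ gc image_iff)
    obtain s where "pfx s x" "?D (hstr s)"
    proof (rule cohen_real_meets[OF x, of ?D])
      show "definable M (\<lambda>c. ?D (c 0))" by (intro definability SEQ_in gM)
      show "\<exists>t. ?D (hstr (s @ t))" for s
        unfolding D using Rc[of s] unfolding R by metis
    qed
    then show "\<exists>t. pfx (c t) x" unfolding D by blast
  next
    fix t x y m
    assume x: "x \<in> cohen_reals M" and xy: "(x, y) \<in> moves F ^^ m" "m \<le> 2 ^ (2 ^ Suc (length t))"
      and pfx: "pfx (c t) x" "pfx (c t) y"
    obtain Q where Q: "Q \<in> elts (words F (2 ^ Suc (length t)))" "decode Q x = y"
      using moves_relpow_words[OF F xy x] by blast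
    have "settled Q (hstr (c t))" using Rc[of t] Q(1) unfolding R by blast
    then show "x = y"
      using settled_fixed[OF real_code_words[OF F Q(1)] x] Q(2) pfx by metis
  qed
qed

end

section \<open>Hyperfinite Borel equivalence relations\<close>

instance bool :: second_countable_topology
proof
  have "open = generate_topology (UNIV :: bool set set)"
    by (auto simp: fun_eq_iff open_discrete intro: generate_topology.Basis)
  then show "\<exists>B::bool set set. countable B \<and> open = generate_topology B"
    by (intro exI[of _ UNIV]) auto
qed

lemma open_vimage_proj: "open W \<Longrightarrow> open ((\<lambda>f. f i) -` W)"
  by (intro open_vimage continuous_on_product_coordinates)

instance "fun" :: (type, t0_space) t0_space
proof
  fix x y :: "'a \<Rightarrow> 'b"
  assume "x \<noteq> y"
  then obtain i where i: "x i \<noteq> y i" by (auto simp: fun_eq_iff)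
  from t0_space_class.t0_space[OF i] obtain U where "open U" "\<not> (x i \<in> U \<longleftrightarrow> y i \<in> U)" by (elim exE conjE)
  then show "\<exists>U. open U \<and> \<not> (x \<in> U \<longleftrightarrow> y \<in> U)"
    by (intro exI[of _ "(\<lambda>f. f i) -` U"]) (simp add: open_vimage_proj)
qed

instance "fun" :: (type, t1_space) t1_space
proof
  fix x y :: "'a \<Rightarrow> 'b"
  assume "x \<noteq> y"
  then obtain i where "x i \<noteq> y i" by (auto simp: fun_eq_iff)
  then obtain U where "open U" "x i \<in> U" "y i \<notin> U" using t1_space by blast
  then show "\<exists>U. open U \<and> x \<in> U \<and> y \<notin> U"
    by (intro exI[of _ "(\<lambda>f. f i) -` U"]) (simp add: open_vimage_proj)
qed

instance "fun" :: (type, t2_space) t2_space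
proof
  fix x y :: "'a \<Rightarrow> 'b"
  assume "x \<noteq> y"
  then obtain i where "x i \<noteq> y i" by (auto simp: fun_eq_iff)
  then obtain U V where "open U" "open V" "x i \<in> U" "y i \<in> V" "U \<inter> V = {}"
    by (meson hausdorff)
  then show "\<exists>U V. open U \<and> open V \<and> x \<in> U \<and> y \<in> V \<and> U \<inter> V = {}"
    by (intro exI[of _ "(\<lambda>f. f i) -` U"] exI[of _ "(\<lambda>f. f i) -` V"]) (auto simp: open_vimage_proj)
qed

section \<open>Borel relations covered by countably many Borel functions\<close>

lemma borel_pair_vimage:
  fixes A :: "('a::second_countable_topology \<times> 'b::second_countable_topology) set"
  assumes "A \<in> sets borel" "f \<in> borel_measurable borel" "g \<in> borel_measurable borel"
  shows "{x. (f x, g x) \<in> A} \<in> sets borel"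
proof -
  have "(\<lambda>x. (f x, g x)) \<in> borel_measurable borel"
    using assms(2,3) by (rule borel_measurable_Pair)
  from measurable_sets[OF this assms(1)] show ?thesis by (simp add: vimage_def)
qed

lemma borel_Times:
  fixes A :: "'a::second_countable_topology set" and B :: "'b::second_countable_topology set"
  shows "A \<in> sets borel \<Longrightarrow> B \<in> sets borel \<Longrightarrow> A \<times> B \<in> sets borel"
  by (metis borel_prod pair_measureI)

lemma borel_Id_on:
  fixes A :: "'a::{second_countable_topology,t2_space} set"
  assumes "A \<in> sets borel" shows "Id_on A \<in> sets borel"
proof -
  have "Id_on A = {y. \<exists>x. y = (x, x)} \<inter> A \<times> A" by auto
  also have "\<dots> \<in> sets borel"
    by (intro sets.Int borel_Times assms borel_closed closed_diagonal)
  finally show ?thesis .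
qed

text \<open>In general a composition is a projection and need not be Borel. Here the intermediate
  point is \<open>f x\<close> for one of countably many Borel functions \<open>f\<close>, so the
  projection becomes a countable union of preimages.\<close>

lemma borel_relcomp:
  fixes R S :: "'a::second_countable_topology rel"
  assumes "countable G" "\<And>f. f \<in> G \<Longrightarrow> f \<in> borel_measurable borel"
    and "R \<in> sets borel" "S \<in> sets borel" "\<And>x y. (x, y) \<in> R \<Longrightarrow> \<exists>f\<in>G. y = f x"
  shows "R O S \<in> sets borel"
proof -
  have "R O S = (\<Union>f\<in>G. {p. (fst p, f (fst p)) \<in> R} \<inter> {p. (f (fst p), snd p) \<in> S})"
    using assms(5) by (auto simp: relcomp_unfold) blast
  also have "\<dots> \<in> sets borel"
  proof (intro sets.countable_UN'' assms(1) sets.Int)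
    fix f assume "f \<in> G"
    then have f: "f \<in> borel_measurable borel" using assms(2) by blast
    have fst: "fst \<in> borel_measurable (borel :: ('a \<times> 'a) measure)"
      and snd: "snd \<in> borel_measurable (borel :: ('a \<times> 'a) measure)"
      by (simp_all add: measurable_fst measurable_snd flip: borel_prod)
    have f_fst: "(\<lambda>p :: 'a \<times> 'a. f (fst p)) \<in> borel_measurable borel"
      using measurable_compose[OF fst f] .
    show "{p :: 'a \<times> 'a. (fst p, f (fst p)) \<in> R} \<in> sets borel"
      using borel_pair_vimage[OF assms(3) fst f_fst] by simp
    show "{p. (f (fst p), snd p) \<in> S} \<in> sets borel"
      using borel_pair_vimage[OF assms(4) f_fst snd] by simp
  qed
  finally show ?thesis .
qed

lemma borel_relpow:
  fixes S :: "'a::{second_countable_topology,t2_space} rel"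
  assumes "countable G" "\<And>f. f \<in> G \<Longrightarrow> f \<in> borel_measurable borel"
    and "S \<in> sets borel" "\<And>x y. (x, y) \<in> S \<Longrightarrow> \<exists>f\<in>G. y = f x"
  shows "S ^^ n \<in> sets borel"
proof (induction n)
  case 0
  have "Id = Id_on (UNIV :: 'a set)" by auto
  then show ?case using borel_Id_on[of "UNIV :: 'a set"] by simp
next
  case (Suc n)
  have "S ^^ Suc n = S O S ^^ n" by (simp add: relpow_commute)
  then show ?case using borel_relcomp[OF assms(1-3) Suc assms(4)] by simp
qed

lemma borel_rtrancl:
  fixes S :: "'a::{second_countable_topology,t2_space} rel"
  assumes "countable G" "\<And>f. f \<in> G \<Longrightarrow> f \<in> borel_measurable borel"
    and "S \<in> sets borel" "\<And>x y. (x, y) \<in> S \<Longrightarrow> \<exists>f\<in>G. y = f x"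
  shows "S\<^sup>* \<in> sets borel"
  unfolding rtrancl_is_UN_relpow by (intro sets.countable_UN'' borel_relpow[OF assms]) auto

lemma equiv_rtrancl_restrict: "sym S \<Longrightarrow> equiv X (S\<^sup>* \<inter> X \<times> X)"
proof (rule equivI)
  assume "sym S"
  then have "sym (S\<^sup>*)" by (rule sym_rtrancl)
  then show "sym (S\<^sup>* \<inter> X \<times> X)" by (auto simp: sym_def)
qed (auto simp: refl_on_def trans_def intro: rtrancl_trans)

text \<open>Between consecutive visits to \<open>N\<close> a path stays in \<open>Z\<close>, where
  it can be shortened to length at most \<open>d\<close>; so these visits are joined by at most
  \<open>d + 2\<close> edges and coincide. Thus a component has at most one point in
  \<open>N\<close>, within \<open>d + 1\<close> of all others, and passing through it gives
  \<open>2 * d + 2\<close>. A component that avoids \<open>N\<close> has diameter at most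
  \<open>d\<close>.\<close>

lemma relpow_add_sparse:
  assumes sym: "sym S" and Y: "Y \<subseteq> Z \<union> N"
    and diam: "\<And>x y. (x, y) \<in> (S \<inter> Z \<times> Z)\<^sup>* \<Longrightarrow> \<exists>m\<le>d. (x, y) \<in> S ^^ m"
    and sparse: "\<And>x y m. \<lbrakk>(x, y) \<in> S ^^ m; m \<le> d + 2; x \<in> N; y \<in> N\<rbrakk> \<Longrightarrow> x = y"
    and xy: "(x, y) \<in> (S \<inter> Y \<times> Y)\<^sup>*"
  shows "\<exists>m\<le>2 * d + 2. (x, y) \<in> S ^^ m"
proof -
  define A where "A = S \<inter> (Y - N) \<times> (Y - N)"
  let ?B = "S \<inter> Y \<times> Y"
  have A: "\<exists>m\<le>d. (x, y) \<in> S ^^ m" if "(x, y) \<in> A\<^sup>*" for x y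
  proof -
    have "A \<subseteq> S \<inter> Z \<times> Z" using Y by (auto simp: A_def)
    then show ?thesis using that diam rtrancl_mono by blast
  qed
  have sym': "sym ?B" using sym by (auto simp: sym_def)
  \<comment> \<open>Invariant along a path from \<open>z\<close>: every return to \<open>N\<close>
    is a return to \<open>z\<close>, so elsewhere the last excursion from \<open>z\<close> has
    stayed outside of \<open>N\<close>.\<close>
  have from_N: "v = z \<or> (v \<notin> N \<and> (\<exists>w. (z, w) \<in> S \<and> (w, v) \<in> A\<^sup>*))"
    if "(z, v) \<in> ?B\<^sup>*" "z \<in> N" for z v
    using that(1)
  proof (induction rule: rtrancl_induct)
    case (step v v')
    show ?case
    proof (cases "v' \<in> N")
      case True
      have "\<exists>m\<le>d + 2. (z, v') \<in> S ^^ m"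
        using step.IH
      proof
        assume "v = z"
        then have "(z, v') \<in> S ^^ 1" using step.hyps by simp
        then show ?thesis by (intro exI[of _ 1]) auto
      next
        assume "v \<notin> N \<and> (\<exists>w. (z, w) \<in> S \<and> (w, v) \<in> A\<^sup>*)"
        then obtain w m where "(z, w) \<in> S" "(w, v) \<in> S ^^ m" "m \<le> d" using A by blast
        then have "(z, v') \<in> S ^^ Suc (Suc m)"
          using step.hyps relpow_Suc_I relpow_Suc_I2 by (metis IntD1)
        then show ?thesis using \<open>m \<le> d\<close> by (intro exI[of _ "Suc (Suc m)"]) auto
      qed
      then show ?thesis using sparse that(2) True by blast
    next
      case False
      have "(z, v') \<in> S" if "v = z" using step.hyps that by simp
      moreover have "(v, v') \<in> A" if "v \<notin> N" using step.hyps that False by (simp add: A_def)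
      ultimately show ?thesis using step.IH False by (meson rtrancl.rtrancl_into_rtrancl rtrancl.rtrancl_refl)
    qed
  qed simp
  have dist_N: "\<exists>m\<le>d + 1. (z, v) \<in> S ^^ m" if "(z, v) \<in> ?B\<^sup>*" "z \<in> N" for z v
    using from_N[OF that]
  proof
    assume "v = z" then show ?thesis by (intro exI[of _ 0]) simp
  next
    assume "v \<notin> N \<and> (\<exists>w. (z, w) \<in> S \<and> (w, v) \<in> A\<^sup>*)"
    then obtain w m where "(z, w) \<in> S" "(w, v) \<in> S ^^ m" "m \<le> d" using A by blast
    moreover from this have "(z, v) \<in> S ^^ Suc m" by (meson relpow_Suc_I2)
    ultimately show ?thesis by (intro exI[of _ "Suc m"]) auto
  qed
  have sym_pow: "(v, u) \<in> S ^^ m" if "(u, v) \<in> S ^^ m" for u v m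
    using that sym
  proof (induction m arbitrary: v)
    case (Suc m)
    then obtain w where "(u, w) \<in> S ^^ m" "(w, v) \<in> S" by auto
    then show ?case using Suc.IH sym by (meson relpow_Suc_I2 symD)
  qed auto
  have "(x, y) \<in> A\<^sup>* \<or> (\<exists>z\<in>N. (x, z) \<in> ?B\<^sup>* \<and> (z, y) \<in> ?B\<^sup>*)"
    using xy
  proof (induction rule: rtrancl_induct)
    case (step v v')
    have "(v, v') \<in> A \<or> v \<in> N \<or> v' \<in> N" using step.hyps by (auto simp: A_def)
    then show ?case
      using step by (meson rtrancl.rtrancl_into_rtrancl rtrancl.rtrancl_refl)
  qed simp
  then show ?thesis
  proof
    assume "(x, y) \<in> A\<^sup>*"
    then obtain m where "m \<le> d" "(x, y) \<in> S ^^ m" using A by blast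
    then show ?thesis by (intro exI[of _ m]) auto
  next
    assume "\<exists>z\<in>N. (x, z) \<in> ?B\<^sup>* \<and> (z, y) \<in> ?B\<^sup>*"
    then obtain z where z: "z \<in> N" "(x, z) \<in> ?B\<^sup>*" "(z, y) \<in> ?B\<^sup>*" by blast
    then have "(z, x) \<in> ?B\<^sup>*" using sym' by (meson sym_rtrancl symD)
    then obtain m where m: "m \<le> d + 1" "(x, z) \<in> S ^^ m" using dist_N z(1) sym_pow by blast
    obtain n where n: "n \<le> d + 1" "(z, y) \<in> S ^^ n" using dist_N z by blast
    have "(x, y) \<in> S ^^ (m + n)" using m n by (auto simp: relpow_add)
    then show ?thesis using m n by (intro exI[of _ "m + n"]) auto
  qed
qed

lemma finite_relpow_Image:
  fixes S :: "'a rel"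
  assumes "finite G" "\<And>x y. (x, y) \<in> S \<Longrightarrow> \<exists>f\<in>G. y = f x"
  shows "finite ((S ^^ n) `` {x})"
proof (induction n)
  case (Suc n)
  have "(S ^^ Suc n) `` {x} \<subseteq> (\<Union>y\<in>(S ^^ n) `` {x}. (\<lambda>f. f y) ` G)"
    using assms(2) by auto blast
  then show ?case using Suc assms(1) by (meson finite_UN_I finite_imageI finite_subset)
qed simp

lemma hyperfinite_of_sparse:
  fixes S :: "'a::{second_countable_topology,t2_space} rel"
  assumes X: "X \<in> sets borel" and S: "S \<in> sets borel" "S \<subseteq> X \<times> X" "sym S"
    and G: "finite G" "\<And>f. f \<in> G \<Longrightarrow> f \<in> borel_measurable borel" "\<And>x y. (x, y) \<in> S \<Longrightarrow> \<exists>f\<in>G. y = f x"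
    and N: "\<And>k. N k \<in> sets borel" "X \<subseteq> (\<Union>k. N k)"
    and sparse: "\<And>k x y m. \<lbrakk>(x, y) \<in> S ^^ m; m \<le> 2 ^ Suc k; x \<in> N k; y \<in> N k\<rbrakk> \<Longrightarrow> x = y"
  shows "hyperfinite X (S\<^sup>* \<inter> X \<times> X)"
proof -
  define Z where "Z k = (\<Union>j<k. N j)" for k
  define A where "A k = S \<inter> Z k \<times> Z k" for k
  \<comment> \<open>The closure is reflexive on the whole type, so points of \<open>X\<close>
    outside of \<open>Z k\<close> form singleton classes and \<open>K k\<close> is an equivalence
    relation on all of \<open>X\<close>.\<close>
  define K where "K k = (A k)\<^sup>* \<inter> X \<times> X" for k
  have Z: "Z k \<in> sets borel" for k unfolding Z_def using N(1) by (intro sets.finite_UN) auto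
  have A: "A k \<in> sets borel" "sym (A k)" for k
    using S borel_Times[OF Z Z] by (auto simp: A_def sym_def)
  have A_G: "\<exists>f\<in>G. y = f x" if "(x, y) \<in> A k" for x y k using that G(3) by (auto simp: A_def)
  have XX: "X \<times> X \<in> sets borel" using borel_Times[OF X X] .
  \<comment> \<open>For \<open>k = 0\<close> the bound is 0, as \<open>Z 0\<close> is empty. The
    step is the recursion of \<open>relpow_add_sparse\<close>, where the scale \<open>d + 2\<close>
    equals \<open>2 ^ Suc k\<close>.\<close>
  have diam: "(x, y) \<in> (A k)\<^sup>* \<Longrightarrow> \<exists>m\<le>2 ^ Suc k - 2. (x, y) \<in> S ^^ m" for k x y
  proof (induction k arbitrary: x y)
    case 0
    then have "x = y" by (simp add: A_def Z_def)
    then show ?case by (intro exI[of _ 0]) simp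
  next
    case (Suc k)
    have two: "(2::nat) ^ Suc k \<ge> 2" by simp
    have "\<exists>m\<le>2 * (2 ^ Suc k - 2) + 2. (x, y) \<in> S ^^ m"
    proof (rule relpow_add_sparse[OF S(3)])
      show "Z (Suc k) \<subseteq> Z k \<union> N k" by (auto simp: Z_def less_Suc_eq)
      show "\<exists>m\<le>2 ^ Suc k - 2. (x, y) \<in> S ^^ m" if "(x, y) \<in> (S \<inter> Z k \<times> Z k)\<^sup>*" for x y
        using Suc.IH that by (simp add: A_def)
      show "x = y" if "(x, y) \<in> S ^^ m" "m \<le> 2 ^ Suc k - 2 + 2" "x \<in> N k" "y \<in> N k" for x y m
        using sparse[OF that(1) _ that(3,4)] that(2) unfolding le_add_diff_inverse2[OF two] by blast
      show "(x, y) \<in> (S \<inter> Z (Suc k) \<times> Z (Suc k))\<^sup>*" using Suc.prems by (simp add: A_def)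
    qed
    moreover have "2 * (2 ^ Suc k - 2) + 2 = (2 ^ Suc (Suc k) - 2 :: nat)"
      using two unfolding power_Suc[of 2 "Suc k"] by arith
    ultimately show ?case by metis
  qed
  have borel_eq: "borel_equiv X (R\<^sup>* \<inter> X \<times> X)"
    if "R \<in> sets borel" "sym R" "\<And>x y. (x, y) \<in> R \<Longrightarrow> \<exists>f\<in>G. y = f x" for R
    using X XX borel_rtrancl[OF countable_finite[OF G(1)] G(2) that(1,3)] equiv_rtrancl_restrict[OF that(2)]
    by (auto simp: borel_equiv_def)
  have "finite (K k `` {x})" for k x
  proof -
    have "K k `` {x} \<subseteq> (\<Union>m\<in>{..2 ^ Suc k - 2}. (S ^^ m) `` {x})"
      using diam by (fastforce simp: K_def)
    then show ?thesis
      by (rule finite_subset) (intro finite_UN_I finite_relpow_Image[OF G(1,3)], auto)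
  qed
  then have fin: "finite_borel_equiv X (K k)" for k
    unfolding finite_borel_equiv_def K_def using borel_eq[OF A(1)[of k] A(2)[of k] A_G[of _ _ k]] by blast
  have inc: "incseq A" unfolding A_def Z_def by (rule incseq_SucI) (auto simp: less_Suc_eq)
  have "incseq K"
    unfolding K_def using inc by (intro monoI) (meson Int_mono monoD order_refl rtrancl_mono)
  moreover have "S\<^sup>* \<inter> X \<times> X = (\<Union>k. K k)"
  proof
    \<comment> \<open>A path has finitely many vertices, each of them in some \<open>N i\<close>, so
      it runs inside some \<open>Z k\<close>.\<close>
    have "\<exists>k. (x, y) \<in> (A k)\<^sup>*" if "(x, y) \<in> S\<^sup>*" for x y
      using that
    proof (induction rule: rtrancl_induct)
      case (step y z)
      obtain k where k: "(x, y) \<in> (A k)\<^sup>*" using step.IH by blast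
      obtain i j where ij: "y \<in> N i" "z \<in> N j" using step.hyps S(2) N(2) by blast
      let ?l = "max k (Suc (max i j))"
      have "y \<in> Z ?l" "z \<in> Z ?l" using ij by (auto simp: Z_def less_Suc_eq_le intro: max.coboundedI2)
      then have "(y, z) \<in> A ?l" using step.hyps by (simp add: A_def)
      moreover have "(x, y) \<in> (A ?l)\<^sup>*"
        using k monoD[OF inc, of k ?l] by (meson max.cobounded1 rtrancl_mono subsetD)
      ultimately show ?case by (meson rtrancl.rtrancl_into_rtrancl)
    qed blast
    then show "S\<^sup>* \<inter> X \<times> X \<subseteq> (\<Union>k. K k)" by (auto simp: K_def)
    have "A k \<subseteq> S" for k by (auto simp: A_def)
    then show "(\<Union>k. K k) \<subseteq> S\<^sup>* \<inter> X \<times> X" unfolding K_def using rtrancl_mono by blast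
  qed
  moreover have "countable ((S\<^sup>* \<inter> X \<times> X) `` {x})" for x
  proof -
    have "(S\<^sup>* \<inter> X \<times> X) `` {x} \<subseteq> (\<Union>n. (S ^^ n) `` {x})" by (auto simp: rtrancl_is_UN_relpow)
    then show ?thesis
      by (rule countable_subset) (rule countable_UN[OF _ countable_finite[OF finite_relpow_Image[OF G(1,3)]]], auto)
  qed
  ultimately show ?thesis
    unfolding hyperfinite_def countable_borel_equiv_def using fin borel_eq[OF S(1,3) G(3)] by blast
qed

text \<open>Each \<open>y\<close> in the class is counted at the least \<open>n\<close> with
  \<open>y = g n x\<close>. The set of all \<open>x\<close> at which \<open>n\<close> is such an
  index is Borel, and the cardinality is the sum of the indicators of these sets.\<close>

lemma card_class_measurable:
  fixes F :: "'a::{second_countable_topology,t2_space} rel" and g :: "nat \<Rightarrow> 'a \<Rightarrow> 'a"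
  assumes F: "F \<in> sets borel" "\<And>x. finite (F `` {x})"
    and g: "\<And>n. g n \<in> borel_measurable borel" "\<And>x y. (x, y) \<in> F \<Longrightarrow> \<exists>n. y = g n x"
  shows "(\<lambda>x. real (card (F `` {x}))) \<in> borel_measurable borel"
proof -
  let ?I = "\<lambda>x. {n. (x, g n x) \<in> F \<and> (\<forall>j<n. g j x \<noteq> g n x)}"
  have bij: "bij_betw (\<lambda>n. g n x) (?I x) (F `` {x})" for x
    unfolding bij_betw_def
  proof
    show "inj_on (\<lambda>n. g n x) (?I x)"
      unfolding inj_on_def by (auto, metis linorder_neqE_nat)
    show "(\<lambda>n. g n x) ` ?I x = F `` {x}"
    proof
      show "F `` {x} \<subseteq> (\<lambda>n. g n x) ` ?I x"
      proof
        fix y assume y: "y \<in> F `` {x}"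
        then have ex: "\<exists>n. g n x = y" using g(2) by auto
        define n where "n = (LEAST n. g n x = y)"
        have n: "g n x = y" unfolding n_def using LeastI_ex[OF ex] .
        have "g j x \<noteq> y" if "j < n" for j using that not_less_Least unfolding n_def by blast
        then have "n \<in> ?I x" using n y by simp
        then show "y \<in> (\<lambda>n. g n x) ` ?I x" using n by (rule image_eqI[rotated, OF _ sym])
      qed
    qed auto
  qed
  have fin: "finite (?I x)" for x using bij_betw_finite[OF bij] F(2) by blast
  have "real (card (F `` {x})) = (\<Sum>n. of_bool (n \<in> ?I x))" for x
  proof -
    have "(\<Sum>n. of_bool (n \<in> ?I x) :: real) = (\<Sum>n\<in>?I x. of_bool (n \<in> ?I x))"
      by (rule suminf_finite[OF fin]) auto
    also have "\<dots> = real (card (?I x))" by simp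
    finally show ?thesis using bij_betw_same_card[OF bij, of x] by simp
  qed
  moreover have "(\<lambda>x. \<Sum>n. of_bool (n \<in> ?I x) :: real) \<in> borel_measurable borel"
  proof (rule borel_measurable_suminf)
    fix n
    have "{x. n \<in> ?I x} = {x. (x, g n x) \<in> F} \<inter> (\<Inter>j\<in>{..<n}. UNIV - {x. (g j x, g n x) \<in> Id_on UNIV})"
      by (auto simp: Id_on_iff)
    also have "\<dots> \<in> sets borel"
      using borel_pair_vimage[OF F(1) _ g(1), of "\<lambda>x. x" n]
        borel_pair_vimage[OF borel_Id_on g(1) g(1)]
      by (cases "n = 0") (auto intro!: sets.Int sets.finite_INT sets.Diff)
    finally have "{x. n \<in> ?I x} \<in> sets borel" .
    then have "indicator {x. n \<in> ?I x} \<in> borel_measurable (borel :: 'a measure)"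
      by (rule borel_measurable_indicator)
    then show "(\<lambda>x. of_bool (n \<in> ?I x) :: real) \<in> borel_measurable borel"
      by (simp add: indicator_def[abs_def])
  qed
  ultimately show ?thesis by (simp only:)
qed

text \<open>\<open>h\<close> gives the uniform distribution on the class of \<open>x\<close> in
  \<open>F n k\<close>. Equivalent \<open>x\<close> and \<open>y\<close> lie in a common class once
  \<open>n\<close> and then \<open>k\<close> are large enough, so the differences are not merely
  small but eventually 0.\<close>

lemma frechet_amenable_UN_hyperfinite:
  fixes E :: "nat \<Rightarrow> 'a::{second_countable_topology,t2_space} rel" and g :: "nat \<Rightarrow> 'a \<Rightarrow> 'a"
  assumes E: "\<And>n. hyperfinite X (E n)" "incseq E" and R: "R = (\<Union>n. E n)" "countable_borel_equiv X R"
    and g: "\<And>n. g n \<in> borel_measurable borel" "\<And>x y. (x, y) \<in> R \<Longrightarrow> \<exists>n. y = g n x"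
  shows "frechet_amenable X R"
proof -
  have "\<exists>F. (\<forall>k. finite_borel_equiv X (F k)) \<and> incseq F \<and> E n = (\<Union>k. F k)" for n
    using E(1) by (auto simp: hyperfinite_def)
  then obtain F where F: "\<And>n k. finite_borel_equiv X (F n k)" "\<And>n. incseq (F n)" "\<And>n. E n = (\<Union>k. F n k)"
    by metis
  have eq: "equiv X (F n k)" and F_borel: "F n k \<in> sets borel" for n k
    using F(1) by (auto simp: finite_borel_equiv_def borel_equiv_def)
  have sub: "F n k \<subseteq> R" for n k using F(3) R(1) by blast
  have fin: "finite (F n k `` {x})" for n k x
  proof (cases "x \<in> X")
    case True then show ?thesis using F(1) by (auto simp: finite_borel_equiv_def)
  next
    case False
    then have "F n k `` {x} = {}" using equiv_type[OF eq, of n k] by auto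
    then show ?thesis by simp
  qed
  define h where "h i = (\<lambda>(x, y). case prod_decode i of (n, k) \<Rightarrow>
    of_bool ((x, y) \<in> F n k) / real (card (F n k `` {x})))" for i
  have h: "h (prod_encode (n, k)) (x, y) = of_bool ((x, y) \<in> F n k) / real (card (F n k `` {x}))" for n k x y
    by (simp add: h_def)
  have h': "h i (x, y) = (case prod_decode i of (n, k) \<Rightarrow> of_bool ((x, y) \<in> F n k) / real (card (F n k `` {x})))" for i x y
    by (simp add: h_def)
  have "filter_amenable (filter_sum (\<lambda>_. cofinite)) X R"
    unfolding filter_amenable_def
  proof (intro conjI exI[of _ h] allI ballI)
    show "countable_borel_equiv X R" by (fact R(2))
    show "0 \<le> h i p" for i p by (cases p) (auto simp: h' split: prod.split)
    show "h i \<in> borel_measurable (restrict_space borel R)" for i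
    proof -
      obtain n k where i: "prod_decode i = (n, k)" by fastforce
      have "(\<lambda>x. real (card (F n k `` {x}))) \<in> borel_measurable borel"
        by (rule card_class_measurable[where g = g]) (use F_borel fin g sub in blast)+
      then have card: "(\<lambda>p :: 'a \<times> 'a. real (card (F n k `` {fst p}))) \<in> borel_measurable borel"
        using measurable_compose[of fst borel borel] by (simp add: measurable_fst flip: borel_prod)
      have "(\<lambda>p. indicator (F n k) p / real (card (F n k `` {fst p}))) \<in> borel_measurable borel"
        using borel_measurable_divide[OF borel_measurable_indicator[OF F_borel[of n k]] card] .
      moreover have "(\<lambda>p. indicator (F n k) p / real (card (F n k `` {fst p}))) = h i"
        by (auto simp: h_def i fun_eq_iff indicator_def)
      ultimately show ?thesis by (auto intro: measurable_restrict_space1)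
    qed
    show "((\<lambda>y. h i (x, y)) has_sum 1) (R `` {x})" if x: "x \<in> X" for i x
    proof -
      obtain n k where i: "prod_decode i = (n, k)" by fastforce
      show ?thesis
      proof (rule has_sum_finite_neutralI[of "F n k `` {x}"])
        have "x \<in> F n k `` {x}" using equiv_class_self[OF eq x] .
        then have "card (F n k `` {x}) > 0" using fin card_gt_0_iff by blast
        then show "1 = (\<Sum>y\<in>F n k `` {x}. h i (x, y))" by (simp add: h' i)
        show "F n k `` {x} \<subseteq> R `` {x}" using sub by blast
      qed (auto simp: h' i fin)
    qed
    fix p assume p: "p \<in> R"
    obtain x y where xy: "p = (x, y)" by fastforce
    have "eventually (\<lambda>i. (\<Sum>\<^sub>\<infinity>z\<in>R `` {x}. \<bar>h i (x, z) - h i (y, z)\<bar>) = 0) (filter_sum (\<lambda>_. cofinite))"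
      unfolding eventually_filter_sum cofinite_eq_sequentially
    proof -
      obtain n0 where n0: "(x, y) \<in> E n0" using p xy R(1) by blast
      show "\<forall>\<^sub>F n in sequentially. \<forall>\<^sub>F k in sequentially.
          (\<Sum>\<^sub>\<infinity>z\<in>R `` {x}. \<bar>h (prod_encode (n, k)) (x, z) - h (prod_encode (n, k)) (y, z)\<bar>) = 0"
      proof (rule eventually_sequentiallyI[of n0])
        fix n assume "n0 \<le> n"
        then have "(x, y) \<in> E n" using n0 E(2) by (meson monoD subsetD)
        then obtain k0 where k0: "(x, y) \<in> F n k0" using F(3) by blast
        show "\<forall>\<^sub>F k in sequentially.
          (\<Sum>\<^sub>\<infinity>z\<in>R `` {x}. \<bar>h (prod_encode (n, k)) (x, z) - h (prod_encode (n, k)) (y, z)\<bar>) = 0"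
        proof (rule eventually_sequentiallyI[of k0])
          fix k assume "k0 \<le> k"
          then have "(x, y) \<in> F n k" using k0 F(2) by (meson monoD subsetD)
          then have "F n k `` {x} = F n k `` {y}" by (rule equiv_class_eq[OF eq])
          moreover from this have "(x, z) \<in> F n k \<longleftrightarrow> (y, z) \<in> F n k" for z by blast
          ultimately show "(\<Sum>\<^sub>\<infinity>z\<in>R `` {x}. \<bar>h (prod_encode (n, k)) (x, z) - h (prod_encode (n, k)) (y, z)\<bar>) = 0"
            by (simp add: h)
        qed
      qed
    qed
    then show "case p of (x, y) \<Rightarrow> ((\<lambda>n. \<Sum>\<^sub>\<infinity>z\<in>R `` {x}. \<bar>h n (x, z) - h n (y, z)\<bar>) \<longlongrightarrow> 0) (filter_sum (\<lambda>_. cofinite))"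
      unfolding xy prod.case by (rule tendsto_eventually)
  qed
  moreover have "iterated_frechet (hsucc (hnat 1)) (filter_sum (\<lambda>_. cofinite))"
    by (intro iterated_frechet.intros)
  ultimately show ?thesis unfolding frechet_amenable_def by blast
qed

section \<open>The equivalence relation of equal generic extensions\<close>

lemma borel_countable_Ball:
  assumes "countable I" "\<And>i. i \<in> I \<Longrightarrow> {x. P i x} \<in> sets borel"
  shows "{x. \<forall>i\<in>I. P i x} \<in> sets borel"
proof (cases "I = {}")
  case False
  have "{x. \<forall>i\<in>I. P i x} = (\<Inter>i\<in>I. {x. P i x})" by auto
  also have "\<dots> \<in> sets borel" using assms False by (intro sets.countable_INT') auto
  finally show ?thesis .
qed simp

lemma borel_countable_Bex:
  assumes "countable I" "\<And>i. i \<in> I \<Longrightarrow> {x. P i x} \<in> sets borel"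
  shows "{x. \<exists>i\<in>I. P i x} \<in> sets borel"
proof -
  have "{x. \<exists>i\<in>I. P i x} = (\<Union>i\<in>I. {x. P i x})" by auto
  then show ?thesis using assms by (simp add: sets.countable_UN'')
qed

lemma borel_conj:
  "{x. P x} \<in> sets borel \<Longrightarrow> {x. Q x} \<in> sets borel \<Longrightarrow> {x. P x \<and> Q x} \<in> sets borel"
  using sets.Int[of "{x. P x}" borel "{x. Q x}"] by (simp add: Collect_conj_eq)

lemma borel_not: "{x. P x} \<in> sets borel \<Longrightarrow> {x. \<not> P x} \<in> sets borel"
  using sets.compl_sets[of "{x. P x}" borel] by (simp add: Collect_neg_eq Compl_eq_Diff_UNIV)

lemma borel_imp:
  "{x. P x} \<in> sets borel \<Longrightarrow> {x. Q x} \<in> sets borel \<Longrightarrow> {x. P x \<longrightarrow> Q x} \<in> sets borel"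
proof -
  assume "{x. P x} \<in> sets borel" "{x. Q x} \<in> sets borel"
  then have "{x. \<not> (P x \<and> \<not> Q x)} \<in> sets borel" by (intro borel_not borel_conj)
  then show ?thesis by simp
qed

lemma borel_const: "{x. b} \<in> sets borel"
  by (cases b) auto

lemmas borel_logic = borel_countable_Ball borel_countable_Bex borel_conj borel_not borel_imp borel_const

lemma borel_pfx: "{x. pfx s x} \<in> sets borel"
  by (intro borel_open open_pfx)

lemma borel_interp: "interp UNIV c \<in> sets borel"
proof (induction c)
  case (Basic s) show ?case using borel_pfx[of s] by simp
next
  case (Complement c) then show ?case by (simp add: sets.Diff)
next
  case (CUnion f) then show ?case by (auto intro: sets.countable_UN)
qed

lemma borel_fst_snd:
  assumes "{x :: 'a. P x} \<in> sets borel"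
  shows "{p :: 'a::second_countable_topology \<times> 'a. P (fst p)} \<in> sets borel"
    and "{p :: 'a \<times> 'a. P (snd p)} \<in> sets borel"
proof -
  have "{p :: 'a \<times> 'a. P (fst p)} = {x. P x} \<times> UNIV" "{p :: 'a \<times> 'a. P (snd p)} = UNIV \<times> {x. P x}"
    by auto
  then show "{p :: 'a \<times> 'a. P (fst p)} \<in> sets borel" "{p :: 'a \<times> 'a. P (snd p)} \<in> sets borel"
    using borel_Times[OF assms, of UNIV] borel_Times[OF _ assms, of UNIV] by simp_all
qed

context ctm
begin

text \<open>Serves to show that only countably many codes lie in \<open>M\<close>; the whole type
  \<open>bcode\<close> is uncountable.\<close>

lemma hcode_inject: "hcode c = hcode d \<Longrightarrow> c = d"
proof (induction c arbitrary: d)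
  case (Basic s) then show ?case by (cases d) (auto simp: hcode_Basic)
next
  case (Complement c) then show ?case by (cases d) (auto simp: hcode_Basic)
next
  case (CUnion f)
  then show ?case by (cases d) (auto simp: hcode_Basic fun_eq_iff)
qed

lemma countable_subsets_in: "countable (subsets_in M)"
proof -
  have "countable (hreals ` subsets_in M)"
    by (rule countable_subset[OF _ countable_M]) (auto simp: subsets_in_def)
  then show ?thesis
    by (rule countable_image_inj_on) (auto simp: inj_on_def subsets_in_def dest: hreals_inj)
qed

lemma countable_cohen_poset: "countable (cohen_poset M)"
  by (rule countable_subset[OF _ countable_subsets_in]) (auto simp: cohen_poset_def borel_in_def)

lemma countable_codes: "countable {c. hcode c \<in> M}"
proof -
  have "countable (hcode ` {c. hcode c \<in> M})"
    by (rule countable_subset[OF _ countable_M]) auto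
  then show ?thesis by (rule countable_image_inj_on) (auto simp: inj_on_def dest: hcode_inject)
qed

lemma borel_mem_filter: "{x. p \<in> cohen_filter M x} \<in> sets borel"
proof -
  let ?C = "{c. hcode c \<in> M \<and> p = interp (cantor_in M) c \<and> p \<in> cohen_poset M}"
  have "{x. p \<in> cohen_filter M x} = (\<Union>c\<in>?C. interp UNIV c)"
    by (auto simp: cohen_filter_def)
  also have "\<dots> \<in> sets borel"
    by (intro sets.countable_UN'' borel_interp countable_subset[OF _ countable_codes]) auto
  finally show ?thesis .
qed

text \<open>Genericity quantifies over conditions and over dense sets in \<open>M\<close>, which are
  countably many from outside. \<open>K\<close> rewrites it so that the range of every quantifier is
  countable and independent of \<open>x\<close>.\<close>

lemma borel_cohen_reals: "cohen_reals M \<in> sets borel"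
proof -
  let ?P = "cohen_poset M" and ?D = "{D. dense_subset (cohen_poset M) D \<and> hfamily D \<in> M}"
  let ?G = "cohen_filter M"
  have D: "countable ?D"
  proof -
    have sub: "D \<subseteq> subsets_in M" if "D \<in> ?D" for D
      using that by (auto simp: dense_subset_def cohen_poset_def borel_in_def)
    have "D = E" if "D \<in> ?D" "E \<in> ?D" "hfamily D = hfamily E" for D E
    proof -
      have "hreals ` D = hreals ` E" using that elts_hfamily sub by metis
      moreover have "inj_on hreals (subsets_in M)"
        by (auto simp: inj_on_def subsets_in_def dest: hreals_inj)
      ultimately show ?thesis using sub that by (meson inj_on_image_eq_iff)
    qed
    then have "inj_on hfamily ?D" by (simp add: inj_on_def)
    moreover have "countable (hfamily ` ?D)" by (rule countable_subset[OF _ countable_M]) auto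
    ultimately show ?thesis by (rule countable_image_inj_on[rotated])
  qed
  have cD: "countable d" if "d \<in> ?D" for d
    using that by (intro countable_subset[OF _ countable_cohen_poset]) (auto simp: dense_subset_def)
  have sub: "?G x \<subseteq> ?P" for x by (auto simp: cohen_filter_def)
  define K where "K x \<longleftrightarrow> (\<exists>p\<in>?P. p \<in> ?G x) \<and> (\<forall>p\<in>?P. \<forall>q\<in>?P. p \<subseteq> q \<longrightarrow> p \<in> ?G x \<longrightarrow> q \<in> ?G x) \<and>
      (\<forall>p\<in>?P. \<forall>q\<in>?P. p \<in> ?G x \<and> q \<in> ?G x \<longrightarrow> (\<exists>r\<in>?P. r \<in> ?G x \<and> r \<subseteq> p \<and> r \<subseteq> q)) \<and>
      (\<forall>D\<in>?D. \<exists>d\<in>D. d \<in> ?G x)" for x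
  have "x \<in> cohen_reals M \<longleftrightarrow> K x" for x
  proof -
    note G = sub[of x]
    have "?G x \<noteq> {} \<longleftrightarrow> (\<exists>p\<in>?P. p \<in> ?G x)" using G by blast
    moreover have "(\<forall>p\<in>?G x. \<forall>q\<in>?P. p \<subseteq> q \<longrightarrow> q \<in> ?G x) \<longleftrightarrow>
        (\<forall>p\<in>?P. \<forall>q\<in>?P. p \<subseteq> q \<longrightarrow> p \<in> ?G x \<longrightarrow> q \<in> ?G x)" using G by blast
    moreover have "(\<forall>p\<in>?G x. \<forall>q\<in>?G x. \<exists>r\<in>?G x. r \<subseteq> p \<and> r \<subseteq> q) \<longleftrightarrow>
        (\<forall>p\<in>?P. \<forall>q\<in>?P. p \<in> ?G x \<and> q \<in> ?G x \<longrightarrow> (\<exists>r\<in>?P. r \<in> ?G x \<and> r \<subseteq> p \<and> r \<subseteq> q))"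
      using G by (meson subsetD)
    moreover have "(\<forall>D. dense_subset ?P D \<and> hfamily D \<in> M \<longrightarrow> ?G x \<inter> D \<noteq> {}) \<longleftrightarrow> (\<forall>D\<in>?D. \<exists>d\<in>D. d \<in> ?G x)"
      by (simp add: Int_commute disjoint_iff Bex_def)
    ultimately show ?thesis
      unfolding cohen_reals_def generic_filter_def is_filter_on_def K_def using G by simp
  qed
  then have "cohen_reals M = {x. K x}" by blast
  also have "\<dots> \<in> sets borel"
    unfolding K_def
    by (intro borel_logic borel_mem_filter countable_cohen_poset D cD)
  finally show ?thesis .
qed

lemma borel_gen: "{x. a \<in> gen x} \<in> sets borel"
  unfolding gen_iff by (intro borel_logic borel_mem_filter)

text \<open>Extensionality reduces equality of two values to the members of both names, with
  countable quantifiers and Borel conditions on membership in \<open>gen x\<close>. The induction is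
  on \<open>t\<close> for all \<open>s\<close>, along the transitive closure of membership because a
  member name sits inside a pair.\<close>

lemma borel_val_eq: "{p. val (gen (fst p)) t = val (gen (snd p)) s} \<in> sets borel"
proof (induction t arbitrary: s rule: wf_induct_rule[OF wf_trancl[OF wf_elts]])
  case (1 t)
  let ?T = "{(u, a). hpair u a \<in> elts t}" and ?S = "{(u, a). hpair u a \<in> elts s}"
  have eq: "val G t = val H s \<longleftrightarrow>
      (\<forall>p\<in>?T. snd p \<in> G \<longrightarrow> (\<exists>q\<in>?S. snd q \<in> H \<and> val G (fst p) = val H (fst q))) \<and>
      (\<forall>q\<in>?S. snd q \<in> H \<longrightarrow> (\<exists>p\<in>?T. snd p \<in> G \<and> val G (fst p) = val H (fst q)))" (is "_ \<longleftrightarrow> ?R") for G H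
  proof -
    have "val G t = val H s \<longleftrightarrow> elts (val G t) = elts (val H s)" using hc_ext by metis
    also have "\<dots> \<longleftrightarrow> ?R" unfolding elts_val by (auto simp: set_eq_iff image_iff) (metis | blast)+
    finally show ?thesis .
  qed
  have less: "(fst p, t) \<in> {(a, b). a \<in> elts b}\<^sup>+" if "p \<in> ?T" for p
  proof -
    obtain u a where p: "p = (u, a)" "hpair u a \<in> elts t" using \<open>p \<in> ?T\<close> by auto
    have "(u, hset {u}) \<in> {(a, b). a \<in> elts b}" "(hset {u}, hpair u a) \<in> {(a, b). a \<in> elts b}"
      "(hpair u a, t) \<in> {(a, b). a \<in> elts b}" using p(2) by (auto simp: hpair_def)
    then show ?thesis unfolding p by (metis fst_conv r_into_trancl trancl_into_trancl)
  qed
  show ?case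
    unfolding eq
    by (intro borel_logic countable_hpairs borel_fst_snd[OF borel_gen] 1 less)
qed

lemma cohen_equiv_subset: "cohen_equiv M \<subseteq> cohen_reals M \<times> cohen_reals M"
  by (auto simp: cohen_equiv_def)

lemma equiv_cohen_equiv: "equiv (cohen_reals M) (cohen_equiv M)"
  by (rule equivI) (auto simp: cohen_equiv_def refl_on_def sym_def trans_def)

text \<open>\<open>M[x] = M[y]\<close> means that each name at \<open>x\<close> has the value of
  some name at \<open>y\<close> and conversely, which are quantifiers over the countable set
  \<open>M\<close> applied to \<open>borel_val_eq\<close>.\<close>

lemma borel_cohen_equiv: "cohen_equiv M \<in> sets borel"
proof -
  have "cohen_equiv M = {p. fst p \<in> cohen_reals M \<and> snd p \<in> cohen_reals M \<and>
      (\<forall>t\<in>M. \<exists>s\<in>M. val (gen (fst p)) t = val (gen (snd p)) s) \<and>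
      (\<forall>s\<in>M. \<exists>t\<in>M. val (gen (fst p)) t = val (gen (snd p)) s)}"
  proof -
    have "f ` M = g ` M \<longleftrightarrow> (\<forall>t\<in>M. \<exists>s\<in>M. f t = g s) \<and> (\<forall>s\<in>M. \<exists>t\<in>M. f t = g s)" for f g :: "hc \<Rightarrow> hc"
      unfolding set_eq_subset image_subset_iff image_iff by metis
    note image_eq = this
    show ?thesis unfolding cohen_equiv_def generic_ext_eq image_eq by (auto simp: split_beta)
  qed
  also have "\<dots> \<in> sets borel"
    using borel_cohen_reals
    by (intro borel_logic borel_fst_snd countable_M borel_val_eq) auto
  finally show ?thesis .
qed

lemma decode_measurable: "decode Q \<in> borel_measurable borel"
proof (rule measurable_coordinatewise_then_product)
  fix n
  have "{x. decode Q x n} = (\<Union>s\<in>{s. hpair (hstr s) (hnat n) \<in> elts Q}. {x. pfx s x})"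
    by (auto simp: decode_def)
  also have "\<dots> \<in> sets borel" by (intro sets.countable_UN'' borel_pfx) auto
  finally have *: "{x. decode Q x n} \<in> sets borel" .
  show "(\<lambda>x. decode Q x n) \<in> borel_measurable borel"
  proof (rule measurableI)
    fix A :: "bool set"
    have "(\<lambda>x. decode Q x n) -` A = {x. (decode Q x n \<longrightarrow> True \<in> A) \<and> (\<not> decode Q x n \<longrightarrow> False \<in> A)}"
    proof (rule set_eqI)
      fix x
      show "x \<in> (\<lambda>x. decode Q x n) -` A \<longleftrightarrow>
          x \<in> {x. (decode Q x n \<longrightarrow> True \<in> A) \<and> (\<not> decode Q x n \<longrightarrow> False \<in> A)}"
        by (cases "decode Q x n") simp_all
    qed
    also have "\<dots> \<in> sets borel" by (intro borel_logic *)
    finally show "(\<lambda>x. decode Q x n) -` A \<inter> space borel \<in> sets borel" by simp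
  qed simp
qed

end

text \<open>Bijective base 2 with the first letter as lowest digit: strings of length n get the
  indices from \<open>2 ^ n - 1\<close> to \<open>2 ^ Suc n - 2\<close>. This enumeration is made
  outside of \<open>M\<close>.\<close>

primrec string_index :: "bool list \<Rightarrow> nat" where
  "string_index [] = 0"
| "string_index (b # s) = 2 * string_index s + 1 + of_bool b"

lemma string_index_inject: "string_index s = string_index t \<Longrightarrow> s = t"
proof (induction s arbitrary: t)
  case Nil then show ?case by (cases t) auto
next
  case (Cons b s)
  then obtain a r where t: "t = a # r" by (cases t) auto
  have "a = b \<and> string_index s = string_index r"
    using Cons.prems unfolding t by (cases a; cases b; simp; presburger)
  then show ?case using Cons.IH t by blast
qed

lemma string_index_less: "string_index s + 2 \<le> 2 ^ Suc (length s)"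
  by (induction s) (auto simp: of_bool_def)

lemma relpow_subset: "(R :: 'a rel) \<subseteq> S \<Longrightarrow> R ^^ n \<subseteq> S ^^ n"
  by (induction n) (auto intro: relcomp_mono[THEN subsetD])

theorem theorem3p1:
  fixes M :: "hc set"
  assumes "ctm_ZFC M"
  shows "(\<exists>E :: nat \<Rightarrow> (nat \<Rightarrow> bool) rel.
            (\<forall>n. hyperfinite (cohen_reals M) (E n)) \<and> incseq E \<and>
            cohen_equiv M = (\<Union>n. E n)) \<and>
         frechet_amenable (cohen_reals M) (cohen_equiv M)"
proof -
  interpret ctm M by standard (fact assms)
  let ?X = "cohen_reals M" and ?R = "cohen_equiv M"
  have "countable {Q. real_code Q}"
    by (rule countable_subset[OF _ countable_M]) (auto simp: real_code_def)
  moreover have "{Q. real_code Q} \<noteq> {}" using real_code_hident by blast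
  ultimately obtain q :: "nat \<Rightarrow> hc" where q: "range q = {Q. real_code Q}"
    by (metis uncountable_def)
  have q_code: "real_code (q n)" for n using q by blast
  have cover: "\<exists>n. y = decode (q n) x" if "(x, y) \<in> ?R" for x y
  proof -
    have "x \<in> ?X" "y \<in> ?X" "generic_ext M x = generic_ext M y"
      using that by (auto simp: cohen_equiv_def)
    then obtain Q where "real_code Q" "decode Q x = y" by (rule generic_ext_decode)
    then show ?thesis using q by (metis (mono_tags) mem_Collect_eq rangeE)
  qed
  note eq = equiv_cohen_equiv
  have symR: "(y, x) \<in> ?R" if "(x, y) \<in> ?R" for x y
    using that by (auto simp: cohen_equiv_def)
  \<comment> \<open>With both directions required, \<open>S n\<close> is symmetric and every
    neighbour of a point is one of at most \<open>n\<close> images of it.\<close>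
  define S where "S n = ?R \<inter> {p. (\<exists>i<n. snd p = decode (q i) (fst p)) \<and> (\<exists>i<n. fst p = decode (q i) (snd p))}" for n
  have S_borel: "S n \<in> sets borel" for n
  proof -
    have fst: "fst \<in> borel_measurable (borel :: (real2 \<times> real2) measure)"
      and snd: "snd \<in> borel_measurable (borel :: (real2 \<times> real2) measure)"
      by (simp_all add: measurable_fst measurable_snd flip: borel_prod)
    note d = measurable_compose[OF fst decode_measurable] measurable_compose[OF snd decode_measurable]
    have "{p :: real2 \<times> real2. (snd p, decode Q (fst p)) \<in> Id_on UNIV} \<in> sets borel"
      "{p :: real2 \<times> real2. (fst p, decode Q (snd p)) \<in> Id_on UNIV} \<in> sets borel" for Q
      using borel_pair_vimage[OF borel_Id_on[of UNIV] snd d(1)] borel_pair_vimage[OF borel_Id_on[of UNIV] fst d(2)]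
      by simp_all
    then have eqs: "{p :: real2 \<times> real2. snd p = decode Q (fst p)} \<in> sets borel"
      "{p :: real2 \<times> real2. fst p = decode Q (snd p)} \<in> sets borel" for Q
      by (simp_all add: Id_on_iff)
    have "S n = ?R \<inter> {p. (\<exists>i\<in>{..<n}. snd p = decode (q i) (fst p)) \<and> (\<exists>i\<in>{..<n}. fst p = decode (q i) (snd p))}"
      by (auto simp: S_def)
    also have "\<dots> \<in> sets borel"
      by (intro sets.Int borel_cohen_equiv borel_logic eqs) auto
    finally show ?thesis .
  qed
  define E where "E n = (S n)\<^sup>* \<inter> ?X \<times> ?X" for n
  have hyp: "hyperfinite ?X (E n)" for n
  proof -
    let ?F = "q ` {..<n}"
    obtain c :: "bool list \<Rightarrow> bool list" where
      c: "\<And>x. x \<in> ?X \<Longrightarrow> \<exists>t. pfx (c t) x"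
      "\<And>t x y m. \<lbrakk>x \<in> ?X; (x, y) \<in> moves ?F ^^ m; m \<le> 2 ^ (2 ^ Suc (length t)); pfx (c t) x; pfx (c t) y\<rbrakk> \<Longrightarrow> x = y"
      by (rule sparse_strings[of ?F]) (use q_code in auto)
    \<comment> \<open>The index determines the string, so this is at most one cylinder.\<close>
    let ?N = "\<lambda>k. {x. \<exists>t. string_index t = k \<and> pfx (c t) x}"
    have S_moves: "S n \<subseteq> moves ?F" using cohen_equiv_subset by (auto simp: S_def moves_def)
    show ?thesis
      unfolding E_def
    proof (rule hyperfinite_of_sparse[where G = "decode ` ?F" and N = ?N])
      show "S n \<subseteq> ?X \<times> ?X" using cohen_equiv_subset by (auto simp: S_def)
      show "sym (S n)" using symR by (auto simp: S_def sym_def)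
      show "\<exists>f\<in>decode ` ?F. y = f x" if "(x, y) \<in> S n" for x y using that by (auto simp: S_def)
      show "?N k \<in> sets borel" for k
      proof -
        have "?N k = (\<Union>t\<in>{t. string_index t = k}. {x. pfx (c t) x})" by auto
        then show ?thesis by (simp add: sets.countable_UN'' borel_pfx)
      qed
      show "?X \<subseteq> (\<Union>k. ?N k)" using c(1) by auto
      fix k x y m
      assume xy: "(x, y) \<in> S n ^^ m" and m: "m \<le> 2 ^ Suc k" and "x \<in> ?N k" "y \<in> ?N k"
      then obtain t where t: "string_index t = k" "pfx (c t) x" "pfx (c t) y"
        using string_index_inject by blast
      show "x = y"
      \<comment> \<open>Points of \<open>?N k\<close> need not be Cohen reals; for positive
        \<open>m\<close> the first edge shows that \<open>x\<close> is one.\<close>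
      proof (cases "m = 0")
        case True then show ?thesis using xy by simp
      next
        case False
        then obtain j where "m = Suc j" by (cases m) auto
        then obtain z where "(x, z) \<in> S n" using xy by (meson relpow_Suc_D2)
        then have "x \<in> ?X" using \<open>S n \<subseteq> ?X \<times> ?X\<close> by auto
        moreover have "(x, y) \<in> moves ?F ^^ m" using xy relpow_subset[OF S_moves] by blast
        \<comment> \<open>Here the doubly exponential bound of \<open>sparse_strings\<close> absorbs
          the index of \<open>t\<close>.\<close>
        moreover have "Suc k \<le> 2 ^ Suc (length t)" using string_index_less[of t] t(1) by simp
        then have "m \<le> 2 ^ (2 ^ Suc (length t))"
          using m by (meson le_trans one_le_numeral power_increasing)
        ultimately show ?thesis using c(2) t by blast
      qed
    qed (auto simp: borel_cohen_reals S_borel decode_measurable)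
  qed
  have inc: "incseq E"
  proof (rule incseq_SucI)
    fix n
    have "S n \<subseteq> S (Suc n)" by (auto simp: S_def less_Suc_eq)
    then show "E n \<subseteq> E (Suc n)" unfolding E_def using rtrancl_mono by blast
  qed
  have union: "?R = (\<Union>n. E n)"
  proof
    show "?R \<subseteq> (\<Union>n. E n)"
    proof (rule subrelI)
      fix x y assume xy: "(x, y) \<in> ?R"
      obtain i j where "y = decode (q i) x" "x = decode (q j) y"
        using cover[OF xy] cover[OF symR[OF xy]] by blast
      then have "(x, y) \<in> S (Suc (max i j))"
        using xy by (auto simp: S_def less_Suc_eq_le intro: max.cobounded1 max.cobounded2)
      then show "(x, y) \<in> (\<Union>n. E n)" using xy cohen_equiv_subset by (auto simp: E_def)
    qed
    show "(\<Union>n. E n) \<subseteq> ?R"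
    proof (clarsimp simp: E_def)
      fix n x y assume "(x, y) \<in> (S n)\<^sup>*" "x \<in> ?X"
      then show "(x, y) \<in> ?R"
      proof (induction rule: rtrancl_induct)
        case base then show ?case by (simp add: cohen_equiv_def)
      next
        case (step y z)
        then show ?case by (auto simp: S_def cohen_equiv_def)
      qed
    qed
  qed
  have "countable_borel_equiv ?X ?R"
    unfolding countable_borel_equiv_def borel_equiv_def
  proof (intro conjI ballI borel_cohen_reals borel_cohen_equiv eq)
    fix x
    have "?R `` {x} \<subseteq> (\<lambda>n. decode (q n) x) ` UNIV" using cover by blast
    then show "countable (?R `` {x})" by (rule countable_subset) simp
  qed
  then have "frechet_amenable ?X ?R"
    by (intro frechet_amenable_UN_hyperfinite[where g = "\<lambda>n. decode (q n)", OF hyp inc union])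
      (auto simp: decode_measurable intro: cover)
  then show ?thesis using hyp inc union by blast
qed

end
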